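(* For every $j\ge1$: (1) $\lambda_j(\mathrm{Lag}(\mathcal V,\Omega))=(\lambda_{j-2n}(\Lambda_D),\lambda_j(\Lambda_D)]$; (2) $\lambda_j(\Sigma_0)=(\lambda_{j-2n}(\Lambda_D),\lambda_j(\Lambda_D))$. Here $\lambda_j(S)=\{\lambda_j(\Lambda):\Lambda\in S\}$ and $\lambda_i(\Lambda_D):=-\infty$ for $i\le0$.
   Context: Setting. Let $n\ge1$, $T>0$, $P,Q\in H^1([0,T],L(n))$, $R\in C([0,T],L(n))$, where $L(n)$ is the set of real $n\times n$ matrices; $P(t),R(t)$ are symmetric and $P(t)$ is positive definite for all $t\in[0,T]$. For $x:[0,T]\to\mathbf C^n$ put $y=P\dot x+Qx$ and $z=(y^T,x^T)^T$. Let $\mathcal Ax=-\frac{d}{dt}(P\dot x+Qx)+Q^T\dot x+Rx$. Let $J_n=\begin{bmatrix}0&-I_n\\ I_n&0\end{bmatrix}$, $\omega_n(u,v)=\langle J_nu,v\rangle$ on $\mathbf C^{2n}$ (standard Hermitian product), and $(\mathcal V,\Omega)=(\mathbf C^{2n}\oplus\mathbf C^{2n},-\omega_n\oplus\omega_n)$. $\mathrm{Lag}(\mathcal V,\Omega)$ is the set of complex subspaces $\Lambda\subset\mathcal V$ with $\Omega|_\Lambda=0$ and $\dim_{\mathbf C}\Lambda=2n$. Vectors of $\mathcal V$ are written $(z(0),z(T))$ with $z(0)=(y(0),x(0))$, $z(T)=(y(T),x(T))$; the Dirichlet condition is $\Lambda_D=\{x(0)=x(T)=0\}$. For $\Lambda\in\mathrm{Lag}(\mathcal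 V,\Omega)$, $\mathcal A_\Lambda$ is the self-adjoint operator on $L^2([0,T],\mathbf C^n)$ acting as $\mathcal A$ with domain $\{x\in H^2([0,T],\mathbf C^n):(z(0),z(T))\in\Lambda\}$. Its spectrum is bounded below and consists of discrete eigenvalues, $\lambda_1(\Lambda)\le\lambda_2(\Lambda)\le\cdots$, counted with multiplicity. For $0\le r\le2n$, the $r$-th layer is $\Sigma_r=\{\Lambda\in\mathrm{Lag}(\mathcal V,\Omega):\dim(\Lambda\cap\Lambda_D)=r\}$. *)

theory Defs
  imports "HOL-Analysis.Analysis" "HOL-Library.Function_Algebras"
begin

section \<open>One-dimensional Sobolev spaces on an interval\<close>

text \<open>Elements of \<open>H\<^sup>1([0,T])\<close> are identified with their continuous representatives: \<open>f\<close> is of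
  class \<open>H\<^sup>1\<close> iff it is the indefinite Lebesgue integral of an \<open>L\<^sup>2\<close> function, which is then its
  weak derivative.  Only the values of \<open>f\<close> on \<open>[0,T]\<close> matter.\<close>

definition L2_on :: "real \<Rightarrow> (real \<Rightarrow> 'a::euclidean_space) \<Rightarrow> bool" where
  "L2_on T g \<longleftrightarrow> g \<in> borel_measurable (lebesgue_on {0..T}) \<and>
     integrable (lebesgue_on {0..T}) (\<lambda>t. (norm (g t))\<^sup>2)"

definition has_weak_deriv ::
    "real \<Rightarrow> (real \<Rightarrow> 'a::euclidean_space) \<Rightarrow> (real \<Rightarrow> 'a) \<Rightarrow> bool" where
  "has_weak_deriv T f g \<longleftrightarrow> L2_on T g \<and>
     (\<forall>t\<in>{0..T}. f t = f 0 + integral\<^sup>L (lebesgue_on {0..t}) g)"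

definition H1 :: "real \<Rightarrow> (real \<Rightarrow> 'a::euclidean_space) \<Rightarrow> bool" where
  "H1 T f \<longleftrightarrow> (\<exists>g. has_weak_deriv T f g)"

text \<open>For \<open>f\<close> of class \<open>H\<^sup>1\<close> this is determined up to a null set.\<close>

definition weak_deriv :: "real \<Rightarrow> (real \<Rightarrow> 'a::euclidean_space) \<Rightarrow> real \<Rightarrow> 'a" where
  "weak_deriv T f = (SOME g. has_weak_deriv T f g)"

text \<open>The classical derivative, one-sided at the end points.  A function of class \<open>H\<^sup>2\<close> is
  \<open>C\<^sup>1\<close> on \<open>[0,T]\<close>, so its derivative has values at \<open>0\<close> and \<open>T\<close>.\<close>

definition deriv_on :: "real \<Rightarrow> (real \<Rightarrow> 'a::euclidean_space) \<Rightarrow> real \<Rightarrow> 'a" where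
  "deriv_on T x t = vector_derivative x (at t within {0..T})"

definition H2 :: "real \<Rightarrow> (real \<Rightarrow> 'a::euclidean_space) \<Rightarrow> bool" where
  "H2 T x \<longleftrightarrow> x differentiable_on {0..T} \<and> H1 T (deriv_on T x)"

section \<open>The symplectic space of boundary values\<close>

text \<open>\<open>complex ^ ('n + 'n)\<close> is \<open>\<complex>\<^sup>2\<^sup>n\<close>, with \<open>Inl\<close> indexing the \<open>y\<close>-block and \<open>Inr\<close> the
  \<open>x\<close>-block of \<open>z = (y, x)\<close>.  \<open>complex ^ (('n + 'n) + ('n + 'n))\<close> is \<open>\<complex>\<^sup>2\<^sup>n \<oplus> \<complex>\<^sup>2\<^sup>n\<close>, whose outer
  \<open>Inl\<close> and \<open>Inr\<close> index \<open>z(0)\<close> and \<open>z(T)\<close>.  Subspaces and dimensions are complex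
  (\<^const>\<open>vec.subspace\<close>, \<^const>\<open>vec.dim\<close>).\<close>

type_synonym 'n phase = "complex ^ ('n + 'n)"
type_synonym 'n bdspace = "complex ^ (('n + 'n) + ('n + 'n))"

definition join :: "'a ^ 'm::finite \<Rightarrow> 'a ^ 'k::finite \<Rightarrow> 'a ^ ('m + 'k)" where
  "join u v = (\<chi> i. case i of Inl a \<Rightarrow> u $ a | Inr b \<Rightarrow> v $ b)"

definition left_part :: "'a ^ ('m::finite + 'k::finite) \<Rightarrow> 'a ^ 'm" where
  "left_part w = (\<chi> a. w $ Inl a)"

definition right_part :: "'a ^ ('m::finite + 'k::finite) \<Rightarrow> 'a ^ 'k" where
  "right_part w = (\<chi> b. w $ Inr b)"

definition J_mat :: "complex ^ ('n + 'n) ^ ('n::finite + 'n)" where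
  "J_mat = (\<chi> i j. case (i, j) of
       (Inl a, Inr b) \<Rightarrow> (if a = b then -1 else 0)
     | (Inr a, Inl b) \<Rightarrow> (if a = b then 1 else 0)
     | _ \<Rightarrow> 0)"

definition hermitian :: "complex ^ 'm \<Rightarrow> complex ^ 'm::finite \<Rightarrow> complex" where
  "hermitian u v = (\<Sum>i\<in>UNIV. u $ i * cnj (v $ i))"

definition omega :: "'n::finite phase \<Rightarrow> 'n phase \<Rightarrow> complex" where
  "omega u v = hermitian (J_mat *v u) v"

definition Omega :: "'n::finite bdspace \<Rightarrow> 'n bdspace \<Rightarrow> complex" where
  "Omega u v = - omega (left_part u) (left_part v) + omega (right_part u) (right_part v)"

definition Lag :: "'n::finite bdspace set set" where
  "Lag = {L. vec.subspace L \<and> (\<forall>u\<in>L. \<forall>v\<in>L. Omega u v = 0) \<and> vec.dim L = 2 * CARD('n)}"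

definition Dirichlet :: "'n::finite bdspace set" where
  "Dirichlet = {w. right_part (left_part w) = 0 \<and> right_part (right_part w) = 0}"

definition layer :: "nat \<Rightarrow> 'n::finite bdspace set set" where
  "layer r = {L \<in> Lag. vec.dim (L \<inter> Dirichlet) = r}"

section \<open>Sturm--Liouville operators and their eigenvalues\<close>

definition cmat :: "real ^ 'k ^ 'm \<Rightarrow> complex ^ 'k ^ 'm" where
  "cmat = map_matrix complex_of_real"

definition quasi_deriv :: "(real \<Rightarrow> real ^ 'n ^ 'n) \<Rightarrow> (real \<Rightarrow> real ^ 'n ^ 'n) \<Rightarrow> real
    \<Rightarrow> (real \<Rightarrow> complex ^ 'n) \<Rightarrow> real \<Rightarrow> complex ^ 'n::finite" where
  "quasi_deriv P Q T x t = cmat (P t) *v deriv_on T x t + cmat (Q t) *v x t"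

definition phase_curve :: "(real \<Rightarrow> real ^ 'n ^ 'n) \<Rightarrow> (real \<Rightarrow> real ^ 'n ^ 'n) \<Rightarrow> real
    \<Rightarrow> (real \<Rightarrow> complex ^ 'n) \<Rightarrow> real \<Rightarrow> 'n::finite phase" where
  "phase_curve P Q T x t = join (quasi_deriv P Q T x t) (x t)"

definition SL_op :: "(real \<Rightarrow> real ^ 'n ^ 'n) \<Rightarrow> (real \<Rightarrow> real ^ 'n ^ 'n) \<Rightarrow> (real \<Rightarrow> real ^ 'n ^ 'n)
    \<Rightarrow> real \<Rightarrow> (real \<Rightarrow> complex ^ 'n) \<Rightarrow> real \<Rightarrow> complex ^ 'n::finite" where
  "SL_op P Q R T x t = - weak_deriv T (quasi_deriv P Q T x) t
     + cmat (transpose (Q t)) *v deriv_on T x t + cmat (R t) *v x t"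

text \<open>A function on \<open>[0,T]\<close> is represented by its extension by \<open>0\<close> to the real line, so that
  equality of functions on \<open>[0,T]\<close> is equality in HOL and dimensions of function spaces are
  counted correctly.\<close>

definition SL_dom :: "(real \<Rightarrow> real ^ 'n ^ 'n) \<Rightarrow> (real \<Rightarrow> real ^ 'n ^ 'n) \<Rightarrow> real
    \<Rightarrow> 'n bdspace set \<Rightarrow> (real \<Rightarrow> complex ^ 'n::finite) set" where
  "SL_dom P Q T L = {x. H2 T x \<and> (\<forall>t. t \<notin> {0..T} \<longrightarrow> x t = 0) \<and>
     join (phase_curve P Q T x 0) (phase_curve P Q T x T) \<in> L}"

definition eigenspace :: "(real \<Rightarrow> real ^ 'n ^ 'n) \<Rightarrow> (real \<Rightarrow> real ^ 'n ^ 'n)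
    \<Rightarrow> (real \<Rightarrow> real ^ 'n ^ 'n) \<Rightarrow> real \<Rightarrow> 'n bdspace set \<Rightarrow> real
    \<Rightarrow> (real \<Rightarrow> complex ^ 'n::finite) set" where
  "eigenspace P Q R T L \<mu> = {x \<in> SL_dom P Q T L.
     AE t in lebesgue_on {0..T}. SL_op P Q R T x t = complex_of_real \<mu> *s x t}"

definition scale_fun :: "complex \<Rightarrow> ('b \<Rightarrow> complex ^ 'n) \<Rightarrow> 'b \<Rightarrow> complex ^ 'n" where
  "scale_fun c f = (\<lambda>t. c *s f t)"

interpretation cfun: vector_space "scale_fun :: complex \<Rightarrow> ('b \<Rightarrow> complex ^ 'n::finite) \<Rightarrow> _"
  by unfold_locales
    (auto simp: scale_fun_def fun_eq_iff vec_eq_iff algebra_simps)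

text \<open>A nondecreasing enumeration \<open>l 1 \<le> l 2 \<le> \<dots>\<close> of the eigenvalues in which every real number
  occurs as often as its multiplicity (\<open>0\<close> times if it is not an eigenvalue).  The value \<open>l 0\<close>
  is irrelevant.  Eigenvalues are real because the operators are self-adjoint.\<close>

definition is_eigenvalue_enum :: "(real \<Rightarrow> real ^ 'n ^ 'n) \<Rightarrow> (real \<Rightarrow> real ^ 'n ^ 'n)
    \<Rightarrow> (real \<Rightarrow> real ^ 'n ^ 'n) \<Rightarrow> real \<Rightarrow> 'n::finite bdspace set \<Rightarrow> (nat \<Rightarrow> real) \<Rightarrow> bool" where
  "is_eigenvalue_enum P Q R T L l \<longleftrightarrow>
     (\<forall>i k. 1 \<le> i \<and> i \<le> k \<longrightarrow> l i \<le> l k) \<and>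
     (\<forall>\<mu>. finite {i. 1 \<le> i \<and> l i = \<mu>} \<and>
          card {i. 1 \<le> i \<and> l i = \<mu>} = cfun.dim (eigenspace P Q R T L \<mu>))"

text \<open>The \<open>i\<close>-th eigenvalue, with the convention \<open>-\<infinity>\<close> for \<open>i \<le> 0\<close>.  For \<open>i \<ge> 1\<close> the value does
  not depend on the enumeration chosen, since there is at most one up to its value at \<open>0\<close>.\<close>

definition eigval :: "(real \<Rightarrow> real ^ 'n ^ 'n) \<Rightarrow> (real \<Rightarrow> real ^ 'n ^ 'n)
    \<Rightarrow> (real \<Rightarrow> real ^ 'n ^ 'n) \<Rightarrow> real \<Rightarrow> 'n::finite bdspace set \<Rightarrow> int \<Rightarrow> ereal" where
  "eigval P Q R T L i =
     (if i \<le> 0 then -\<infinity> else ereal ((SOME l. is_eigenvalue_enum P Q R T L l) (nat i)))"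

end

theory Submission
  imports Defs
begin

text \<open>Fix a spectral parameter \<open>\<mu>\<close>.  A Lagrangian boundary condition amounts to a subspace \<open>E\<close> of
  admissible boundary values of \<open>x\<close> together with a Hermitian form \<open>S\<close> on them, and its eigenspace
  for \<open>\<mu>\<close> is the kernel of the Hermitian form \<open>h = energy + S - \<mu> L\<^sup>2\<close> on the space of \<open>C\<^sup>1\<close> functions
  with boundary values in \<open>E\<close>.  The space splits orthogonally for \<open>h\<close> into a finite-codimensional
  space on which \<open>h\<close> is coercive and a finite-dimensional one, on which \<open>h\<close> can be diagonalized.
  Hence the number of eigenvalues \<open>< \<mu>\<close> (\<open>\<le> \<mu>\<close>) is the largest dimension of a subspace on which
  \<open>h\<close> is negative (nonpositive).  The Dirichlet condition corresponds to \<open>E = 0\<close> and the layer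
  \<open>\<Sigma>\<^sub>0\<close> to \<open>E = \<complex>\<^sup>2\<^sup>n\<close>, so that the inequalities compare such dimensions on nested spaces of
  codimension at most \<open>2n\<close>; they are strict because a solution vanishing together with its
  quasi-derivative at \<open>0\<close> vanishes.  Each value in the open interval is attained by a Robin
  condition \<open>S = s I\<close>, where \<open>s\<close> is the supremum of the parameters for which \<open>h\<close> is still
  nonpositive on some \<open>j\<close>-dimensional space.\<close>

section \<open>Indices of Hermitian forms\<close>

text \<open>The forms live on an incomplete space of C^1 functions, so no minimizer and no spectral
  theorem is invoked. Differential equations take the place of completeness: the
  \<open>h\<close>-orthogonal complement of the functions with vanishing moments and boundary values
  consists of the solutions of (A - \<mu>)x = a combination of finitely many bumps, and the boundary
  value problems needed are solvable because uniqueness implies existence in finite dimension.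
  Existence of eigenvalues is also a result: the i-th one is the least \<mu> at which the form is
  nonpositive on some i-dimensional space, and \<open>eigval\<close>, which selects an enumeration
  by \<open>SOME\<close>, is identified through uniqueness of enumerations. Changes of \<mu> and of
  the Robin parameter are both controlled by one comparison form, the L2 form plus the Euclidean
  form of the boundary values. Hence one pair of semicontinuity statements serves for both: under
  small perturbations the nonpositive index cannot jump up and the negative index cannot jump down.
  The gap between the two indices at \<mu> is the multiplicity.\<close>

locale complex_vector_space = vector_space scale
  for scale :: "complex \<Rightarrow> 'v::ab_group_add \<Rightarrow> 'v"
begin

text \<open>The laws are relative to \<open>X\<close> because the energy integral is additive only
  where its integrands are integrable.\<close>

definition hform :: "'v set \<Rightarrow> ('v \<Rightarrow> 'v \<Rightarrow> complex) \<Rightarrow> bool" where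
  "hform X h \<longleftrightarrow> subspace X \<and>
     (\<forall>x\<in>X. \<forall>y\<in>X. \<forall>z\<in>X. h (x + y) z = h x z + h y z) \<and>
     (\<forall>c. \<forall>x\<in>X. \<forall>y\<in>X. h (scale c x) y = c * h x y) \<and>
     (\<forall>x\<in>X. \<forall>y\<in>X. h y x = cnj (h x y))"

section \<open>Elementary rules for Hermitian forms\<close>

lemma hform_subspace: "hform X h \<Longrightarrow> subspace X"
  by (drule iffD1[OF hform_def]) (erule conjunct1)

lemma hform_add_left: "hform X h \<Longrightarrow> x \<in> X \<Longrightarrow> y \<in> X \<Longrightarrow> z \<in> X \<Longrightarrow> h (x + y) z = h x z + h y z"
  by (drule iffD1[OF hform_def], elim conjE) (drule bspec | assumption)+

lemma hform_scale_left: "hform X h \<Longrightarrow> x \<in> X \<Longrightarrow> y \<in> X \<Longrightarrow> h (scale c x) y = c * h x y"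
  by (drule iffD1[OF hform_def], elim conjE) (drule spec[of _ c], drule bspec, assumption, drule bspec)

lemma hform_cnj: "hform X h \<Longrightarrow> x \<in> X \<Longrightarrow> y \<in> X \<Longrightarrow> h y x = cnj (h x y)"
  by (drule iffD1[OF hform_def], elim conjE) (rotate_tac 5, drule (1) bspec, drule (1) bspec)

lemma hform_add_right:
  assumes "hform X h" "x \<in> X" "y \<in> X" "z \<in> X"
  shows "h z (x + y) = h z x + h z y"
  using assms hform_cnj[OF assms(1) _ assms(4)] hform_add_left[OF assms]
    subspace_add[OF hform_subspace[OF assms(1)] assms(2,3)]
  by simp

lemma hform_scale_right:
  assumes "hform X h" "x \<in> X" "y \<in> X"
  shows "h y (scale c x) = cnj c * h y x"
  using assms hform_cnj[OF assms(1) _ assms(3)] hform_scale_left[OF assms]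
    subspace_scale[OF hform_subspace[OF assms(1)] assms(2)]
  by simp

lemma hform_zero_left: "hform X h \<Longrightarrow> x \<in> X \<Longrightarrow> h 0 x = 0"
  using hform_scale_left[of X h x x 0] by simp

lemma hform_zero_right: "hform X h \<Longrightarrow> x \<in> X \<Longrightarrow> h x 0 = 0"
  using hform_scale_right[of X h x x 0] by simp

lemma hform_sum_left:
  assumes "hform X h" "y \<in> X" "finite B" "B \<subseteq> X"
  shows "h (\<Sum>e\<in>B. scale (a e) e) y = (\<Sum>e\<in>B. a e * h e y)"
  using assms(3,4)
proof (induction B rule: finite_induct)
  case empty
  then show ?case using assms by (simp add: hform_zero_left)
next
  case (insert e B)
  have "(\<Sum>e\<in>B. scale (a e) e) \<in> X" "scale (a e) e \<in> X"
    using insert hform_subspace[OF assms(1)] by (auto intro!: subspace_sum subspace_scale)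
  then show ?case
    using insert assms by (simp add: hform_add_left[OF assms(1)] hform_scale_left[OF assms(1)])
qed

lemma hform_sum_right:
  assumes "hform X h" "y \<in> X" "finite B" "B \<subseteq> X"
  shows "h y (\<Sum>e\<in>B. scale (a e) e) = (\<Sum>e\<in>B. cnj (a e) * h y e)"
proof -
  have s: "(\<Sum>e\<in>B. scale (a e) e) \<in> X"
    using assms hform_subspace[OF assms(1)] by (auto intro!: subspace_sum subspace_scale)
  have "h y (\<Sum>e\<in>B. scale (a e) e) = (\<Sum>e\<in>B. cnj (a e * h e y))"
    by (simp only: hform_cnj[OF assms(1) s assms(2)] hform_sum_left[OF assms] cnj_sum)
  also have "\<dots> = (\<Sum>e\<in>B. cnj (a e) * h y e)"
    using assms(4) by (intro sum.cong) (auto simp: hform_cnj[OF assms(1) _ assms(2)])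
  finally show ?thesis .
qed

lemma hform_span_right_zero:
  assumes "hform X h" "y \<in> X" "B \<subseteq> X" "\<And>e. e \<in> B \<Longrightarrow> h y e = 0" "w \<in> span B"
  shows "h y w = 0"
proof -
  obtain t r where "finite t" "t \<subseteq> B" "w = (\<Sum>a\<in>t. scale (r a) a)"
    using assms(5) by (auto simp: span_explicit)
  then show ?thesis
    using hform_sum_right[OF assms(1,2), of t r] assms(3,4) by (auto intro!: sum.neutral)
qed

lemma hform_span_left_zero:
  assumes "hform X h" "y \<in> X" "B \<subseteq> X" "\<And>e. e \<in> B \<Longrightarrow> h e y = 0" "w \<in> span B"
  shows "h w y = 0"
proof -
  have "w \<in> X" using assms span_minimal[OF assms(3) hform_subspace[OF assms(1)]] by auto
  moreover have "h y w = 0"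
  proof (rule hform_span_right_zero[OF assms(1-3) _ assms(5)])
    fix e assume "e \<in> B"
    then show "h y e = 0" using hform_cnj[OF assms(1) _ assms(2), of e] assms(3,4) by auto
  qed
  ultimately show ?thesis using hform_cnj[OF assms(1,2), of w] by auto
qed

lemma hform_mono: "hform X h \<Longrightarrow> subspace Y \<Longrightarrow> Y \<subseteq> X \<Longrightarrow> hform Y h"
  unfolding hform_def by blast

lemma hform_span: "hform X h \<Longrightarrow> B \<subseteq> X \<Longrightarrow> span B \<subseteq> X"
  by (simp add: hform_subspace span_minimal)

lemma hform_quad_add:
  assumes "hform X h" "x \<in> X" "y \<in> X"
  shows "Re (h (x + y) (x + y)) = Re (h x x) + Re (h y y) + 2 * Re (h x y)"
proof -
  have s: "x + y \<in> X" using assms subspace_add[OF hform_subspace] by blast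
  have "h y x = cnj (h x y)" by (rule hform_cnj[OF assms])
  then show ?thesis
    by (simp add: hform_add_left[OF assms s] hform_add_right[OF assms assms(2)]
       hform_add_right[OF assms assms(3)])
qed

lemma hform_quad_orth:
  assumes "hform X h" "x \<in> X" "y \<in> X" "h x y = 0"
  shows "Re (h (x + y) (x + y)) = Re (h x x) + Re (h y y)"
  using hform_quad_add[OF assms(1-3)] assms(4) by simp

lemma hform_quad_scale:
  assumes "hform X h" "x \<in> X"
  shows "Re (h (scale c x) (scale c x)) = (cmod c)\<^sup>2 * Re (h x x)"
proof -
  have s: "scale c x \<in> X" using assms subspace_scale[OF hform_subspace] by blast
  have "h (scale c x) (scale c x) = (c * cnj c) * h x x"
    using assms s by (simp add: hform_scale_left[OF assms(1)] hform_scale_right[OF assms(1)])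
  then show ?thesis by (simp add: complex_mult_cnj cmod_power2 flip: of_real_add of_real_power)
qed

lemma hform_quad_sum_orth:
  assumes "hform X h" "finite B" "B \<subseteq> X" "pairwise (\<lambda>x y. h x y = 0) B"
  shows "Re (h (\<Sum>e\<in>B. scale (a e) e) (\<Sum>e\<in>B. scale (a e) e)) = (\<Sum>e\<in>B. (cmod (a e))\<^sup>2 * Re (h e e))"
  using assms(2-4)
proof (induction B rule: finite_induct)
  case empty
  then show ?case
    using hform_zero_left[OF assms(1)] hform_subspace[OF assms(1)] subspace_0 by auto
next
  case (insert e B)
  have m: "(\<Sum>e\<in>B. scale (a e) e) \<in> X" "scale (a e) e \<in> X"
    using insert hform_subspace[OF assms(1)] by (auto intro!: subspace_sum subspace_scale)
  have "h (scale (a e) e) (\<Sum>e\<in>B. scale (a e) e) = a e * (\<Sum>f\<in>B. cnj (a f) * h e f)"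
    using insert m hform_scale_left[OF assms(1), of e "\<Sum>e\<in>B. scale (a e) e" "a e"]
      hform_sum_right[OF assms(1), of e B a] by simp
  also have "(\<Sum>f\<in>B. cnj (a f) * h e f) = 0"
    using insert by (intro sum.neutral) (auto simp: pairwise_insert)
  finally have "h (scale (a e) e) (\<Sum>e\<in>B. scale (a e) e) = 0" by simp
  then show ?case
    using insert m hform_quad_orth[OF assms(1) m(2,1)] hform_quad_scale[OF assms(1), of e "a e"]
    by (simp add: pairwise_insert)
qed

text \<open>Polarization gives Re h(u,y) = 0 for all u; the choice u = h(y,x) x turns this real part
  into |h(x,y)|^2.\<close>

lemma hform_null_if_quad_zero:
  assumes h: "hform X h" and z: "\<And>x. x \<in> X \<Longrightarrow> Re (h x x) = 0" and "x \<in> X" "y \<in> X"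
  shows "h x y = 0"
proof -
  have "Re (h u y) = 0" if "u \<in> X" for u
    using hform_quad_add[OF h that \<open>y \<in> X\<close>] z that \<open>y \<in> X\<close>
      subspace_add[OF hform_subspace[OF h] that \<open>y \<in> X\<close>] by simp
  moreover have "scale (h y x) x \<in> X"
    using assms subspace_scale[OF hform_subspace[OF h]] by blast
  ultimately have "Re (h (scale (h y x) x) y) = 0" by blast
  moreover have "h (scale (h y x) x) y = cnj (h x y) * h x y"
    using assms by (simp add: hform_scale_left[OF h] hform_cnj[OF h, of x y])
  ultimately show ?thesis
    by (metis Re_complex_of_real complex_norm_square mult.commute norm_eq_zero power_eq_0_iff)
qed

lemma span_finite_sum:
  assumes "finite B" "w \<in> span B"
  obtains a where "w = (\<Sum>e\<in>B. scale (a e) e)"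
  using assms by (auto simp: span_finite)

text \<open>Isotropic vectors rule out plain Gram-Schmidt. Induction on the dimension: if the
  quadratic form vanishes on the span, every basis is orthogonal by polarization; otherwise a vector
  \<open>v\<close> with h(v,v) nonzero splits off, and the induction continues in its orthogonal
  complement \<open>Z\<close>.\<close>

lemma orthogonal_basis:
  assumes h: "hform X h" and "finite B0" "B0 \<subseteq> X"
  obtains B where "finite B" "independent B" "span B = span B0" "pairwise (\<lambda>x y. h x y = 0) B"
proof -
  have main: "\<exists>B. finite B \<and> independent B \<and> span B = Y \<and> pairwise (\<lambda>x y. h x y = 0) B"
    if "finite S" "independent S" "span S = Y" "Y \<subseteq> X" "card S = n" for S n Y
    using that
  proof (induction n arbitrary: S Y)
    case 0
    then show ?case by (intro exI[of _ "{}"]) auto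
  next
    case (Suc n)
    have sY: "subspace Y" using Suc by auto
    have hY: "hform Y h" using hform_mono[OF h sY] Suc by auto
    show ?case
    proof (cases "\<forall>v\<in>Y. Re (h v v) = 0")
      case True
      then have "h x y = 0" if "x \<in> Y" "y \<in> Y" for x y
        using hform_null_if_quad_zero[OF hY] that by blast
      then have "pairwise (\<lambda>x y. h x y = 0) S"
        using Suc by (auto simp: pairwise_def span_base)
      then show ?thesis using Suc by blast
    next
      case False
      then obtain v where v: "v \<in> Y" "h v v \<noteq> 0" by force
      define Z where "Z = {y \<in> Y. h y v = 0}"
      have sZ: "subspace Z"
        using sY v hform_add_left[OF hY] hform_scale_left[OF hY] hform_zero_left[OF hY]
        by (auto simp: Z_def subspace_def)
      obtain S' where S': "S' \<subseteq> Z" "independent S'" "Z \<subseteq> span S'"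
        using maximal_independent_subset[of Z] by blast
      have spS': "span S' = Z" using S' span_minimal[OF S'(1) sZ] by auto
      have fS': "finite S'"
        using independent_span_bound[OF \<open>finite S\<close> S'(2)] S'(1) Suc by (auto simp: Z_def)
      have vn: "v \<notin> Z" using v by (simp add: Z_def)
      have proj: "\<exists>z\<in>Z. y = scale (h y v / h v v) v + z" if "y \<in> Y" for y
      proof (intro bexI[of _ "y - scale (h y v / h v v) v"])
        have e: "y = (y - scale (h y v / h v v) v) + scale (h y v / h v v) v" by simp
        have m: "y - scale (h y v / h v v) v \<in> Y" "scale (h y v / h v v) v \<in> Y"
          using sY that v by (auto intro!: subspace_diff subspace_scale)
        have "h y v = h (y - scale (h y v / h v v) v) v + (h y v / h v v) * h v v"
          using hform_add_left[OF hY m v(1)] hform_scale_left[OF hY v(1) v(1)] by simp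
        then show "y - scale (h y v / h v v) v \<in> Z" using m v by (simp add: Z_def)
      qed auto
      have spv: "span (insert v B) = Y" if "span B = Z" for B
      proof
        have "insert v B \<subseteq> Y"
          using span_superset[of B] unfolding that using v by (auto simp: Z_def)
        then show "span (insert v B) \<subseteq> Y" using sY by (rule span_minimal)
        show "Y \<subseteq> span (insert v B)"
        proof
          fix y assume "y \<in> Y"
          then obtain z where "z \<in> Z" and y: "y = scale (h y v / h v v) v + z"
            using proj by blast
          then have z: "z \<in> span B" using that by simp
          then have "z \<in> span (insert v B)" using span_mono[of B "insert v B"] by blast
          then have "scale (h y v / h v v) v + z \<in> span (insert v B)"
            by (rule span_add[OF span_scale[OF span_base[OF insertI1]]])
          then show "y \<in> span (insert v B)" using y by (rule back_subst[of "\<lambda>y. y \<in> _", OF _ sym])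
        qed
      qed
      have "independent (insert v S')"
        by (rule independent_insertI[OF _ S'(2)]) (simp add: vn spS')
      then have "card (insert v S') = card S"
        using spv[OF spS'] Suc by (metis dim_span_eq_card_independent)
      moreover have "v \<notin> S'" using vn S' by auto
      ultimately have "card S' = n" using fS' Suc by simp
      then obtain B where B: "finite B" "independent B" "span B = Z" "pairwise (\<lambda>x y. h x y = 0) B"
        using Suc.IH[OF fS' S'(2) spS'] Suc.prems by (auto simp: Z_def)
      have "h e v = 0 \<and> h v e = 0" if "e \<in> B" for e
        using that span_superset[of B] hform_cnj[OF hY _ v(1), of e] unfolding B(3)
        by (auto simp: Z_def)
      then have "pairwise (\<lambda>x y. h x y = 0) (insert v B)"
        using B(4) by (auto simp: pairwise_insert)
      moreover have "independent (insert v B)"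
        by (rule independent_insertI[OF _ B(2)]) (simp add: vn B(3))
      ultimately show ?thesis using B spv[OF B(3)] by (intro exI[of _ "insert v B"]) auto
    qed
  qed
  obtain S where S: "S \<subseteq> B0" "independent S" "B0 \<subseteq> span S"
    using maximal_independent_subset[of B0] by blast
  have sp: "span S = span B0"
    using S span_mono[OF S(1)] span_minimal[OF S(3)] by auto
  have "finite S" using S assms finite_subset by blast
  then obtain B where "finite B" "independent B" "span B = span B0" "pairwise (\<lambda>x y. h x y = 0) B"
    using main[OF _ S(2) sp hform_span[OF h assms(3)] refl] by blast
  then show ?thesis using that by blast
qed

lemma hform_bounded_coeffs:
  assumes "hform X g" "finite B" "B \<subseteq> X"
  shows "\<exists>K\<ge>0. \<forall>a. \<bar>Re (g (\<Sum>e\<in>B. scale (a e) e) (\<Sum>e\<in>B. scale (a e) e))\<bar> \<le> K * (\<Sum>e\<in>B. (cmod (a e))\<^sup>2)"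
proof (intro exI[of _ "\<Sum>e\<in>B. \<Sum>f\<in>B. cmod (g e f)"] conjI allI)
  fix a
  define w where "w = (\<Sum>e\<in>B. scale (a e) e)"
  define s where "s = (\<Sum>e\<in>B. (cmod (a e))\<^sup>2)"
  have w: "w \<in> X"
    unfolding w_def using assms hform_subspace[OF assms(1)] by (auto intro!: subspace_sum subspace_scale)
  have le: "cmod (a e) * cmod (a f) \<le> s" if "e \<in> B" "f \<in> B" for e f
  proof -
    have "(cmod (a e))\<^sup>2 \<le> s" "(cmod (a f))\<^sup>2 \<le> s"
      unfolding s_def using that assms by (auto intro!: member_le_sum)
    moreover have "2 * (cmod (a e) * cmod (a f)) \<le> (cmod (a e))\<^sup>2 + (cmod (a f))\<^sup>2"
      using sum_squares_bound[of "cmod (a e)" "cmod (a f)"] by simp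
    ultimately show ?thesis by linarith
  qed
  have "g w w = (\<Sum>e\<in>B. a e * g e w)"
    using hform_sum_left[OF assms(1) w assms(2,3)] by (simp add: w_def)
  also have "\<dots> = (\<Sum>e\<in>B. a e * (\<Sum>f\<in>B. cnj (a f) * g e f))"
  proof (rule sum.cong[OF refl])
    fix e assume "e \<in> B"
    then show "a e * g e w = a e * (\<Sum>f\<in>B. cnj (a f) * g e f)"
      using hform_sum_right[OF assms(1) _ assms(2,3), of e a] assms(3) by (auto simp: w_def)
  qed
  finally have "cmod (g w w) \<le> (\<Sum>e\<in>B. cmod (a e * (\<Sum>f\<in>B. cnj (a f) * g e f)))"
    by (simp add: norm_sum)
  also have "\<dots> \<le> (\<Sum>e\<in>B. \<Sum>f\<in>B. s * cmod (g e f))"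
  proof (intro sum_mono)
    fix e assume e: "e \<in> B"
    have "cmod (a e * (\<Sum>f\<in>B. cnj (a f) * g e f)) \<le> cmod (a e) * (\<Sum>f\<in>B. cmod (a f) * cmod (g e f))"
      by (auto simp: norm_mult intro!: mult_left_mono sum_norm_le)
    also have "\<dots> = (\<Sum>f\<in>B. (cmod (a e) * cmod (a f)) * cmod (g e f))"
      by (simp add: sum_distrib_left algebra_simps)
    also have "\<dots> \<le> (\<Sum>f\<in>B. s * cmod (g e f))"
      using le e by (intro sum_mono mult_right_mono) auto
    finally show "cmod (a e * (\<Sum>f\<in>B. cnj (a f) * g e f)) \<le> (\<Sum>f\<in>B. s * cmod (g e f))" .
  qed
  also have "\<dots> = (\<Sum>e\<in>B. \<Sum>f\<in>B. cmod (g e f)) * s"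
    by (simp add: sum_distrib_left sum_distrib_right mult.commute)
  finally show "\<bar>Re (g w w)\<bar> \<le> (\<Sum>e\<in>B. \<Sum>f\<in>B. cmod (g e f)) * s"
    using abs_Re_le_cmod[of "g w w"] by linarith
qed (auto intro!: sum_nonneg)

text \<open>Equivalence of norms in finite dimension: in a \<open>p\<close>-orthogonal basis
  \<open>p\<close> is a positive weighted sum of squared coefficients, and such a sum dominates
  every Hermitian form.\<close>

lemma hform_bounded_by_definite:
  assumes g: "hform X g" and p: "hform X p" and C: "finite C" "C \<subseteq> X"
    and pos: "\<And>x. x \<in> span C \<Longrightarrow> x \<noteq> 0 \<Longrightarrow> Re (p x x) > 0"
  shows "\<exists>K>0. \<forall>w\<in>span C. \<bar>Re (g w w)\<bar> \<le> K * Re (p w w)"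
proof -
  obtain B where B: "finite B" "independent B" "span B = span C" "pairwise (\<lambda>x y. p x y = 0) B"
    using orthogonal_basis[OF p C] by blast
  have BX: "B \<subseteq> X" using span_superset[of B] hform_span[OF p C(2)] B(3) by auto
  obtain K where K: "K \<ge> 0"
      "\<And>a. \<bar>Re (g (\<Sum>e\<in>B. scale (a e) e) (\<Sum>e\<in>B. scale (a e) e))\<bar> \<le> K * (\<Sum>e\<in>B. (cmod (a e))\<^sup>2)"
    using hform_bounded_coeffs[OF g B(1) BX] by blast
  have pe: "Re (p e e) > 0" if "e \<in> B" for e
  proof (rule pos)
    show "e \<in> span C" using that B(3) span_base by blast
    show "e \<noteq> 0" using that B(2) dependent_zero by blast
  qed
  \<comment> \<open>The inserted 1 keeps the minimum meaningful and positive when \<open>B\<close>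
    is empty.\<close>
  define m where "m = Min (insert 1 ((\<lambda>e. Re (p e e)) ` B))"
  have m0: "m > 0" using pe B(1) by (auto simp: m_def)
  have mle: "m \<le> Re (p e e)" if "e \<in> B" for e using that B(1) by (auto simp: m_def)
  \<comment> \<open>K + 1 in place of K makes the constant positive even if K = 0.\<close>
  have "\<bar>Re (g w w)\<bar> \<le> (K + 1) / m * Re (p w w)" if "w \<in> span C" for w
  proof -
    obtain a where a: "w = (\<Sum>e\<in>B. scale (a e) e)"
      using \<open>w \<in> span C\<close> span_finite_sum[OF B(1), of w thesis] B(3) by simp
    define s where "s = (\<Sum>e\<in>B. (cmod (a e))\<^sup>2)"
    have s0: "s \<ge> 0" by (simp add: s_def sum_nonneg)
    have "m * s \<le> Re (p w w)"
      unfolding a hform_quad_sum_orth[OF p B(1) BX B(4)] s_def sum_distrib_left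
      by (intro sum_mono) (simp add: mult.commute[of m] mult_left_mono mle)
    then have "s \<le> Re (p w w) / m" using m0 by (simp add: field_simps)
    then have "(K + 1) * s \<le> (K + 1) * (Re (p w w) / m)" using K(1) by (intro mult_left_mono) auto
    moreover have "\<bar>Re (g w w)\<bar> \<le> K * s" using K(2)[of a] by (simp add: a s_def)
    ultimately show ?thesis using s0 by (simp add: distrib_right)
  qed
  then show ?thesis using K(1) m0 by (intro exI[of _ "(K + 1) / m"]) auto
qed

lemma hformI:
  assumes "subspace X"
    and "\<And>x y z. x \<in> X \<Longrightarrow> y \<in> X \<Longrightarrow> z \<in> X \<Longrightarrow> h (x + y) z = h x z + h y z"
    and "\<And>c x y. x \<in> X \<Longrightarrow> y \<in> X \<Longrightarrow> h (scale c x) y = c * h x y"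
    and "\<And>x y. x \<in> X \<Longrightarrow> y \<in> X \<Longrightarrow> h y x = cnj (h x y)"
  shows "hform X h"
  unfolding hform_def by (intro conjI ballI allI assms)

lemma hform_add:
  assumes "hform X g" "hform X h"
  shows "hform X (\<lambda>x y. g x y + h x y)"
proof (rule hformI)
  show "g y x + h y x = cnj (g x y + h x y)" if "x \<in> X" "y \<in> X" for x y
    using hform_cnj[OF assms(1) that] hform_cnj[OF assms(2) that] by simp
qed (use assms in \<open>auto simp: hform_add_left hform_scale_left distrib_left intro: hform_subspace\<close>)

lemma hform_cmult:
  assumes "hform X g"
  shows "hform X (\<lambda>x y. complex_of_real r * g x y)"
proof (rule hformI)
  show "complex_of_real r * g y x = cnj (complex_of_real r * g x y)" if "x \<in> X" "y \<in> X" for x y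
    using hform_cnj[OF assms(1) that] by simp
qed (use assms in \<open>auto simp: hform_add_left hform_scale_left distrib_left intro: hform_subspace\<close>)

text \<open>A codimension count without quotient spaces: modulo \<open>A\<close> every vector of
  \<open>C\<close> lies in the span of \<open>B\<close>. If the span of \<open>C\<close> met
  \<open>A\<close> only in 0, choosing these representatives would embed \<open>C\<close> as an
  independent set into the span of the smaller set \<open>B\<close>.\<close>

lemma pigeonhole_span:
  assumes A: "subspace A" and "finite B" "finite C" "independent C" "card B < card C"
    and dec: "\<And>x. x \<in> C \<Longrightarrow> \<exists>w\<in>span B. x - w \<in> A"
  shows "\<exists>x\<in>span C. x \<noteq> 0 \<and> x \<in> A"
proof (rule ccontr)
  assume "\<not> ?thesis"
  then have triv: "x = 0" if "x \<in> span C" "x \<in> A" for x using that by blast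
  obtain f where f: "\<And>x. x \<in> C \<Longrightarrow> f x \<in> span B \<and> x - f x \<in> A"
    using dec by metis
  have key: "u v = 0" if "(\<Sum>v\<in>C. scale (u v) (f v)) = 0" "v \<in> C" for u v
  proof -
    have "(\<Sum>v\<in>C. scale (u v) v) = (\<Sum>v\<in>C. scale (u v) (v - f v))"
      using that(1) by (simp add: scale_right_diff_distrib sum_subtractf)
    also have "\<dots> \<in> A" using f A by (auto intro!: subspace_sum subspace_scale)
    finally have "(\<Sum>v\<in>C. scale (u v) v) \<in> A" .
    moreover have "(\<Sum>v\<in>C. scale (u v) v) \<in> span C"
      by (intro span_sum span_scale span_base)
    ultimately have "(\<Sum>v\<in>C. scale (u v) v) = 0" using triv by blast
    then show ?thesis using assms that(2) independentD by blast
  qed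
  have inj: "inj_on f C"
  proof (rule inj_onI, rule ccontr)
    fix x y assume xy: "x \<in> C" "y \<in> C" "f x = f y" "x \<noteq> y"
    let ?u = "\<lambda>v. if v = x then 1 else if v = y then -1 else (0::complex)"
    have "(\<Sum>v\<in>C. scale (?u v) (f v)) = (\<Sum>v\<in>{x,y}. scale (?u v) (f v))"
      using xy assms(3) by (intro sum.mono_neutral_right) auto
    also have "\<dots> = 0" using xy by simp
    finally show False using key[of ?u x] xy by simp
  qed
  have "independent (f ` C)"
  proof (rule independent_if_scalars_zero)
    fix g x assume 1: "(\<Sum>x\<in>f ` C. scale (g x) x) = 0" "x \<in> f ` C"
    then have "(\<Sum>v\<in>C. scale ((g \<circ> f) v) (f v)) = 0" by (simp add: sum.reindex[OF inj])
    then show "g x = 0" using key[of "g \<circ> f"] 1 by auto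
  qed (use assms in auto)
  then have "card (f ` C) \<le> card B"
    using independent_span_bound[OF \<open>finite B\<close>] f by blast
  then show False using card_image[OF inj] assms by simp
qed

text \<open>\<open>npos\<close> says that m is at most index plus nullity, and \<open>neg\<close>
  below that m is at most the Morse index. As predicates in m they make sense before the indices are
  known to be finite.\<close>

definition npos :: "'v set \<Rightarrow> ('v \<Rightarrow> 'v \<Rightarrow> complex) \<Rightarrow> nat \<Rightarrow> bool" where
  "npos X h m \<longleftrightarrow> (\<exists>C\<subseteq>X. finite C \<and> independent C \<and> card C = m \<and> (\<forall>x\<in>span C. Re (h x x) \<le> 0))"

definition neg :: "'v set \<Rightarrow> ('v \<Rightarrow> 'v \<Rightarrow> complex) \<Rightarrow> nat \<Rightarrow> bool" where
  "neg X h m \<longleftrightarrow> (\<exists>C\<subseteq>X. finite C \<and> independent C \<and> card C = m \<and>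
     (\<forall>x\<in>span C. x \<noteq> 0 \<longrightarrow> Re (h x x) < 0))"

definition kernel :: "'v set \<Rightarrow> ('v \<Rightarrow> 'v \<Rightarrow> complex) \<Rightarrow> 'v set" where
  "kernel X h = {x \<in> X. \<forall>y\<in>X. h x y = 0}"

text \<open>A Sylvester basis of a finite-dimensional part, sorted by sign,
  \<open>h\<close>-orthogonal to the infinite-dimensional remainder \<open>X0\<close>. Positivity on
  \<open>X0\<close> is kept out of the definition, since it is needed in several strengths.\<close>

definition diag where
  "diag X h X0 Bp Bz Bn \<longleftrightarrow> subspace X0 \<and> X0 \<subseteq> X \<and> finite Bp \<and> finite Bz \<and> finite Bn \<and>
     Bp \<union> Bz \<union> Bn \<subseteq> X \<and> independent (Bp \<union> Bz \<union> Bn) \<and>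
     pairwise (\<lambda>x y. h x y = 0) (Bp \<union> Bz \<union> Bn) \<and>
     (\<forall>e\<in>Bp. Re (h e e) > 0) \<and> (\<forall>e\<in>Bz. Re (h e e) = 0) \<and> (\<forall>e\<in>Bn. Re (h e e) < 0) \<and>
     (\<forall>x\<in>X0. \<forall>e\<in>Bp \<union> Bz \<union> Bn. h x e = 0) \<and>
     (\<forall>x\<in>X. \<exists>x0\<in>X0. \<exists>w\<in>span (Bp \<union> Bz \<union> Bn). x = x0 + w)"

lemma diag_exists:
  assumes h: "hform X h" and "subspace X0" "X0 \<subseteq> X" "subspace Y" "Y \<subseteq> X" "finite F" "Y \<subseteq> span F"
    and "\<And>x y. x \<in> X0 \<Longrightarrow> y \<in> Y \<Longrightarrow> h x y = 0"
    and "\<And>x. x \<in> X \<Longrightarrow> \<exists>x0\<in>X0. \<exists>y\<in>Y. x = x0 + y"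
  obtains Bp Bz Bn where "diag X h X0 Bp Bz Bn" "Bp \<union> Bz \<union> Bn \<subseteq> Y"
proof -
  obtain S where S: "S \<subseteq> Y" "independent S" "Y \<subseteq> span S"
    using maximal_independent_subset[of Y] by blast
  have fS: "finite S" using independent_span_bound[OF \<open>finite F\<close> S(2)] S assms by auto
  obtain B where B: "finite B" "independent B" "span B = span S" "pairwise (\<lambda>x y. h x y = 0) B"
    using orthogonal_basis[OF h fS order_trans[OF S(1) \<open>Y \<subseteq> X\<close>]] by metis
  have spB: "span B = Y" using B S span_minimal[OF S(1) \<open>subspace Y\<close>] by auto
  then have BY: "B \<subseteq> Y" using span_superset by auto
  define Bp where "Bp = {e\<in>B. Re (h e e) > 0}"
  define Bz where "Bz = {e\<in>B. Re (h e e) = 0}"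
  define Bn where "Bn = {e\<in>B. Re (h e e) < 0}"
  have un: "Bp \<union> Bz \<union> Bn = B" by (auto simp: Bp_def Bz_def Bn_def)
  have "finite Bp" "finite Bz" "finite Bn" using B by (auto simp: Bp_def Bz_def Bn_def)
  then have "diag X h X0 Bp Bz Bn"
    unfolding diag_def un spB using assms B BY
    by (auto simp: Bp_def Bz_def Bn_def)
  then show ?thesis using that BY un by blast
qed

lemma diagD:
  assumes "diag X h X0 Bp Bz Bn"
  shows "subspace X0" "X0 \<subseteq> X" "finite Bp" "finite Bz" "finite Bn" "Bp \<subseteq> X" "Bz \<subseteq> X" "Bn \<subseteq> X"
    "independent (Bp \<union> Bz \<union> Bn)" "pairwise (\<lambda>x y. h x y = 0) (Bp \<union> Bz \<union> Bn)"
    "\<And>e. e \<in> Bp \<Longrightarrow> Re (h e e) > 0" "\<And>e. e \<in> Bz \<Longrightarrow> Re (h e e) = 0" "\<And>e. e \<in> Bn \<Longrightarrow> Re (h e e) < 0"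
    "\<And>x e. x \<in> X0 \<Longrightarrow> e \<in> Bp \<union> Bz \<union> Bn \<Longrightarrow> h x e = 0"
    "\<And>x. x \<in> X \<Longrightarrow> \<exists>x0\<in>X0. \<exists>w\<in>span (Bp \<union> Bz \<union> Bn). x = x0 + w"
  using assms unfolding diag_def by blast+

lemma hform_span_orth:
  assumes h: "hform X h" and "A \<subseteq> X" "B \<subseteq> X" "\<And>a b. a \<in> A \<Longrightarrow> b \<in> B \<Longrightarrow> h a b = 0"
    and "u \<in> span A" "w \<in> span B"
  shows "h u w = 0"
proof (rule hform_span_left_zero[OF h _ \<open>A \<subseteq> X\<close> _ \<open>u \<in> span A\<close>])
  show "w \<in> X" using hform_span[OF h \<open>B \<subseteq> X\<close>] assms by auto
  fix e assume "e \<in> A"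
  then show "h e w = 0"
    using assms by (intro hform_span_right_zero[OF h _ \<open>B \<subseteq> X\<close> _ \<open>w \<in> span B\<close>]) auto
qed

lemma diag_decompose:
  assumes d: "diag X h X0 Bp Bz Bn" and "x \<in> X"
  obtains x0 p z n where "x0 \<in> X0" "p \<in> span Bp" "z \<in> span Bz" "n \<in> span Bn" "x = x0 + p + z + n"
proof -
  obtain x0 w where "x0 \<in> X0" "w \<in> span (Bp \<union> Bz \<union> Bn)" "x = x0 + w"
    using diagD(15)[OF d \<open>x \<in> X\<close>] by blast
  moreover from this obtain p z n where "p \<in> span Bp" "z \<in> span Bz" "n \<in> span Bn" "w = p + z + n"
    unfolding span_Un by auto
  ultimately show ?thesis using that by (metis add.assoc)
qed

lemma diag_orthogonal:
  assumes h: "hform X h" and d: "diag X h X0 Bp Bz Bn"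
    and m: "x0 \<in> X0" "p \<in> span Bp" "z \<in> span Bz" "n \<in> span Bn"
  shows "h x0 p = 0" "h x0 z = 0" "h x0 n = 0" "h p z = 0" "h p n = 0" "h z n = 0"
proof -
  note D = diagD[OF d]
  have pw: "h a b = 0" if "a \<in> Bp \<union> Bz \<union> Bn" "b \<in> Bp \<union> Bz \<union> Bn" "a \<noteq> b" for a b
    using D(10) that by (auto simp: pairwise_def)
  have o1: "h a b = 0" if "a \<in> Bp" "b \<in> Bz \<union> Bn" for a b
    using that D(11,12,13)[of a] D(12,13)[of b] by (intro pw) force+
  have o2: "h a b = 0" if "a \<in> Bz" "b \<in> Bn" for a b
    using that D(12)[of a] D(13)[of b] by (intro pw) force+
  have x0X: "x0 \<in> X" using m(1) D(2) by blast
  show "h x0 p = 0"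
    by (rule hform_span_right_zero[OF h x0X D(6) _ m(2)]) (rule D(14)[OF m(1)], blast)
  show "h x0 z = 0"
    by (rule hform_span_right_zero[OF h x0X D(7) _ m(3)]) (rule D(14)[OF m(1)], blast)
  show "h x0 n = 0"
    by (rule hform_span_right_zero[OF h x0X D(8) _ m(4)]) (rule D(14)[OF m(1)], blast)
  show "h p z = 0" by (rule hform_span_orth[OF h D(6,7) _ m(2,3)]) (rule o1, auto)
  show "h p n = 0" by (rule hform_span_orth[OF h D(6,8) _ m(2,4)]) (rule o1, auto)
  show "h z n = 0" by (rule hform_span_orth[OF h D(7,8) o2 m(3,4)])
qed

lemma diag_mem:
  assumes h: "hform X h" and d: "diag X h X0 Bp Bz Bn"
  shows "x \<in> X0 \<Longrightarrow> x \<in> X" "x \<in> span Bp \<Longrightarrow> x \<in> X" "x \<in> span Bz \<Longrightarrow> x \<in> X" "x \<in> span Bn \<Longrightarrow> x \<in> X"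
  using diagD(2)[OF d] hform_span[OF h] diagD(6,7,8)[OF d] by blast+

lemma diag_sign:
  assumes h: "hform X h" and d: "diag X h X0 Bp Bz Bn"
  shows "p \<in> span Bp \<Longrightarrow> p \<noteq> 0 \<Longrightarrow> Re (h p p) > 0" "z \<in> span Bz \<Longrightarrow> Re (h z z) = 0"
    "n \<in> span Bn \<Longrightarrow> n \<noteq> 0 \<Longrightarrow> Re (h n n) < 0"
proof -
  note D = diagD[OF d]
  have pw: "pairwise (\<lambda>x y. h x y = 0) B" if "B \<subseteq> Bp \<union> Bz \<union> Bn" for B
    using D(10) that by (rule pairwise_subset)
  show "Re (h p p) > 0" if p: "p \<in> span Bp" "p \<noteq> 0"
  proof -
    obtain a where a: "p = (\<Sum>e\<in>Bp. scale (a e) e)" using span_finite_sum[OF D(3) p(1)] .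
    obtain e where "e \<in> Bp" "a e \<noteq> 0"
      using p(2) unfolding a by (metis (mono_tags, lifting) scale_zero_left sum.neutral)
    then show ?thesis
      unfolding a hform_quad_sum_orth[OF h D(3,6) pw[OF le_supI1[OF sup_ge1]]]
      using D(3) D(11) by (intro sum_pos2[of _ e]) (auto simp: less_imp_le)
  qed
  show "Re (h z z) = 0" if z: "z \<in> span Bz"
  proof -
    obtain a where a: "z = (\<Sum>e\<in>Bz. scale (a e) e)" using span_finite_sum[OF D(4) z] .
    show ?thesis
      unfolding a hform_quad_sum_orth[OF h D(4,7) pw[OF le_supI1[OF sup_ge2]]]
      using D(12) by (auto intro!: sum.neutral)
  qed
  show "Re (h n n) < 0" if n: "n \<in> span Bn" "n \<noteq> 0"
  proof -
    obtain a where a: "n = (\<Sum>e\<in>Bn. scale (a e) e)" using span_finite_sum[OF D(5) n(1)] .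
    obtain e where "e \<in> Bn" "a e \<noteq> 0"
      using n(2) unfolding a by (metis (mono_tags, lifting) scale_zero_left sum.neutral)
    then have "(\<Sum>e\<in>Bn. (cmod (a e))\<^sup>2 * - Re (h e e)) > 0"
      using D(5) D(13) by (intro sum_pos2[of _ e]) (auto simp: less_imp_le mult_nonneg_nonpos mult_pos_neg)
    then show ?thesis
      unfolding a hform_quad_sum_orth[OF h D(5,8) pw[OF sup_ge2]] by (simp add: sum_negf)
  qed
qed

lemma diag_quad:
  assumes h: "hform X h" and d: "diag X h X0 Bp Bz Bn"
    and m: "x0 \<in> X0" "p \<in> span Bp" "z \<in> span Bz" "n \<in> span Bn"
  shows "Re (h (x0 + p + z + n) (x0 + p + z + n)) = Re (h x0 x0) + Re (h p p) + Re (h n n)"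
proof -
  note M = diag_mem[OF h d] and O = diag_orthogonal[OF h d m] and sX = hform_subspace[OF h]
  have mm: "x0 \<in> X" "p \<in> X" "z \<in> X" "n \<in> X" using M m by auto
  have s: "x0 + p \<in> X" "x0 + p + z \<in> X" using mm subspace_add[OF sX] by auto
  have "h (x0 + p + z) n = 0" "h (x0 + p) z = 0"
    using O mm s by (simp_all add: hform_add_left[OF h])
  then show ?thesis
    using hform_quad_orth[OF h s(2) mm(4)] hform_quad_orth[OF h s(1) mm(3)]
      hform_quad_orth[OF h mm(1,2)] O diag_sign(2)[OF h d m(3)] by simp
qed

text \<open>Pairing a kernel element with its own components makes the form vanish on the parts in
  \<open>X0\<close>, \<open>Bp\<close> and \<open>Bn\<close>, where it is definite. Conversely the
  form is null on \<open>Bz\<close> by polarization.\<close>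

lemma diag_kernel:
  assumes h: "hform X h" and d: "diag X h X0 Bp Bz Bn"
    and pos: "\<And>x. x \<in> X0 \<Longrightarrow> x \<noteq> 0 \<Longrightarrow> Re (h x x) > 0"
  shows "kernel X h = span Bz"
proof
  note M = diag_mem[OF h d] and sX = hform_subspace[OF h]
  show "span Bz \<subseteq> kernel X h"
  proof
    fix z assume z: "z \<in> span Bz"
    have "h z x = 0" if x: "x \<in> X" for x
    proof -
      obtain x0 p z' n where e: "x0 \<in> X0" "p \<in> span Bp" "z' \<in> span Bz" "n \<in> span Bn" "x = x0 + p + z' + n"
        using diag_decompose[OF d x] by blast
      note O = diag_orthogonal[OF h d e(1,2) z e(4)]
      have sz: "subspace (span Bz)" by simp
      have "h z z' = 0"
        using diag_sign(2)[OF h d]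
        by (intro hform_null_if_quad_zero[OF hform_mono[OF h sz] _ z e(3)]) (auto simp: M)
      moreover have "h z x0 = 0" "h z p = 0"
        using hform_cnj[OF h, of x0 z] hform_cnj[OF h, of p z] O e z M by auto
      moreover have "x0 \<in> X" "p \<in> X" "z' \<in> X" "n \<in> X" "z \<in> X" using e z M by auto
      moreover from this have "x0 + p \<in> X" "x0 + p + z' \<in> X" using subspace_add[OF sX] by auto
      ultimately show ?thesis using O(6) unfolding e(5) by (simp add: hform_add_right[OF h])
    qed
    then show "z \<in> kernel X h" using z M by (auto simp: kernel_def)
  qed
  show "kernel X h \<subseteq> span Bz"
  proof
    fix x assume x: "x \<in> kernel X h"
    then have xX: "x \<in> X" by (simp add: kernel_def)
    obtain x0 p z n where e: "x0 \<in> X0" "p \<in> span Bp" "z \<in> span Bz" "n \<in> span Bn" "x = x0 + p + z + n"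
      using diag_decompose[OF d xX] by blast
    note O = diag_orthogonal[OF h d e(1-4)]
    have mm: "x0 \<in> X" "p \<in> X" "z \<in> X" "n \<in> X" using e M by auto
    have s: "x0 + p \<in> X" "x0 + p + z \<in> X" using mm subspace_add[OF sX] by auto
    have c: "h p x0 = 0" "h z x0 = 0" "h n x0 = 0" "h z p = 0" "h n p = 0"
      using hform_cnj[OF h mm(1,2)] hform_cnj[OF h mm(1,3)] hform_cnj[OF h mm(1,4)]
        hform_cnj[OF h mm(2,3)] hform_cnj[OF h mm(2,4)] O by auto
    have "h x x0 = 0" "h x p = 0" "h x n = 0" using x mm by (auto simp: kernel_def)
    moreover have "h x y = h x0 y + h p y + h z y + h n y" if "y \<in> X" for y
      using mm s that unfolding e(5) by (simp only: hform_add_left[OF h])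
    ultimately have "h x0 x0 = 0" "h p p = 0" "h n n = 0"
      using mm c O by simp_all
    then have "Re (h x0 x0) = 0" "Re (h p p) = 0" "Re (h n n) = 0" by simp_all
    then have "x0 = 0" "p = 0" "n = 0"
      using pos[OF e(1)] diag_sign(1)[OF h d e(2)] diag_sign(3)[OF h d e(4)] by (metis less_irrefl)+
    then show "x \<in> span Bz" using e(3,5) by simp
  qed
qed

lemma diag_card:
  assumes "diag X h X0 Bp Bz Bn"
  shows "card (Bz \<union> Bn) = card Bz + card Bn"
  using diagD(4,5,12,13)[OF assms] by (intro card_Un_disjoint) force+

lemma independent_subset: "independent B \<Longrightarrow> A \<subseteq> B \<Longrightarrow> independent A"
  using dependent_mono by blast

lemma subspace_add_span: "subspace A \<Longrightarrow> subspace {x + y |x y. x \<in> A \<and> y \<in> span B}"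
  using subspace_sums[OF _ subspace_span] by blast

text \<open>Nonnegativity of \<open>g\<close> at x - p yields g(x+p) \<le> 2 g(x) + 2 g(p). On the
  span of \<open>Bp\<close> the form \<open>h\<close> controls \<open>g\<close> by finite dimension,
  and orthogonality adds the two estimates. The factor 2 is the reason for halving \<delta>.\<close>

lemma diag_coercive:
  assumes h: "hform X h" and d: "diag X h X0 Bp Bz Bn" and g: "hform X g"
    and g0: "\<And>x. x \<in> X \<Longrightarrow> 0 \<le> Re (g x x)"
    and e0: "\<epsilon> > 0" "\<And>x. x \<in> X0 \<Longrightarrow> \<epsilon> * Re (g x x) \<le> Re (h x x)"
  shows "\<exists>\<delta>>0. \<forall>x\<in>X0. \<forall>p\<in>span Bp. \<delta> * Re (g (x + p) (x + p)) \<le> Re (h (x + p) (x + p))"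
proof -
  obtain K where K: "K > 0" "\<And>w. w \<in> span Bp \<Longrightarrow> \<bar>Re (g w w)\<bar> \<le> K * Re (h w w)"
    using hform_bounded_by_definite[OF g h diagD(3,6)[OF d] diag_sign(1)[OF h d]] by blast
  define \<delta> where "\<delta> = min \<epsilon> (1 / K) / 2"
  have d0: "\<delta> > 0" "2 * \<delta> \<le> \<epsilon>" "2 * \<delta> \<le> 1 / K" using e0 K by (auto simp: \<delta>_def)
  have "\<delta> * Re (g (x + p) (x + p)) \<le> Re (h (x + p) (x + p))" if x: "x \<in> X0" and p: "p \<in> span Bp" for x p
  proof -
    have m: "x \<in> X" "p \<in> X" using x p diag_mem[OF h d] by auto
    have m2: "scale (-1) p \<in> X" using m subspace_scale[OF hform_subspace[OF h]] by blast
    have "0 \<le> Re (g (x + scale (-1) p) (x + scale (-1) p))"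
      by (rule g0[OF subspace_add[OF hform_subspace[OF h] m(1) m2]])
    also have "\<dots> = Re (g x x) + Re (g p p) - 2 * Re (g x p)"
      using hform_quad_add[OF g m(1) m2] hform_quad_scale[OF g m(2), of "-1"]
        hform_scale_right[OF g m(2,1), of "-1"] by simp
    finally have "Re (g (x + p) (x + p)) \<le> 2 * Re (g x x) + 2 * Re (g p p)"
      using hform_quad_add[OF g m] by simp
    then have "\<delta> * Re (g (x + p) (x + p)) \<le> \<delta> * (2 * Re (g x x) + 2 * Re (g p p))"
      using d0 by (intro mult_left_mono) auto
    also have "\<dots> = (2 * \<delta>) * Re (g x x) + (2 * \<delta>) * Re (g p p)" by (simp add: algebra_simps)
    also have "\<dots> \<le> \<epsilon> * Re (g x x) + (1 / K) * Re (g p p)"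
      using d0 g0 m by (intro add_mono mult_right_mono) auto
    also have "(1 / K) * Re (g p p) \<le> Re (h p p)"
      using K(2)[OF p] K(1) by (simp add: divide_simps mult.commute)
    also have "\<epsilon> * Re (g x x) + Re (h p p) \<le> Re (h x x) + Re (h p p)"
      using e0 x by simp
    also have "\<dots> = Re (h (x + p) (x + p))"
      using hform_quad_orth[OF h m] diag_orthogonal(1)[OF h d x p span_zero span_zero] by simp
    finally show ?thesis by simp
  qed
  then show ?thesis using d0 by blast
qed

text \<open>The space \<open>X0\<close> plus the span of \<open>Bp\<close> has codimension at most
  \<open>card Bz + card Bn\<close>, and a nonpositive space cannot meet it. Positivity is asked of
  another form \<open>h'\<close>, so that the diagonalization of \<open>h\<close> also bounds the
  index of its perturbations.\<close>

lemma npos_le_diag: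
  assumes h: "hform X h" and d: "diag X h X0 Bp Bz Bn"
    and pos: "\<And>x p. x \<in> X0 \<Longrightarrow> p \<in> span Bp \<Longrightarrow> x + p \<noteq> 0 \<Longrightarrow> Re (h' (x + p) (x + p)) > 0"
    and n: "npos X h' m"
  shows "m \<le> card Bz + card Bn"
proof (rule ccontr)
  assume m: "\<not> ?thesis"
  obtain C where C: "C \<subseteq> X" "finite C" "independent C" "card C = m" "\<And>x. x \<in> span C \<Longrightarrow> Re (h' x x) \<le> 0"
    using n by (auto simp: npos_def)
  let ?A = "{x + y |x y. x \<in> X0 \<and> y \<in> span Bp}"
  have "\<exists>x\<in>span C. x \<noteq> 0 \<and> x \<in> ?A"
  proof (rule pigeonhole_span[where B = "Bz \<union> Bn"])
    show "\<exists>w\<in>span (Bz \<union> Bn). x - w \<in> ?A" if "x \<in> C" for x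
    proof -
      have "x \<in> X" using that C by auto
      then obtain x0 p z n where e: "x0 \<in> X0" "p \<in> span Bp" "z \<in> span Bz" "n \<in> span Bn" "x = x0 + p + z + n"
        using diag_decompose[OF d] by metis
      then show ?thesis
        by (intro bexI[of _ "z + n"]) (auto simp: span_Un)
    qed
  qed (use C m d diagD[OF d] diag_card[OF d] subspace_add_span in auto)
  then show False using C pos by force
qed

text \<open>The origin of all strict inequalities: a merely nonpositive space is bounded by the
  negative index once it misses the kernel. A vector it shares with the nonnegative part has zero
  components in \<open>X0\<close> and \<open>Bp\<close>, hence lies in the kernel.\<close>

lemma neg_le_diag:
  assumes h: "hform X h" and d: "diag X h X0 Bp Bz Bn"
    and pos: "\<And>x. x \<in> X0 \<Longrightarrow> x \<noteq> 0 \<Longrightarrow> Re (h x x) > 0"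
    and C: "C \<subseteq> X" "finite C" "independent C" "\<And>x. x \<in> span C \<Longrightarrow> Re (h x x) \<le> 0"
    and K: "span C \<inter> kernel X h \<subseteq> {0}"
  shows "card C \<le> card Bn"
proof (rule ccontr)
  assume m: "\<not> ?thesis"
  let ?A = "{x + y |x y. x \<in> X0 \<and> y \<in> span (Bp \<union> Bz)}"
  have "\<exists>x\<in>span C. x \<noteq> 0 \<and> x \<in> ?A"
  proof (rule pigeonhole_span[where B = "Bn"])
    show "\<exists>w\<in>span Bn. x - w \<in> ?A" if "x \<in> C" for x
    proof -
      have "x \<in> X" using that C by auto
      then obtain x0 p z n where e: "x0 \<in> X0" "p \<in> span Bp" "z \<in> span Bz" "n \<in> span Bn" "x = x0 + p + z + n"
        using diag_decompose[OF d] by metis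
      then have "p + z \<in> span (Bp \<union> Bz)" by (auto simp: span_Un)
      then show ?thesis using e
        by (intro bexI[of _ "n"]) (auto simp: add.assoc)
    qed
  qed (use C m d diagD[OF d] subspace_add_span in auto)
  then obtain x0 p z where e: "x0 \<in> X0" "p \<in> span Bp" "z \<in> span Bz" "x0 + p + z \<in> span C" "x0 + p + z \<noteq> 0"
    unfolding span_Un by (auto simp: add.assoc)
  have "Re (h x0 x0) + Re (h p p) \<le> 0"
    using C(4)[OF e(4)] diag_quad[OF h d e(1-3) span_zero] hform_zero_left[OF h, of 0]
      subspace_0[OF hform_subspace[OF h]] by simp
  moreover have "Re (h 0 0) = 0" using hform_zero_left[OF h] subspace_0[OF hform_subspace[OF h]] by auto
  ultimately have "x0 = 0" "p = 0"
    using pos[OF e(1)] diag_sign(1)[OF h d e(2)] by (smt (verit))+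
  moreover have "z \<in> kernel X h" using e(3) diag_kernel[OF h d pos] by blast
  ultimately show False using K e(4,5) by auto
qed

section \<open>Counting dimensions of nonpositive and negative subspaces\<close>

lemma npos_mono: "npos X h m \<Longrightarrow> X \<subseteq> Y \<Longrightarrow> npos Y h m"
  unfolding npos_def by blast

lemma subset_with_card:
  assumes "finite C" "independent C" "k \<le> card C"
  obtains D where "D \<subseteq> C" "finite D" "independent D" "card D = k" "span D \<subseteq> span C"
proof -
  obtain D where "D \<subseteq> C" "card D = k" "finite D"
    using obtain_subset_with_card_n[OF assms(3)] by blast
  then show ?thesis
    using that[of D] independent_subset[OF assms(2)] span_mono[of D C] by simp
qed

lemma npos_downward:
  assumes "npos X h m" "k \<le> m"
  shows "npos X h k"
proof -
  obtain C where C: "C \<subseteq> X" "finite C" "independent C" "card C = m" "\<forall>x\<in>span C. Re (h x x) \<le> 0"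
    using assms by (auto simp: npos_def)
  moreover obtain D where "D \<subseteq> C" "finite D" "independent D" "card D = k" "span D \<subseteq> span C"
    using subset_with_card[OF C(2,3), of k] C(4) assms(2) by auto
  ultimately show ?thesis
    unfolding npos_def by (intro exI[of _ D] conjI ballI) (auto dest!: subsetD)
qed

lemma neg_downward:
  assumes "neg X h m" "k \<le> m"
  shows "neg X h k"
proof -
  obtain C where C: "C \<subseteq> X" "finite C" "independent C" "card C = m"
      "\<forall>x\<in>span C. x \<noteq> 0 \<longrightarrow> Re (h x x) < 0"
    using assms by (auto simp: neg_def)
  moreover obtain D where "D \<subseteq> C" "finite D" "independent D" "card D = k" "span D \<subseteq> span C"
    using subset_with_card[OF C(2,3), of k] C(4) assms(2) by auto
  ultimately show ?thesis
    unfolding neg_def by (intro exI[of _ D] conjI ballI) (auto dest!: subsetD)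
qed

lemma neg_imp_npos:
  assumes h: "hform X h" and "neg X h m"
  shows "npos X h m"
proof -
  have "Re (h 0 0) = 0"
    using hform_zero_left[OF h] subspace_0[OF hform_subspace[OF h]] by simp
  moreover obtain C where C: "C \<subseteq> X" "finite C" "independent C" "card C = m"
      "\<And>x. x \<in> span C \<Longrightarrow> x \<noteq> 0 \<Longrightarrow> Re (h x x) < 0"
    using assms by (auto simp: neg_def)
  ultimately have "\<forall>x\<in>span C. Re (h x x) \<le> 0" by (metis less_imp_le order_refl)
  then show ?thesis unfolding npos_def using C(1-4) by blast
qed

lemma diag_npos:
  assumes h: "hform X h" and d: "diag X h X0 Bp Bz Bn"
  shows "npos X h (card Bz + card Bn)"
proof -
  have "Re (h x x) \<le> 0" if x: "x \<in> span (Bz \<union> Bn)" for x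
  proof -
    obtain z n where e: "z \<in> span Bz" "n \<in> span Bn" "x = z + n" using x by (auto simp: span_Un)
    have "Re (h 0 0) = 0" using hform_zero_left[OF h] subspace_0[OF hform_subspace[OF h]] by auto
    then show ?thesis
      using diag_quad[OF h d subspace_0[OF diagD(1)[OF d]] span_zero e(1,2)] diag_sign(3)[OF h d e(2)] e
      by (cases "n = 0") auto
  qed
  moreover have "Bz \<union> Bn \<subseteq> X" "finite (Bz \<union> Bn)" using diagD[OF d] by auto
  moreover have "independent (Bz \<union> Bn)" by (rule independent_subset[OF diagD(9)[OF d]]) auto
  ultimately show ?thesis
    unfolding npos_def using diag_card[OF d] by (intro exI[of _ "Bz \<union> Bn"]) auto
qed

lemma diag_neg:
  assumes h: "hform X h" and d: "diag X h X0 Bp Bz Bn"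
  shows "neg X h (card Bn)"
proof -
  have "independent Bn" by (rule independent_subset[OF diagD(9)[OF d]]) auto
  then show ?thesis
    unfolding neg_def using diagD(5,8)[OF d] diag_sign(3)[OF h d] by (intro exI[of _ Bn]) blast
qed

lemma kernel_neg_trivial:
  assumes C: "C \<subseteq> X" "\<And>x. x \<in> span C \<Longrightarrow> x \<noteq> 0 \<Longrightarrow> Re (h x x) < 0" and h: "hform X h"
  shows "span C \<inter> kernel X h \<subseteq> {0}"
  using C(2) hform_span[OF h C(1)] by (force simp: kernel_def)

text \<open>Sylvester's law of inertia: the cardinalities do not depend on the
  diagonalization.\<close>

lemma index_diag:
  assumes h: "hform X h" and d: "diag X h X0 Bp Bz Bn"
    and pos: "\<And>x. x \<in> X0 \<Longrightarrow> x \<noteq> 0 \<Longrightarrow> Re (h x x) > 0"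
  shows "npos X h m \<longleftrightarrow> m \<le> card Bz + card Bn" "neg X h m \<longleftrightarrow> m \<le> card Bn"
    "kernel X h = span Bz" "dim (kernel X h) = card Bz"
proof -
  have "Re (h (x + p) (x + p)) > 0" if "x \<in> X0" "p \<in> span Bp" "x + p \<noteq> 0" for x p
  proof -
    have z: "Re (h 0 0) = 0" using hform_zero_left[OF h] subspace_0[OF hform_subspace[OF h]] by auto
    have "Re (h (x + p) (x + p)) = Re (h x x) + Re (h p p)"
      using diag_quad[OF h d that(1,2) span_zero span_zero] z by simp
    then show ?thesis
      using pos[OF that(1)] diag_sign(1)[OF h d that(2)] that(3) z
      by (cases "x = 0"; cases "p = 0") (auto intro: add_pos_pos)
  qed
  then show "npos X h m \<longleftrightarrow> m \<le> card Bz + card Bn"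
    using npos_le_diag[OF h d] npos_downward[OF diag_npos[OF h d]] by blast
  have "m \<le> card Bn" if n: "neg X h m"
  proof -
    obtain C where C: "C \<subseteq> X" "finite C" "independent C" "card C = m"
        "\<And>x. x \<in> span C \<Longrightarrow> x \<noteq> 0 \<Longrightarrow> Re (h x x) < 0"
      using n by (auto simp: neg_def)
    have "Re (h x x) \<le> 0" if "x \<in> span C" for x
      using C(5)[OF that] hform_zero_left[OF h] subspace_0[OF hform_subspace[OF h]]
      by (cases "x = 0") auto
    then show ?thesis
      using neg_le_diag[OF h d pos C(1-3) _ kernel_neg_trivial[OF C(1,5) h]] C(4) by blast
  qed
  then show "neg X h m \<longleftrightarrow> m \<le> card Bn"
    using neg_downward[OF diag_neg[OF h d]] by blast
  show "kernel X h = span Bz" by (rule diag_kernel[OF h d pos])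
  then show "dim (kernel X h) = card Bz"
    using dim_span_eq_card_independent[OF independent_subset[OF diagD(9)[OF d], of Bz]] by auto
qed

text \<open>Upper semicontinuity of the nonpositive index. Lowering the form by a small multiple of
  \<open>g\<close> leaves it positive on the finite-codimensional positive part, by coercivity
  there; half of the coercivity constant is kept for strictness.\<close>

lemma npos_perturb:
  assumes h: "hform X h" and d: "diag X h X0 Bp Bz Bn" and g: "hform X g"
    and g0: "\<And>x. x \<in> X \<Longrightarrow> x \<noteq> 0 \<Longrightarrow> 0 < Re (g x x)"
    and e0: "\<epsilon> > 0" "\<And>x. x \<in> X0 \<Longrightarrow> \<epsilon> * Re (g x x) \<le> Re (h x x)"
  shows "\<exists>\<delta>>0. \<forall>h'. (\<forall>x\<in>X. Re (h x x) - \<delta> * Re (g x x) \<le> Re (h' x x)) \<longrightarrow>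
    (\<forall>m. npos X h' m \<longrightarrow> npos X h m)"
proof -
  have "0 \<le> Re (g x x)" if "x \<in> X" for x
    using g0[OF that] hform_zero_left[OF g that] by (cases "x = 0") auto
  then obtain \<delta> where \<delta>: "\<delta> > 0" "\<And>x p. x \<in> X0 \<Longrightarrow> p \<in> span Bp \<Longrightarrow> \<delta> * Re (g (x + p) (x + p)) \<le> Re (h (x + p) (x + p))"
    using diag_coercive[OF h d g _ e0] by blast
  have "npos X h m" if h': "\<forall>x\<in>X. Re (h x x) - \<delta> / 2 * Re (g x x) \<le> Re (h' x x)" and n: "npos X h' m" for h' m
  proof -
    have "Re (h' (x + p) (x + p)) > 0" if "x \<in> X0" "p \<in> span Bp" "x + p \<noteq> 0" for x p
    proof -
      have m: "x + p \<in> X" using that diag_mem[OF h d] subspace_add[OF hform_subspace[OF h]] by auto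
      have "Re (h (x + p) (x + p)) - \<delta> / 2 * Re (g (x + p) (x + p)) \<le> Re (h' (x + p) (x + p))"
        by (rule bspec[OF h' m])
      moreover have "0 < \<delta> / 2 * Re (g (x + p) (x + p))" using g0[OF m that(3)] \<delta>(1) by simp
      moreover have "\<delta> * Re (g (x + p) (x + p)) \<le> Re (h (x + p) (x + p))" by (rule \<delta>(2)[OF that(1,2)])
      ultimately show ?thesis by linarith
    qed
    then have "m \<le> card Bz + card Bn" by (rule npos_le_diag[OF h d _ n])
    then show ?thesis using npos_downward[OF diag_npos[OF h d]] by blast
  qed
  then show ?thesis using \<delta>(1) by (intro exI[of _ "\<delta> / 2"]) auto
qed

text \<open>Lower semicontinuity of the negative index. On the finite-dimensional negative space g
  \<le> K(-h), so adding g/(2K) consumes at most half of -h.\<close>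

lemma neg_perturb:
  assumes h: "hform X h" and g: "hform X g" and g0: "\<And>x. x \<in> X \<Longrightarrow> x \<noteq> 0 \<Longrightarrow> 0 < Re (g x x)"
    and n: "neg X h m"
  shows "\<exists>\<delta>>0. \<forall>h'. (\<forall>x\<in>X. Re (h' x x) \<le> Re (h x x) + \<delta> * Re (g x x)) \<longrightarrow> neg X h' m"
proof -
  obtain C where C: "C \<subseteq> X" "finite C" "independent C" "card C = m"
      "\<And>x. x \<in> span C \<Longrightarrow> x \<noteq> 0 \<Longrightarrow> Re (h x x) < 0"
    using n by (auto simp: neg_def)
  have "hform X (\<lambda>x y. complex_of_real (-1) * h x y)" by (rule hform_cmult[OF h])
  then obtain K where K: "K > 0" "\<And>w. w \<in> span C \<Longrightarrow> \<bar>Re (g w w)\<bar> \<le> K * - Re (h w w)"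
    using hform_bounded_by_definite[OF g _ C(2,1), of "\<lambda>x y. complex_of_real (-1) * h x y"] C(5) by auto
  have "neg X h' m" if h': "\<forall>x\<in>X. Re (h' x x) \<le> Re (h x x) + 1 / (2 * K) * Re (g x x)" for h'
  proof -
    have "Re (h' x x) < 0" if x: "x \<in> span C" "x \<noteq> 0" for x
    proof -
      have xX: "x \<in> X" using x hform_span[OF h C(1)] by auto
      have "1 / (2 * K) * Re (g x x) \<le> - Re (h x x) / 2"
        using K(2)[OF x(1)] K(1) by (simp add: divide_simps mult.commute)
      then show ?thesis using h' xX C(5)[OF x] by (smt (verit) field_sum_of_halves)
    qed
    then show ?thesis unfolding neg_def using C by blast
  qed
  then show ?thesis using K(1) by (intro exI[of _ "1 / (2 * K)"]) auto
qed

text \<open>Coercivity up to finite dimension, measured by the comparison form \<open>g\<close>;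
  this is the hypothesis under which indices are finite and semicontinuous.\<close>

definition regular :: "'v set \<Rightarrow> ('v \<Rightarrow> 'v \<Rightarrow> complex) \<Rightarrow> ('v \<Rightarrow> 'v \<Rightarrow> complex) \<Rightarrow> bool" where
  "regular X g h \<longleftrightarrow> (\<exists>X0 Bp Bz Bn. diag X h X0 Bp Bz Bn \<and>
     (\<exists>\<epsilon>>0. \<forall>x\<in>X0. \<epsilon> * Re (g x x) \<le> Re (h x x)))"

lemma regularE:
  assumes "regular X g h" and g: "\<And>x. x \<in> X \<Longrightarrow> x \<noteq> 0 \<Longrightarrow> 0 < Re (g x x)"
  obtains X0 Bp Bz Bn \<epsilon> where "diag X h X0 Bp Bz Bn" "\<epsilon> > 0" "\<And>x. x \<in> X0 \<Longrightarrow> \<epsilon> * Re (g x x) \<le> Re (h x x)"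
    "\<And>x. x \<in> X0 \<Longrightarrow> x \<noteq> 0 \<Longrightarrow> Re (h x x) > 0"
proof -
  obtain X0 Bp Bz Bn \<epsilon> where d: "diag X h X0 Bp Bz Bn" "\<epsilon> > 0" "\<And>x. x \<in> X0 \<Longrightarrow> \<epsilon> * Re (g x x) \<le> Re (h x x)"
    using assms(1) unfolding regular_def by blast
  have "Re (h x x) > 0" if "x \<in> X0" "x \<noteq> 0" for x
  proof -
    have "0 < \<epsilon> * Re (g x x)" using g[OF _ that(2)] that(1) d diagD(2)[OF d(1)] by auto
    then show ?thesis using d(3)[OF that(1)] by linarith
  qed
  then show ?thesis using that d by blast
qed

text \<open>Applied with \<open>Y\<close> the functions vanishing at both ends, this makes
  eigenvalues on the zeroth layer strictly smaller than the Dirichlet ones.\<close>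

lemma npos_subspace_imp_neg:
  assumes h: "hform X h" and r: "regular X g h" and g: "\<And>x. x \<in> X \<Longrightarrow> x \<noteq> 0 \<Longrightarrow> 0 < Re (g x x)"
    and Y: "subspace Y" "Y \<subseteq> X" and K: "kernel X h \<inter> Y \<subseteq> {0}" and n: "npos Y h m"
  shows "neg X h m"
proof -
  obtain X0 Bp Bz Bn \<epsilon> where d: "diag X h X0 Bp Bz Bn"
    and pos: "\<And>x. x \<in> X0 \<Longrightarrow> x \<noteq> 0 \<Longrightarrow> Re (h x x) > 0"
    using regularE[OF r g] by metis
  obtain C where C: "C \<subseteq> Y" "finite C" "independent C" "card C = m" "\<And>x. x \<in> span C \<Longrightarrow> Re (h x x) \<le> 0"
    using n by (auto simp: npos_def)
  have "span C \<subseteq> Y" by (rule span_minimal[OF C(1) Y(1)])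
  then have "card C \<le> card Bn"
    using K by (intro neg_le_diag[OF h d pos _ C(2,3,5)]) (use C(1) Y(2) in auto)
  then show ?thesis using neg_downward[OF diag_neg[OF h d]] C(4) by blast
qed

text \<open>Passing to codimension at most \<open>card L\<close> costs at most \<open>card L\<close>
  dimensions, and again nonpositive improves to negative. If the count failed, some nonzero x would
  lie both in the nonpositive part of \<open>X\<close> and in the nonnegative part of
  \<open>Y\<close>; then its negative component vanishes and x is a kernel element in
  \<open>Y\<close>.\<close>

lemma npos_imp_neg_subspace:
  assumes h: "hform X h" and r: "regular X g h" and g: "\<And>x. x \<in> X \<Longrightarrow> x \<noteq> 0 \<Longrightarrow> 0 < Re (g x x)"
    and Y: "subspace Y" "Y \<subseteq> X" and rY: "regular Y g h"
    and K: "kernel X h \<inter> Y \<subseteq> {0}"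
    and L: "finite L" "\<And>x. x \<in> X \<Longrightarrow> \<exists>w\<in>span L. x - w \<in> Y"
    and n: "npos X h m"
  shows "neg Y h (m - card L)"
proof -
  have hY: "hform Y h" by (rule hform_mono[OF h Y])
  obtain X0 Bp Bz Bn \<epsilon> where d: "diag X h X0 Bp Bz Bn"
    and pos: "\<And>x. x \<in> X0 \<Longrightarrow> x \<noteq> 0 \<Longrightarrow> Re (h x x) > 0"
    using regularE[OF r g] by metis
  have gY: "\<And>x. x \<in> Y \<Longrightarrow> x \<noteq> 0 \<Longrightarrow> 0 < Re (g x x)" using g Y(2) by blast
  obtain Y0 Cp Cz Cn \<epsilon>' where d': "diag Y h Y0 Cp Cz Cn"
    and pos': "\<And>x. x \<in> Y0 \<Longrightarrow> x \<noteq> 0 \<Longrightarrow> Re (h x x) > 0"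
    using regularE[OF rY gY] by metis
  note D = diagD[OF d] and D' = diagD[OF d']
  have h0: "Re (h 0 0) = 0" using hform_zero_left[OF h] subspace_0[OF hform_subspace[OF h]] by auto
  have "card Bz + card Bn \<le> card Cn + card L"
  proof (rule ccontr)
    assume a: "\<not> ?thesis"
    let ?A = "{x + y |x y. x \<in> Y0 \<and> y \<in> span (Cp \<union> Cz)}"
    have "\<exists>x\<in>span (Bz \<union> Bn). x \<noteq> 0 \<and> x \<in> ?A"
    proof (rule pigeonhole_span[where B = "Cn \<union> L"])
      have "card (Cn \<union> L) \<le> card Cn + card L" by (rule card_Un_le)
      then show "card (Cn \<union> L) < card (Bz \<union> Bn)" using a diag_card[OF d] by linarith
      show "independent (Bz \<union> Bn)" by (rule independent_subset[OF D(9)]) auto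
      fix x assume "x \<in> Bz \<union> Bn"
      then have "x \<in> X" using D(7,8) by blast
      then obtain w where w: "w \<in> span L" "x - w \<in> Y" using L(2) by blast
      obtain x0 p z n where e: "x0 \<in> Y0" "p \<in> span Cp" "z \<in> span Cz" "n \<in> span Cn" "x - w = x0 + p + z + n"
        using diag_decompose[OF d' w(2)] by metis
      have "p + z \<in> span (Cp \<union> Cz)" using e by (auto simp: span_Un)
      moreover have "x - (n + w) = x0 + (p + z)" using e(5) by (simp add: algebra_simps)
      ultimately have "x - (n + w) \<in> ?A" using e(1) by blast
      moreover have "n + w \<in> span (Cn \<union> L)" using e(4) w(1) by (auto simp: span_Un)
      ultimately show "\<exists>w\<in>span (Cn \<union> L). x - w \<in> ?A" by blast
    qed (use D D' L(1) subspace_add_span in auto)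
    then obtain x x0 y where xy: "x \<in> span (Bz \<union> Bn)" "x \<noteq> 0" "x0 \<in> Y0" "y \<in> span (Cp \<union> Cz)" "x = x0 + y"
      by blast
    from xy(4) obtain p z where "p \<in> span Cp" "z \<in> span Cz" "y = p + z"
      unfolding span_Un by blast
    with xy have x: "x \<in> span (Bz \<union> Bn)" "x \<noteq> 0" "x0 \<in> Y0" "p \<in> span Cp" "z \<in> span Cz" "x = x0 + p + z"
      by (simp_all add: add.assoc)
    have "x0 \<in> Y" "p \<in> Y" "z \<in> Y" using diag_mem[OF hY d'] x by auto
    then have xY: "x \<in> Y" unfolding x(6) using subspace_add[OF Y(1)] by blast
    have "Re (h x0 x0) \<ge> 0" using pos'[OF x(3)] h0 by (cases "x0 = 0") auto
    moreover have "Re (h p p) \<ge> 0" using diag_sign(1)[OF hY d' x(4)] h0 by (cases "p = 0") auto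
    ultimately have "Re (h x x) \<ge> 0"
      using diag_quad[OF hY d' x(3-5) span_zero] x(6) h0 by simp
    moreover obtain z' n where e: "z' \<in> span Bz" "n \<in> span Bn" "x = z' + n" using x(1) by (auto simp: span_Un)
    moreover have "Re (h x x) = Re (h n n)"
      using diag_quad[OF h d subspace_0[OF D(1)] span_zero e(1,2)] e(3) h0 by simp
    ultimately have "n = 0" using diag_sign(3)[OF h d e(2)] by (metis not_less)
    then have "x \<in> kernel X h" using e diag_kernel[OF h d pos] by simp
    then show False using K xY x(2) by blast
  qed
  moreover have "m \<le> card Bz + card Bn" using n index_diag(1)[OF h d pos] by blast
  ultimately have "m - card L \<le> card Cn" by linarith
  then show ?thesis by (rule neg_downward[OF diag_neg[OF hY d']])
qed

lemma npos_antimono: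
  assumes h: "hform X h" and le: "\<And>x. x \<in> X \<Longrightarrow> Re (h'' x x) \<le> Re (h' x x)" and n: "npos X h' m"
  shows "npos X h'' m"
proof -
  obtain C where C: "C \<subseteq> X" "finite C" "independent C" "card C = m" "\<And>x. x \<in> span C \<Longrightarrow> Re (h' x x) \<le> 0"
    using n by (auto simp: npos_def)
  have "Re (h'' x x) \<le> 0" if "x \<in> span C" for x
    using le[of x] C(5)[OF that] hform_span[OF h C(1)] that by fastforce
  then show ?thesis unfolding npos_def using C(1-4) by blast
qed

lemma independent_Un_disjoint:
  assumes "finite A" "finite B" "independent A" "independent B" "span A \<inter> span B \<subseteq> {0}"
  shows "independent (A \<union> B)" "A \<inter> B = {}"
proof -
  show dis: "A \<inter> B = {}"
  proof (rule ccontr)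
    assume "A \<inter> B \<noteq> {}"
    then obtain x where "x \<in> A" "x \<in> B" by blast
    moreover from this have "x = 0" using assms(5) span_base[of x A] span_base[of x B] by blast
    ultimately show False using assms(3) dependent_zero by blast
  qed
  show "independent (A \<union> B)"
  proof (rule independent_if_scalars_zero)
    fix f x assume f: "(\<Sum>x\<in>A \<union> B. scale (f x) x) = 0" "x \<in> A \<union> B"
    let ?a = "\<Sum>x\<in>A. scale (f x) x" and ?b = "\<Sum>x\<in>B. scale (f x) x"
    have s: "?a + ?b = 0" using f(1) assms dis by (simp add: sum.union_disjoint)
    have "?a \<in> span A" "?b \<in> span B"
      by (intro span_sum span_scale span_base; assumption)+
    moreover have "?a = - ?b" using s by (simp add: eq_neg_iff_add_eq_0)
    moreover from calculation have "?a \<in> span B" by (simp only: span_neg)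
    ultimately have "?a = 0" using assms(5) by blast
    then have "?a = 0" "?b = 0" using s by auto
    then show "f x = 0"
      using f(2) independentD[OF assms(3,1) subset_refl, of f x] independentD[OF assms(4,2) subset_refl, of f x]
      by auto
  qed (use assms in auto)
qed

text \<open>Subtracts from each c its \<open>h\<close>-orthogonal projection \<open>P c\<close> onto
  the span of \<open>B\<close>, which exists because \<open>h\<close> is nondegenerate on that
  orthogonal family. As \<open>P c\<close> lies in \<open>Y\<close>, the complement of
  \<open>Y\<close> stays a complement; as \<open>B\<close> is orthogonal to \<open>Z\<close>,
  orthogonality to \<open>Z\<close> survives. Cross terms then disappear from the quadratic
  form.\<close>

lemma adjust_complement:
  assumes h: "hform X h" and Y: "subspace Y" "Y \<subseteq> X"
    and B: "finite B" "B \<subseteq> Y" "pairwise (\<lambda>x y. h x y = 0) B" "\<And>e. e \<in> B \<Longrightarrow> h e e \<noteq> 0"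
    and C: "finite C" "C \<subseteq> X" "independent C" "span C \<inter> Y \<subseteq> {0}" "\<And>x. x \<in> X \<Longrightarrow> \<exists>w\<in>span C. x - w \<in> Y"
    and Z: "Z \<subseteq> X" "\<And>c z. c \<in> C \<Longrightarrow> z \<in> Z \<Longrightarrow> h c z = 0" "\<And>e z. e \<in> B \<Longrightarrow> z \<in> Z \<Longrightarrow> h e z = 0"
  obtains D where "finite D" "D \<subseteq> X" "card D = card C" "independent D" "span D \<inter> Y \<subseteq> {0}"
    "\<And>x. x \<in> X \<Longrightarrow> \<exists>w\<in>span D. x - w \<in> Y"
    "\<And>c e. c \<in> span D \<Longrightarrow> e \<in> span B \<Longrightarrow> h c e = 0" "\<And>c z. c \<in> span D \<Longrightarrow> z \<in> Z \<Longrightarrow> h c z = 0"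
proof -
  note sX = hform_subspace[OF h]
  have BX: "B \<subseteq> X" using B Y by blast
  define P where "P c = (\<Sum>e\<in>B. scale (h c e / h e e) e)" for c
  define f where "f c = c - P c" for c
  have PB: "P c \<in> span B" for c unfolding P_def by (intro span_sum span_scale span_base)
  have PY: "P c \<in> Y" for c using PB span_minimal[OF B(2) Y(1)] by blast
  have fX: "f c \<in> X" if "c \<in> C" for c
    using that C(2) PY Y(2) sX unfolding f_def by (auto intro: subspace_diff)
  have P_eq: "h (P c) e = h c e" if "e \<in> B" for c e
  proof -
    have "h (P c) e = (\<Sum>e'\<in>B. h c e' / h e' e' * h e' e)"
      unfolding P_def using that BX by (intro hform_sum_left[OF h _ B(1)]) auto
    also have "\<dots> = (\<Sum>e'\<in>B. if e' = e then h c e else 0)"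
      using B(3) B(4) that by (intro sum.cong) (auto simp: pairwise_def)
    also have "\<dots> = h c e" using that B(1) by simp
    finally show ?thesis .
  qed
  have diff: "h (f c) x = h c x - h (P c) x" if "c \<in> C" "x \<in> X" for c x
  proof -
    have "h (f c + P c) x = h (f c) x + h (P c) x"
      using fX[OF that(1)] PY Y(2) that(2) by (intro hform_add_left[OF h]) auto
    then show ?thesis by (simp add: f_def)
  qed
  have key: "u c = 0" if "(\<Sum>c\<in>C. scale (u c) (f c)) \<in> Y" "c \<in> C" for u c
  proof -
    have "(\<Sum>c\<in>C. scale (u c) c) = (\<Sum>c\<in>C. scale (u c) (f c)) + (\<Sum>c\<in>C. scale (u c) (P c))"
      by (simp add: f_def sum.distrib[symmetric] scale_right_distrib[symmetric])
    also have "\<dots> \<in> Y" using that PY Y(1) by (auto intro!: subspace_add subspace_sum subspace_scale)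
    finally have "(\<Sum>c\<in>C. scale (u c) c) \<in> Y" .
    moreover have "(\<Sum>c\<in>C. scale (u c) c) \<in> span C" by (intro span_sum span_scale span_base)
    ultimately have "(\<Sum>c\<in>C. scale (u c) c) = 0" using C(4) by blast
    then show ?thesis using independentD[OF C(3,1) subset_refl _ that(2)] by blast
  qed
  have inj: "inj_on f C"
  proof (rule inj_onI, rule ccontr)
    fix x y assume xy: "x \<in> C" "y \<in> C" "f x = f y" "x \<noteq> y"
    let ?u = "\<lambda>v. if v = x then 1 else if v = y then -1 else (0::complex)"
    have "(\<Sum>v\<in>C. scale (?u v) (f v)) = (\<Sum>v\<in>{x,y}. scale (?u v) (f v))"
      using xy C(1) by (intro sum.mono_neutral_right) auto
    also have "\<dots> = 0" using xy by simp
    finally show False using key[of ?u x] xy subspace_0[OF Y(1)] by simp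
  qed
  have sp: "\<exists>u. w = (\<Sum>c\<in>C. scale (u c) (f c))" if w: "w \<in> span (f ` C)" for w
  proof -
    obtain u where "w = (\<Sum>v\<in>f ` C. scale (u v) v)"
      using span_finite_sum[OF finite_imageI[OF C(1)] w] .
    then show ?thesis by (intro exI[of _ "u \<circ> f"]) (simp add: sum.reindex[OF inj])
  qed
  show thesis
  proof (rule that[of "f ` C"])
    show "finite (f ` C)" "f ` C \<subseteq> X" "card (f ` C) = card C"
      using C(1) fX card_image[OF inj] by auto
    show "independent (f ` C)"
    proof (rule independent_if_scalars_zero)
      fix g x assume 1: "(\<Sum>x\<in>f ` C. scale (g x) x) = 0" "x \<in> f ` C"
      then have "(\<Sum>v\<in>C. scale ((g \<circ> f) v) (f v)) \<in> Y"
        using subspace_0[OF Y(1)] by (simp add: sum.reindex[OF inj])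
      then show "g x = 0" using key[of "g \<circ> f"] 1(2) by auto
    qed (use C in auto)
    show "span (f ` C) \<inter> Y \<subseteq> {0}"
    proof clarify
      fix w assume w: "w \<in> span (f ` C)" "w \<in> Y"
      obtain u where u: "w = (\<Sum>c\<in>C. scale (u c) (f c))" using sp[OF w(1)] by blast
      then have "u c = 0" if "c \<in> C" for c using key w(2) that by blast
      then show "w = 0" unfolding u by (simp add: sum.neutral)
    qed
    show "\<exists>w\<in>span (f ` C). x - w \<in> Y" if x: "x \<in> X" for x
    proof -
      obtain w where w: "w \<in> span C" "x - w \<in> Y" using C(5)[OF x] by blast
      obtain u where u: "w = (\<Sum>c\<in>C. scale (u c) c)" using span_finite_sum[OF C(1) w(1)] .
      have "(\<Sum>c\<in>C. scale (u c) (P c)) \<in> Y" using PY Y(1) by (auto intro!: subspace_sum subspace_scale)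
      then have "x - w + (\<Sum>c\<in>C. scale (u c) (P c)) \<in> Y" using w(2) subspace_add[OF Y(1)] by blast
      moreover have "x - w + (\<Sum>c\<in>C. scale (u c) (P c)) = x - (\<Sum>c\<in>C. scale (u c) (f c))"
        by (simp add: u f_def scale_right_diff_distrib sum_subtractf)
      moreover have "(\<Sum>c\<in>C. scale (u c) (f c)) \<in> span (f ` C)"
        by (intro span_sum span_scale span_base imageI)
      ultimately show ?thesis by metis
    qed
    have fXX: "f ` C \<subseteq> X" using fX by blast
    show "h c e = 0" if "c \<in> span (f ` C)" "e \<in> span B" for c e
    proof (rule hform_span_orth[OF h fXX BX _ that])
      fix a b assume "a \<in> f ` C" "b \<in> B"
      then show "h a b = 0" using diff P_eq BX by auto
    qed
    show "h c z = 0" if "c \<in> span (f ` C)" "z \<in> Z" for c z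
    proof (rule hform_span_left_zero[OF h _ fXX _ that(1)])
      show zX: "z \<in> X" using that Z(1) by blast
      have "h (P c) z = 0" for c
        by (rule hform_span_left_zero[OF h zX BX _ PB]) (rule Z(3)[OF _ that(2)])
      then show "h a z = 0" if "a \<in> f ` C" for a using diff zX Z(2) \<open>z \<in> Z\<close> that by auto
    qed
  qed
qed

text \<open>The form \<open>r\<close> has radical \<open>Y\<close>, so the parameter s acts only
  transversally to \<open>Y\<close>. For s very negative all of the complement \<open>C\<close>
  becomes negative, for s very positive all of it becomes positive. The index thus sweeps from at
  least j to below j, and at the supremum of the admissible parameters semicontinuity gives both
  claims.\<close>

lemma exists_intermediate_index:
  assumes h: "hform X h" and r: "hform X r" and g: "hform X g"
    and g0: "\<And>x. x \<in> X \<Longrightarrow> x \<noteq> 0 \<Longrightarrow> 0 < Re (g x x)"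
    and r0: "\<And>x. x \<in> X \<Longrightarrow> 0 \<le> Re (r x x)" and rg: "\<And>x. x \<in> X \<Longrightarrow> Re (r x x) \<le> Re (g x x)"
    and Y: "subspace Y" "Y \<subseteq> X" "\<And>x y. x \<in> Y \<Longrightarrow> y \<in> X \<Longrightarrow> r x y = 0"
      "\<And>x. x \<in> X \<Longrightarrow> Re (r x x) = 0 \<Longrightarrow> x \<in> Y"
    and reg: "\<And>s::real. regular X g (\<lambda>x y. h x y + complex_of_real s * r x y)"
    and d: "diag Y h Y0 Bp Bz Bn" and pos: "\<And>x. x \<in> Y0 \<Longrightarrow> x \<noteq> 0 \<Longrightarrow> Re (h x x) > 0"
    and C: "finite C" "C \<subseteq> X" "independent C" "span C \<inter> Y \<subseteq> {0}" "\<And>x. x \<in> X \<Longrightarrow> \<exists>w\<in>span C. x - w \<in> Y"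
      "\<And>c y. c \<in> C \<Longrightarrow> y \<in> Y0 \<Longrightarrow> h c y = 0"
    and j: "\<not> npos Y h j" "neg Y h (j - card C)"
  shows "\<exists>s::real. npos X (\<lambda>x y. h x y + complex_of_real s * r x y) j \<and>
    \<not> neg X (\<lambda>x y. h x y + complex_of_real s * r x y) j"
proof -
  define H where "H s = (\<lambda>x y. h x y + complex_of_real s * r x y)" for s
  have hH: "hform X (H s)" for s unfolding H_def by (intro hform_add hform_cmult h r)
  have reH: "Re (H s x x) = Re (h x x) + s * Re (r x x)" for s x by (simp add: H_def)
  have hY: "hform Y h" by (rule hform_mono[OF h Y(1,2)])
  note D = diagD[OF d] and sX = hform_subspace[OF h]
  have h0: "Re (h 0 0) = 0" "Re (r 0 0) = 0"
    using hform_zero_left[OF h] hform_zero_left[OF r] subspace_0[OF sX] by auto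
  have jb: "card Bz + card Bn < j" "j \<le> card Bn + card C"
    using j index_diag(1,2)[OF hY d pos] by (auto simp: not_le)
  \<comment> \<open>\<open>r\<close> is definite on any space meeting its radical \<open>Y\<close>
    only in 0.\<close>
  have rpos: "Re (r x x) > 0" if "x \<in> span D'" "x \<noteq> 0" "D' \<subseteq> X" "span D' \<inter> Y \<subseteq> {0}" for x D'
  proof -
    have "x \<in> X" using hform_span[OF h that(3)] that(1) by blast
    then show ?thesis using r0[of x] Y(4)[of x] that by force
  qed
  have pwn: "pairwise (\<lambda>x y. h x y = 0) Bn" by (rule pairwise_subset[OF D(10)]) auto
  have pwp: "pairwise (\<lambda>x y. h x y = 0) Bp" by (rule pairwise_subset[OF D(10)]) auto
  have Y0X: "Y0 \<subseteq> X" using D(2) Y(2) by blast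
  have BY0: "h e z = 0" if "e \<in> Bp \<union> Bz \<union> Bn" "z \<in> Y0" for e z
    using D(14)[OF that(2,1)] hform_cnj[OF hY, of z e] that D(2,6,7,8) by auto
  \<comment> \<open>With the complement made orthogonal to \<open>Bn\<close>, the form is negative
    on the sum of both spans once -s exceeds the constant \<open>K\<close> of finite-dimensional
    comparison.\<close>
  have low: "\<exists>s. neg X (H s) j"
  proof -
    have nz: "h e e \<noteq> 0" if "e \<in> Bn" for e using D(13)[OF that] by auto
    have orth0: "h e z = 0" if "e \<in> Bn" "z \<in> Y0" for e z using BY0 that by blast
    obtain E where E: "finite E" "E \<subseteq> X" "card E = card C" "independent E" "span E \<inter> Y \<subseteq> {0}"
      and dE: "\<And>x. x \<in> X \<Longrightarrow> \<exists>w\<in>span E. x - w \<in> Y"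
      and oE: "\<And>c e. c \<in> span E \<Longrightarrow> e \<in> span Bn \<Longrightarrow> h c e = 0"
      and oE2: "\<And>c z. c \<in> span E \<Longrightarrow> z \<in> Y0 \<Longrightarrow> h c z = 0"
      by (rule adjust_complement[OF h Y(1,2) D(5,8) pwn nz C(1-5) Y0X C(6) orth0]) (assumption+, rule that)
    obtain K where K: "K > 0" "\<And>w. w \<in> span E \<Longrightarrow> \<bar>Re (h w w)\<bar> \<le> K * Re (r w w)"
      using hform_bounded_by_definite[OF h r E(1,2) rpos[OF _ _ E(2,5)]] by blast
    have BnX: "Bn \<subseteq> X" using D(8) Y(2) by blast
    have "Re (H (- (K + 1)) x x) < 0" if x: "x \<in> span (Bn \<union> E)" "x \<noteq> 0" for x
    proof -
      obtain u w where e: "u \<in> span Bn" "w \<in> span E" "x = u + w" using x(1) by (auto simp: span_Un)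
      have m: "u \<in> Y" "u \<in> X" "w \<in> X"
        using e hform_span[OF hY D(8)] hform_span[OF h E(2)] Y(2) by auto
      have "Re (h x x) = Re (h u u) + Re (h w w)"
        unfolding e(3) using hform_quad_orth[OF h m(3,2) oE[OF e(2,1)]] by (simp add: add.commute)
      moreover have "Re (r x x) = Re (r w w)"
        unfolding e(3) using hform_quad_orth[OF r m(2,3) Y(3)[OF m(1,3)]] Y(3)[OF m(1,2)] by simp
      ultimately have eq: "Re (H (- (K + 1)) x x) = Re (h u u) + Re (h w w) - (K + 1) * Re (r w w)"
        by (simp add: reH algebra_simps)
      have le: "Re (h u u) \<le> 0" using diag_sign(3)[OF hY d e(1)] h0 by (cases "u = 0") auto
      have le2: "Re (h w w) - (K + 1) * Re (r w w) \<le> - Re (r w w)"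
        using K(2)[OF e(2)] by (simp add: algebra_simps)
      show ?thesis
      proof (cases "w = 0")
        case True
        then have "u \<noteq> 0" using x(2) e(3) by auto
        then show ?thesis using diag_sign(3)[OF hY d e(1)] eq True h0 by simp
      next
        case False
        then show ?thesis using rpos[OF e(2) False E(2,5)] eq le le2 by linarith
      qed
    qed
    moreover have "span Bn \<inter> span E \<subseteq> {0}" using hform_span[OF hY D(8)] E(5) by blast
    moreover have "independent Bn" by (rule independent_subset[OF D(9)]) auto
    ultimately have "neg X (H (- (K + 1))) (card Bn + card C)"
      unfolding neg_def using independent_Un_disjoint[OF D(5) E(1) _ E(4)] E BnX D(5)
      by (intro exI[of _ "Bn \<union> E"]) (auto simp: card_Un_disjoint)
    then show ?thesis using neg_downward jb(2) by blast
  qed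
  \<comment> \<open>With the complement made orthogonal to \<open>Bp\<close>, the form is positive
    on \<open>Y0\<close> plus the spans of \<open>Bp\<close> and of the complement, a space of
    codimension at most \<open>card Bz + card Bn\<close>, which is less than j.\<close>
  have high: "\<exists>s. \<not> npos X (H s) j"
  proof -
    have nz: "h e e \<noteq> 0" if "e \<in> Bp" for e using D(11)[OF that] by auto
    have orth0: "h e z = 0" if "e \<in> Bp" "z \<in> Y0" for e z using BY0 that by blast
    obtain E where E: "finite E" "E \<subseteq> X" "card E = card C" "independent E" "span E \<inter> Y \<subseteq> {0}"
      and dE: "\<And>x. x \<in> X \<Longrightarrow> \<exists>w\<in>span E. x - w \<in> Y"
      and oE: "\<And>c e. c \<in> span E \<Longrightarrow> e \<in> span Bp \<Longrightarrow> h c e = 0"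
      and oE2: "\<And>c z. c \<in> span E \<Longrightarrow> z \<in> Y0 \<Longrightarrow> h c z = 0"
      by (rule adjust_complement[OF h Y(1,2) D(3,6) pwp nz C(1-5) Y0X C(6) orth0]) (assumption+, rule that)
    obtain K where K: "K > 0" "\<And>w. w \<in> span E \<Longrightarrow> \<bar>Re (h w w)\<bar> \<le> K * Re (r w w)"
      using hform_bounded_by_definite[OF h r E(1,2) rpos[OF _ _ E(2,5)]] by blast
    have "\<not> npos X (H (K + 1)) j"
    proof
      assume "npos X (H (K + 1)) j"
      then obtain F where F: "F \<subseteq> X" "finite F" "independent F" "card F = j"
          "\<And>x. x \<in> span F \<Longrightarrow> Re (H (K + 1) x x) \<le> 0"
        by (auto simp: npos_def)
      let ?A = "{x + y |x y. x \<in> Y0 \<and> y \<in> span (Bp \<union> E)}"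
      have "\<exists>x\<in>span F. x \<noteq> 0 \<and> x \<in> ?A"
      proof (rule pigeonhole_span[where B = "Bz \<union> Bn"])
        show "card (Bz \<union> Bn) < card F" using jb(1) F(4) diag_card[OF d] by simp
        fix x assume "x \<in> F"
        then have "x \<in> X" using F(1) by blast
        then obtain w where w: "w \<in> span E" "x - w \<in> Y" using dE by blast
        obtain x0 p z n where e: "x0 \<in> Y0" "p \<in> span Bp" "z \<in> span Bz" "n \<in> span Bn" "x - w = x0 + p + z + n"
          using diag_decompose[OF d w(2)] by metis
        have "p + w \<in> span (Bp \<union> E)" using e w by (auto simp: span_Un)
        moreover have "x - (z + n) = x0 + (p + w)" using e(5) by (simp add: algebra_simps)
        ultimately have "x - (z + n) \<in> ?A" using e(1) by blast
        moreover have "z + n \<in> span (Bz \<union> Bn)" using e by (auto simp: span_Un)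
        ultimately show "\<exists>w\<in>span (Bz \<union> Bn). x - w \<in> ?A" by blast
      qed (use D F subspace_add_span in auto)
      then obtain x x0 y where xy: "x \<in> span F" "x \<noteq> 0" "x0 \<in> Y0" "y \<in> span (Bp \<union> E)" "x = x0 + y"
        by blast
      from xy(4) obtain p w where "p \<in> span Bp" "w \<in> span E" "y = p + w"
        unfolding span_Un by blast
      with xy have x: "x \<in> span F" "x \<noteq> 0" "x0 \<in> Y0" "p \<in> span Bp" "w \<in> span E" "x = x0 + p + w"
        by (simp_all add: add.assoc)
      have m: "x0 \<in> Y" "p \<in> Y" using diag_mem[OF hY d] x by auto
      then have m2: "x0 + p \<in> Y" "x0 + p \<in> X" "w \<in> X" "x0 \<in> X" "p \<in> X"
        using subspace_add[OF Y(1)] Y(2) hform_span[OF h E(2)] x(5) by auto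
      have "h w (x0 + p) = 0"
        using oE oE2 x(3-5) m2 by (simp add: hform_add_right[OF h])
      then have "Re (h x x) = Re (h (x0 + p) (x0 + p)) + Re (h w w)"
        unfolding x(6) using hform_quad_orth[OF h m2(3,2)] by (simp add: add.commute)
      moreover have "Re (h (x0 + p) (x0 + p)) = Re (h x0 x0) + Re (h p p)"
        using diag_quad[OF hY d x(3,4) span_zero span_zero] h0 by simp
      moreover have "Re (r x x) = Re (r w w)"
        unfolding x(6) using hform_quad_orth[OF r m2(2,3) Y(3)[OF m2(1,3)]] Y(3)[OF m2(1,2)] by simp
      ultimately have eq: "Re (H (K + 1) x x) = Re (h x0 x0) + Re (h p p) + Re (h w w) + (K + 1) * Re (r w w)"
        by (simp add: reH)
      have le: "Re (h x0 x0) \<ge> 0" using pos[OF x(3)] h0 by (cases "x0 = 0") auto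
      have le1: "Re (h p p) \<ge> 0" using diag_sign(1)[OF hY d x(4)] h0 by (cases "p = 0") auto
      have le2: "Re (h w w) + (K + 1) * Re (r w w) \<ge> Re (r w w)"
        using K(2)[OF x(5)] by (simp add: algebra_simps)
      have "Re (r w w) \<ge> 0" using r0 m2(3) by blast
      then have "Re (h x0 x0) = 0" "Re (h p p) = 0" "Re (r w w) = 0"
        using F(5)[OF x(1)] eq le le1 le2 by linarith+
      then have "x0 = 0" "p = 0" "w = 0"
        using pos[OF x(3)] diag_sign(1)[OF hY d x(4)] rpos[OF x(5) _ E(2,5)] by (metis less_irrefl)+
      then show False using x by simp
    qed
    then show ?thesis by blast
  qed
  have mono: "npos X (H s) j" if "npos X (H t) j" "s \<le> t" for s t
  proof -
    have "Re (H s x x) \<le> Re (H t x x)" if "x \<in> X" for x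
      using r0[OF that] \<open>s \<le> t\<close> by (simp add: reH mult_right_mono)
    then show ?thesis using npos_antimono[OF h _ that(1)] by blast
  qed
  \<comment> \<open>An initial segment of the reals by monotonicity in s; it contains its supremum
    by upper semicontinuity, and a negative j-space there would persist slightly beyond the
    supremum.\<close>
  define S where "S = {s. npos X (H s) j}"
  have "S \<noteq> {}" using low neg_imp_npos[OF hH] by (auto simp: S_def)
  obtain s2 where s2: "\<not> npos X (H s2) j" using high by blast
  then have ub: "s \<le> s2" if "s \<in> S" for s
    using mono[of s s2] s2 that by (cases "s2 \<le> s") (auto simp: S_def dest: mono)
  then have "bdd_above S" by (intro bdd_aboveI)
  note bdd = \<open>S \<noteq> {}\<close> this
  define s0 where "s0 = Sup S"
  have R0: "regular X g (H s0)" using reg by (simp add: H_def)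
  then obtain X0 Cp Cz Cn \<epsilon> where R: "diag X (H s0) X0 Cp Cz Cn" "\<epsilon> > 0" "\<And>x. x \<in> X0 \<Longrightarrow> \<epsilon> * Re (g x x) \<le> Re (H s0 x x)"
    using regularE[OF R0 g0] by metis
  have "npos X (H s0) j"
  proof -
    obtain \<delta> where \<delta>: "\<delta> > 0" "\<And>h'. (\<forall>x\<in>X. Re (H s0 x x) - \<delta> * Re (g x x) \<le> Re (h' x x)) \<Longrightarrow> npos X h' j \<Longrightarrow> npos X (H s0) j"
      using npos_perturb[OF hH R(1) g g0 R(2,3)] by metis
    obtain s where s: "s \<in> S" "s0 - \<delta> < s"
      using less_cSup_iff[OF bdd, of "s0 - \<delta>"] \<delta>(1) by (auto simp: s0_def)
    have "Re (H s0 x x) - \<delta> * Re (g x x) \<le> Re (H s x x)" if x: "x \<in> X" for x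
    proof -
      have "(s0 - s) * Re (r x x) \<le> \<delta> * Re (r x x)" using s r0[OF x] by (intro mult_right_mono) auto
      also have "\<dots> \<le> \<delta> * Re (g x x)" using \<delta> rg[OF x] by (intro mult_left_mono) auto
      finally show ?thesis by (simp add: reH algebra_simps)
    qed
    then show ?thesis using \<delta>(2)[of "H s"] s(1) by (auto simp: S_def)
  qed
  moreover have "\<not> neg X (H s0) j"
  proof
    assume "neg X (H s0) j"
    then obtain \<delta> where \<delta>: "\<delta> > 0" "\<And>h'. (\<forall>x\<in>X. Re (h' x x) \<le> Re (H s0 x x) + \<delta> * Re (g x x)) \<Longrightarrow> neg X h' j"
      using neg_perturb[OF hH g g0] by metis
    have "neg X (H (s0 + \<delta>)) j"
    proof (intro \<delta>(2) ballI)
      fix x assume x: "x \<in> X"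
      have "\<delta> * Re (r x x) \<le> \<delta> * Re (g x x)" using \<delta> rg[OF x] by (intro mult_left_mono) auto
      then show "Re (H (s0 + \<delta>) x x) \<le> Re (H s0 x x) + \<delta> * Re (g x x)" by (simp add: reH algebra_simps)
    qed
    then have "s0 + \<delta> \<in> S" using neg_imp_npos[OF hH] by (simp add: S_def)
    then show False using cSup_upper[OF _ bdd(2), of "s0 + \<delta>"] \<delta>(1) by (simp add: s0_def)
  qed
  ultimately show ?thesis unfolding H_def by blast
qed

text \<open>The minimax principle in counting form. The i-th value is the infimum of the parameters
  with nonpositive index at least i; it is attained by upper semicontinuity, and the strict version
  comes from lower semicontinuity.\<close>

lemma spectral_enumeration:
  assumes h: "hform X h" and b: "hform X b" and g: "hform X g"
    and b0: "\<And>x. x \<in> X \<Longrightarrow> x \<noteq> 0 \<Longrightarrow> 0 < Re (b x x)" and bg: "\<And>x. x \<in> X \<Longrightarrow> Re (b x x) \<le> Re (g x x)"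
    and reg: "\<And>\<theta>::real. regular X g (\<lambda>x y. h x y + complex_of_real (- \<theta>) * b x y)"
    and below: "\<And>x. x \<in> X \<Longrightarrow> x \<noteq> 0 \<Longrightarrow> m0 * Re (b x x) < Re (h x x)"
    and inf: "\<And>k. \<exists>C\<subseteq>X. finite C \<and> independent C \<and> card C = k"
  obtains l :: "nat \<Rightarrow> real" where
    "\<And>i \<theta>. 1 \<le> i \<Longrightarrow> l i \<le> \<theta> \<longleftrightarrow> npos X (\<lambda>x y. h x y + complex_of_real (- \<theta>) * b x y) i"
    "\<And>i \<theta>. 1 \<le> i \<Longrightarrow> l i < \<theta> \<longleftrightarrow> neg X (\<lambda>x y. h x y + complex_of_real (- \<theta>) * b x y) i"
    "\<And>i k. 1 \<le> i \<Longrightarrow> i \<le> k \<Longrightarrow> l i \<le> l k"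
    "\<And>\<mu>. finite {i. 1 \<le> i \<and> l i = \<mu>} \<and>
       card {i. 1 \<le> i \<and> l i = \<mu>} = dim (kernel X (\<lambda>x y. h x y + complex_of_real (- \<mu>) * b x y))"
proof -
  define H where "H s = (\<lambda>x y. h x y + complex_of_real (- s) * b x y)" for s
  have hH: "hform X (H s)" for s unfolding H_def by (intro hform_add hform_cmult h b)
  have reH: "Re (H s x x) = Re (h x x) - s * Re (b x x)" for s x by (simp add: H_def)
  have g0: "0 < Re (g x x)" if "x \<in> X" "x \<noteq> 0" for x using b0[OF that] bg[OF that(1)] by linarith
  have b1: "0 \<le> Re (b x x)" if "x \<in> X" for x
    using b0[OF that] hform_zero_left[OF b that] by (cases "x = 0") auto
  \<comment> \<open>\<open>b\<close> is positive definite, so raising the parameter turns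
    nonpositive into negative on the same space.\<close>
  have up: "neg X (H t) i" if n: "npos X (H s) i" and "s < t" for s t i
  proof -
    obtain C where C: "C \<subseteq> X" "finite C" "independent C" "card C = i" "\<And>x. x \<in> span C \<Longrightarrow> Re (H s x x) \<le> 0"
      using n by (auto simp: npos_def)
    have "Re (H t x x) < 0" if "x \<in> span C" "x \<noteq> 0" for x
    proof -
      have "x \<in> X" using hform_span[OF h C(1)] that by blast
      then have "s * Re (b x x) < t * Re (b x x)" using b0 that(2) \<open>s < t\<close> by simp
      then show ?thesis using C(5)[OF that(1)] by (simp add: reH)
    qed
    then show ?thesis unfolding neg_def using C(1-4) by blast
  qed
  have up': "npos X (H t) i" if "npos X (H s) i" "s \<le> t" for s t i
    using up[OF that(1), of t] neg_imp_npos[OF hH] that by (cases "s = t") auto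
  define l where "l i = Inf {\<theta>. npos X (H \<theta>) i}" for i
  have bdd: "bdd_below {\<theta>. npos X (H \<theta>) i}" if i: "1 \<le> i" for i
  proof (rule bdd_belowI)
    fix \<theta> assume "\<theta> \<in> {\<theta>. npos X (H \<theta>) i}"
    then obtain C where C: "C \<subseteq> X" "finite C" "independent C" "card C = i" "\<And>x. x \<in> span C \<Longrightarrow> Re (H \<theta> x x) \<le> 0"
      by (auto simp: npos_def)
    have "C \<noteq> {}" using C(4) i by auto
    then obtain x where x: "x \<in> C" by blast
    have "x \<noteq> 0" "x \<in> X" using x C dependent_zero by auto
    then have "m0 * Re (b x x) < Re (h x x)" "0 < Re (b x x)" using below b0 by auto
    moreover have "Re (h x x) \<le> \<theta> * Re (b x x)" using C(5)[OF span_base[OF x]] by (simp add: reH)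
    ultimately have "m0 * Re (b x x) < \<theta> * Re (b x x)" by linarith
    then show "m0 \<le> \<theta>" using \<open>0 < Re (b x x)\<close> by simp
  qed
  \<comment> \<open>On any i-dimensional space \<open>b\<close> dominates \<open>h\<close>, so a
    large parameter makes the form nonpositive there.\<close>
  have ne: "{\<theta>. npos X (H \<theta>) i} \<noteq> {}" for i
  proof -
    obtain C where C: "C \<subseteq> X" "finite C" "independent C" "card C = i" using inf by metis
    have pos: "0 < Re (b x x)" if "x \<in> span C" "x \<noteq> 0" for x
      using b0 that hform_span[OF h C(1)] by blast
    obtain K where "\<And>w. w \<in> span C \<Longrightarrow> \<bar>Re (h w w)\<bar> \<le> K * Re (b w w)"
      using hform_bounded_by_definite[OF h b C(2,1) pos] by blast
    then have "Re (H K w w) \<le> 0" if "w \<in> span C" for w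
      using abs_le_D1 that by (fastforce simp: reH)
    then have "npos X (H K) i" unfolding npos_def using C by blast
    then show ?thesis by blast
  qed
  have att: "npos X (H (l i)) i" if i: "1 \<le> i" for i
  proof -
    have R0: "regular X g (H (l i))" using reg by (simp add: H_def)
    then obtain X0 Cp Cz Cn \<epsilon> where R: "diag X (H (l i)) X0 Cp Cz Cn" "\<epsilon> > 0" "\<And>x. x \<in> X0 \<Longrightarrow> \<epsilon> * Re (g x x) \<le> Re (H (l i) x x)"
      using regularE[OF R0 g0] by metis
    obtain \<delta> where \<delta>: "\<delta> > 0" "\<And>h'. (\<forall>x\<in>X. Re (H (l i) x x) - \<delta> * Re (g x x) \<le> Re (h' x x)) \<Longrightarrow> npos X h' i \<Longrightarrow> npos X (H (l i)) i"
      using npos_perturb[OF hH R(1) g g0 R(2,3)] by metis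
    obtain s where s: "npos X (H s) i" "s < l i + \<delta>"
      using cInf_less_iff[OF ne bdd[OF i], of "l i + \<delta>"] \<delta>(1) by (auto simp: l_def)
    have "Re (H (l i) x x) - \<delta> * Re (g x x) \<le> Re (H s x x)" if x: "x \<in> X" for x
    proof -
      have "(s - l i) * Re (b x x) \<le> \<delta> * Re (b x x)" using s b1[OF x] by (intro mult_right_mono) auto
      also have "\<dots> \<le> \<delta> * Re (g x x)" using \<delta> bg[OF x] by (intro mult_left_mono) auto
      finally show ?thesis by (simp add: reH algebra_simps)
    qed
    then show ?thesis using \<delta>(2)[of "H s"] s(1) by blast
  qed
  have le: "l i \<le> \<theta> \<longleftrightarrow> npos X (H \<theta>) i" if i: "1 \<le> i" for i \<theta>
    using up'[OF att[OF i], of \<theta>] cInf_lower[OF _ bdd[OF i], of \<theta>] by (auto simp: l_def)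
  have less: "l i < \<theta> \<longleftrightarrow> neg X (H \<theta>) i" if i: "1 \<le> i" for i \<theta>
  proof
    show "neg X (H \<theta>) i" if "l i < \<theta>" using up[OF att[OF i] that] .
    assume "neg X (H \<theta>) i"
    then obtain \<delta> where \<delta>: "\<delta> > 0" "\<And>h'. (\<forall>x\<in>X. Re (h' x x) \<le> Re (H \<theta> x x) + \<delta> * Re (g x x)) \<Longrightarrow> neg X h' i"
      using neg_perturb[OF hH g g0] by metis
    have "neg X (H (\<theta> - \<delta>)) i"
    proof (intro \<delta>(2) ballI)
      fix x assume x: "x \<in> X"
      have "\<delta> * Re (b x x) \<le> \<delta> * Re (g x x)" using \<delta> bg[OF x] by (intro mult_left_mono) auto
      then show "Re (H (\<theta> - \<delta>) x x) \<le> Re (H \<theta> x x) + \<delta> * Re (g x x)" by (simp add: reH algebra_simps)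
    qed
    then have "l i \<le> \<theta> - \<delta>" using le[OF i] neg_imp_npos[OF hH] by blast
    then show "l i < \<theta>" using \<delta>(1) by linarith
  qed
  show ?thesis
  proof (rule that[of l])
    show "l i \<le> l k" if "1 \<le> i" "i \<le> k" for i k
      using le[OF that(1)] att[of k] npos_downward[OF _ that(2)] that by auto
    fix \<mu>
    have R0: "regular X g (H \<mu>)" using reg by (simp add: H_def)
    then obtain X0 Cp Cz Cn \<epsilon> where R: "diag X (H \<mu>) X0 Cp Cz Cn"
      "\<And>x. x \<in> X0 \<Longrightarrow> x \<noteq> 0 \<Longrightarrow> Re (H \<mu> x x) > 0"
      using regularE[OF R0 g0] by metis
    note I = index_diag[OF hH R]
    \<comment> \<open>The indices taking the value \<mu> are those above the negative index and up
      to index plus nullity, so their number is the nullity.\<close>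
    have "{i. 1 \<le> i \<and> l i = \<mu>} = {i. 1 \<le> i \<and> l i \<le> \<mu> \<and> \<not> l i < \<mu>}" by auto
    also have "\<dots> = {card Cn<..card Cz + card Cn}" using le less I(1,2) by auto
    finally have "{i. 1 \<le> i \<and> l i = \<mu>} = {card Cn<..card Cz + card Cn}" .
    then show "finite {i. 1 \<le> i \<and> l i = \<mu>} \<and> card {i. 1 \<le> i \<and> l i = \<mu>} =
        dim (kernel X (\<lambda>x y. h x y + complex_of_real (- \<mu>) * b x y))"
      using I(4) by (simp add: H_def)
  qed (use le less in \<open>auto simp: H_def\<close>)
qed

end

section \<open>Products and quotients of Sobolev functions\<close>

text \<open>Telescoping over a fine partition. In the product rules below \<open>M\<close> is an
  indefinite integral of norms, so that increments can be compared without differentiating almost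
  everywhere.\<close>

lemma vanishing_if_increments_small:
  fixes D :: "real \<Rightarrow> 'a::real_normed_vector" and M :: "real \<Rightarrow> real"
  assumes D0: "D 0 = 0"
    and small: "\<And>\<epsilon>. \<epsilon> > 0 \<Longrightarrow> \<exists>\<delta>>0. \<forall>s t. 0 \<le> s \<longrightarrow> s \<le> t \<longrightarrow> t \<le> T \<longrightarrow> t - s < \<delta> \<longrightarrow>
      norm (D t - D s) \<le> \<epsilon> * (M t - M s)"
    and t: "0 \<le> t" "t \<le> T"
  shows "D t = 0"
proof -
  have bound: "norm (D t) \<le> \<epsilon> * (M t - M 0)" if "\<epsilon> > 0" for \<epsilon>
  proof -
    obtain \<delta> where \<delta>: "\<delta> > 0" "\<And>s t. 0 \<le> s \<Longrightarrow> s \<le> t \<Longrightarrow> t \<le> T \<Longrightarrow> t - s < \<delta> \<Longrightarrow>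
        norm (D t - D s) \<le> \<epsilon> * (M t - M s)"
      using small[OF \<open>\<epsilon> > 0\<close>] by metis
    obtain N :: nat where N: "t / \<delta> < real N" using reals_Archimedean2 by blast
    have N0: "N > 0" using N t \<delta>(1) by (cases N) (auto simp: field_simps zero_le_divide_iff)
    have step: "t / real N < \<delta>" using N N0 \<delta>(1) by (simp add: field_simps)
    have "norm (D (real i * (t / real N))) \<le> \<epsilon> * (M (real i * (t / real N)) - M 0)" if "i \<le> N" for i
      using that
    proof (induction i)
      case 0
      then show ?case using D0 by simp
    next
      case (Suc i)
      let ?u = "real i * (t / real N)" and ?v = "real (Suc i) * (t / real N)"
      have v: "?v \<le> t"
      proof -
        have "real (Suc i) * (t / real N) \<le> real N * (t / real N)"
          using Suc.prems t by (intro mult_right_mono) auto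
        then show ?thesis using N0 by simp
      qed
      have diff: "?v - ?u = t / real N" using N0 by (simp add: field_simps)
      have "norm (D ?v - D ?u) \<le> \<epsilon> * (M ?v - M ?u)"
      proof (rule \<delta>(2))
        show "?u \<le> ?v" using t by (intro mult_right_mono) auto
      qed (use t v diff step in auto)
      moreover have "norm (D ?u) \<le> \<epsilon> * (M ?u - M 0)" using Suc by simp
      ultimately show ?case
        using norm_triangle_ineq[of "D ?v - D ?u" "D ?u"] by (simp add: algebra_simps)
    qed
    from this[of N] show ?thesis using N0 by simp
  qed
  have "norm (D t) \<le> 0"
  proof (rule field_le_epsilon)
    fix e :: real assume "e > 0"
    \<comment> \<open>A positive bound for the total variation term, whatever its sign.\<close>
    define c where "c = \<bar>M t - M 0\<bar> + 1"
    have "c > 0" by (simp add: c_def)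
    have "norm (D t) \<le> e / c * (M t - M 0)" using \<open>e > 0\<close> \<open>c > 0\<close> by (intro bound) simp
    also have "\<dots> \<le> e / c * c" using \<open>e > 0\<close> \<open>c > 0\<close> by (intro mult_left_mono) (auto simp: c_def)
    finally show "norm (D t) \<le> 0 + e" using \<open>c > 0\<close> by simp
  qed
  then show ?thesis by simp
qed

lemma L2_on_absolutely_integrable:
  assumes "L2_on T g"
  shows "g absolutely_integrable_on {0..T}"
proof -
  have m: "g \<in> borel_measurable (lebesgue_on {0..T})" and i: "integrable (lebesgue_on {0..T}) (\<lambda>t. (norm (g t))\<^sup>2)"
    using assms by (auto simp: L2_on_def)
  have "finite_measure (lebesgue_on {0..T})"
    by (intro finite_measure_lebesgue_on) (auto simp: lmeasurable_interval)
  then have c: "integrable (lebesgue_on {0..T}) (\<lambda>t. 1::real)"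
    by (simp add: finite_measure.integrable_const)
  have "integrable (lebesgue_on {0..T}) (norm \<circ> g)"
  proof (rule Bochner_Integration.integrable_bound[OF Bochner_Integration.integrable_add[OF c i]])
    show "norm \<circ> g \<in> borel_measurable (lebesgue_on {0..T})" using m by (simp add: o_def)
    have "norm (g t) \<le> 1 + (norm (g t))\<^sup>2" for t
    proof -
      have "2 * norm (g t) \<le> 1 + (norm (g t))\<^sup>2" using sum_squares_bound[of 1 "norm (g t)"] by simp
      then show ?thesis using norm_ge_zero[of "g t"] by linarith
    qed
    then show "AE x in lebesgue_on {0..T}. norm ((norm \<circ> g) x) \<le> norm (1 + (norm (g x))\<^sup>2)"
      by (intro AE_I2) (simp add: add_nonneg_nonneg)
  qed
  then show ?thesis using m by (simp add: absolutely_integrable_measurable)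
qed

lemma integral_lebesgue_on_eq:
  fixes g :: "real \<Rightarrow> 'a::euclidean_space"
  assumes "g absolutely_integrable_on {0..T}" "t \<le> T"
  shows "integral\<^sup>L (lebesgue_on {0..t}) g = integral {0..t} g"
proof -
  have "g absolutely_integrable_on {0..t}"
    using absolutely_integrable_on_subinterval[OF assms(1)] assms(2) by auto
  then have "integrable (lebesgue_on {0..t}) g"
    by (simp add: set_integrable_def integrable_restrict_space)
  then show ?thesis by (rule lebesgue_integral_eq_integral) simp
qed

text \<open>Passes from the Lebesgue integral of the definition to the gauge integral, in which all
  later calculus is done.\<close>

lemma has_weak_deriv_iff:
  "has_weak_deriv T f g \<longleftrightarrow> L2_on T g \<and> (\<forall>t\<in>{0..T}. f t = f 0 + integral {0..t} g)"
  unfolding has_weak_deriv_def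
  using integral_lebesgue_on_eq[OF L2_on_absolutely_integrable] by (metis atLeastAtMost_iff)

lemma integral_interval_diff:
  fixes g :: "real \<Rightarrow> 'a::euclidean_space"
  assumes "g integrable_on {0..T}" "0 \<le> s" "s \<le> t" "t \<le> T"
  shows "integral {0..t} g - integral {0..s} g = integral {s..t} g"
proof -
  have "g integrable_on {0..t}" using integrable_subinterval_real[OF assms(1)] assms by auto
  then show ?thesis
    using Henstock_Kurzweil_Integration.integral_combine[of 0 s t g] assms by (simp add: algebra_simps)
qed

lemma has_weak_deriv_L2: "has_weak_deriv T f g \<Longrightarrow> L2_on T g"
  unfolding has_weak_deriv_def by (rule conjunct1)

lemma has_weak_deriv_at: "has_weak_deriv T f g \<Longrightarrow> t \<in> {0..T} \<Longrightarrow> f t = f 0 + integral {0..t} g"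
  unfolding has_weak_deriv_iff by (drule conjunct2) (rule bspec)

lemma has_weak_deriv_integrable: "has_weak_deriv T f g \<Longrightarrow> g integrable_on {0..T}"
  by (rule set_lebesgue_integral_eq_integral(1)[OF L2_on_absolutely_integrable[OF has_weak_deriv_L2]])

lemma has_weak_deriv_diff:
  assumes "has_weak_deriv T f g" "0 \<le> s" "s \<le> t" "t \<le> T"
  shows "f t - f s = integral {s..t} g"
proof -
  have "f t - f s = integral {0..t} g - integral {0..s} g"
    using has_weak_deriv_at[OF assms(1), of t] has_weak_deriv_at[OF assms(1), of s] assms(2-4) by force
  then show ?thesis using integral_interval_diff[OF has_weak_deriv_integrable[OF assms(1)] assms(2-4)] by simp
qed

lemma has_weak_deriv_continuous:
  assumes "has_weak_deriv T f g"
  shows "continuous_on {0..T} f"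
proof (rule continuous_on_eq)
  show "continuous_on {0..T} (\<lambda>t. f 0 + integral {0..t} g)"
    by (intro continuous_on_add continuous_on_const indefinite_integral_continuous_1 has_weak_deriv_integrable[OF assms])
qed (rule has_weak_deriv_at[OF assms, symmetric])

lemma H1_continuous: "H1 T f \<Longrightarrow> continuous_on {0..T} f"
  unfolding H1_def using has_weak_deriv_continuous by blast

lemma continuous_imp_L2_on:
  fixes g :: "real \<Rightarrow> 'a::euclidean_space"
  assumes "continuous_on {0..T} g"
  shows "L2_on T g"
proof -
  have "continuous_on {0..T} (\<lambda>t. (norm (g t))\<^sup>2)" by (intro continuous_intros assms)
  then have "(\<lambda>t. (norm (g t))\<^sup>2) absolutely_integrable_on {0..T}"
    by (rule absolutely_integrable_continuous_real)
  then show ?thesis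
    unfolding L2_on_def using continuous_imp_measurable_on_sets_lebesgue[OF assms]
    by (simp add: set_integrable_def integrable_restrict_space)
qed

lemma L2_on_add:
  assumes "L2_on T f" "L2_on T g"
  shows "L2_on T (\<lambda>t. f t + g t)"
  unfolding L2_on_def
proof
  have m: "f \<in> borel_measurable (lebesgue_on {0..T})" "g \<in> borel_measurable (lebesgue_on {0..T})"
    and i: "integrable (lebesgue_on {0..T}) (\<lambda>t. (norm (f t))\<^sup>2)" "integrable (lebesgue_on {0..T}) (\<lambda>t. (norm (g t))\<^sup>2)"
    using assms by (auto simp: L2_on_def)
  show "(\<lambda>t. f t + g t) \<in> borel_measurable (lebesgue_on {0..T})" using m by simp
  show "integrable (lebesgue_on {0..T}) (\<lambda>t. (norm (f t + g t))\<^sup>2)"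
  proof (rule Bochner_Integration.integrable_bound)
    show "integrable (lebesgue_on {0..T}) (\<lambda>t. 2 * (norm (f t))\<^sup>2 + 2 * (norm (g t))\<^sup>2)"
      using i by simp
    show "(\<lambda>t. (norm (f t + g t))\<^sup>2) \<in> borel_measurable (lebesgue_on {0..T})" using m by simp
    have "(norm (f t + g t))\<^sup>2 \<le> 2 * (norm (f t))\<^sup>2 + 2 * (norm (g t))\<^sup>2" for t
    proof -
      have "(norm (f t + g t))\<^sup>2 \<le> (norm (f t) + norm (g t))\<^sup>2"
        by (intro power_mono norm_triangle_ineq) auto
      then show ?thesis
        using sum_squares_bound[of "norm (f t)" "norm (g t)"] by (simp add: power2_sum)
    qed
    then show "AE x in lebesgue_on {0..T}. norm ((norm (f x + g x))\<^sup>2) \<le> norm (2 * (norm (f x))\<^sup>2 + 2 * (norm (g x))\<^sup>2)"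
      by (intro AE_I2) (simp add: add_nonneg_nonneg)
  qed
qed

lemma L2_on_bilinear:
  fixes F :: "real \<Rightarrow> 'a::euclidean_space" and g :: "real \<Rightarrow> 'b::euclidean_space"
    and prod :: "'a \<Rightarrow> 'b \<Rightarrow> 'c::euclidean_space"
  assumes b: "bounded_bilinear prod" and F: "continuous_on {0..T} F" and g: "L2_on T g"
  shows "L2_on T (\<lambda>t. prod (F t) (g t))"
  unfolding L2_on_def
proof
  interpret bounded_bilinear prod by (rule b)
  have m: "g \<in> borel_measurable (lebesgue_on {0..T})" "F \<in> borel_measurable (lebesgue_on {0..T})"
    and i: "integrable (lebesgue_on {0..T}) (\<lambda>t. (norm (g t))\<^sup>2)"
    using g continuous_imp_measurable_on_sets_lebesgue[OF F] by (auto simp: L2_on_def)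
  have c: "continuous_on UNIV (\<lambda>x. prod (fst x) (snd x))"
    by (intro continuous_on continuous_intros)
  show pm: "(\<lambda>t. prod (F t) (g t)) \<in> borel_measurable (lebesgue_on {0..T})"
    by (rule borel_measurable_continuous_Pair[OF m(2,1) c])
  have "bounded (F ` {0..T})" using compact_continuous_image[OF F] compact_imp_bounded by auto
  then obtain M where M0: "M > 0" "\<forall>x\<in>F ` {0..T}. norm x \<le> M"
    unfolding bounded_pos by blast
  then have M: "\<And>t. t \<in> {0..T} \<Longrightarrow> norm (F t) \<le> M" "M > 0" by auto
  obtain K where K: "\<And>a b. norm (prod a b) \<le> norm a * norm b * K" "K > 0" using pos_bounded by blast
  show "integrable (lebesgue_on {0..T}) (\<lambda>t. (norm (prod (F t) (g t)))\<^sup>2)"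
  proof (rule Bochner_Integration.integrable_bound)
    show "integrable (lebesgue_on {0..T}) (\<lambda>t. (M * K)\<^sup>2 * (norm (g t))\<^sup>2)" using i by simp
    show "(\<lambda>t. (norm (prod (F t) (g t)))\<^sup>2) \<in> borel_measurable (lebesgue_on {0..T})" using pm by simp
    have "(norm (prod (F t) (g t)))\<^sup>2 \<le> (M * K)\<^sup>2 * (norm (g t))\<^sup>2" if "t \<in> {0..T}" for t
    proof -
      have "norm (prod (F t) (g t)) \<le> norm (F t) * norm (g t) * K" by (rule K)
      also have "\<dots> \<le> M * norm (g t) * K" using M(1)[OF that] K(2) by (intro mult_right_mono) auto
      finally have "(norm (prod (F t) (g t)))\<^sup>2 \<le> (M * norm (g t) * K)\<^sup>2" by (intro power_mono) auto
      then show ?thesis by (simp add: power_mult_distrib mult_ac)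
    qed
    then show "AE x in lebesgue_on {0..T}. norm ((norm (prod (F x) (g x)))\<^sup>2) \<le> norm ((M * K)\<^sup>2 * (norm (g x))\<^sup>2)"
      by (intro AE_I2) auto
  qed
qed

lemma uniform_modulus:
  fixes f :: "real \<Rightarrow> 'a::real_normed_vector"
  assumes "continuous_on {0..T} f" "\<epsilon> > 0"
  obtains \<delta> where "\<delta> > 0" "\<And>s t. s \<in> {0..T} \<Longrightarrow> t \<in> {0..T} \<Longrightarrow> \<bar>t - s\<bar> < \<delta> \<Longrightarrow> norm (f t - f s) \<le> \<epsilon>"
proof -
  have "uniformly_continuous_on {0..T} f" by (rule compact_uniformly_continuous[OF assms(1)]) simp
  then show ?thesis
    using that assms(2) unfolding uniformly_continuous_on_def dist_norm real_norm_def by (metis less_imp_le)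
qed

text \<open>Leibniz rule by comparing increments. With \<open>f\<close> frozen at s and
  \<open>u\<close> at t, the error is the integral of g(r)(u(t) - u(r)) + (f(s) - f(r)) v(r), which
  is a modulus of continuity times the integral of |g| + |v|.\<close>

lemma has_weak_deriv_mult:
  fixes f :: "real \<Rightarrow> 'a::euclidean_space" and u :: "real \<Rightarrow> 'b::euclidean_space"
    and prod :: "'a \<Rightarrow> 'b \<Rightarrow> 'c::euclidean_space"
  assumes b: "bounded_bilinear prod" and f: "has_weak_deriv T f g" and u: "has_weak_deriv T u v"
  shows "has_weak_deriv T (\<lambda>t. prod (f t) (u t)) (\<lambda>t. prod (g t) (u t) + prod (f t) (v t))"
  unfolding has_weak_deriv_iff
proof (intro conjI ballI)
  interpret bounded_bilinear prod by (rule b)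
  let ?k = "\<lambda>t. prod (g t) (u t) + prod (f t) (v t)"
  have cf: "continuous_on {0..T} f" and cu: "continuous_on {0..T} u"
    using f u has_weak_deriv_continuous by blast+
  have L: "L2_on T g" "L2_on T v" using f u has_weak_deriv_L2 by blast+
  have "L2_on T (\<lambda>t. prod (f t) (v t))" by (rule L2_on_bilinear[OF b cf L(2)])
  moreover have "L2_on T (\<lambda>t. prod (g t) (u t))" by (rule L2_on_bilinear[OF flip cu L(1)])
  ultimately show Lk: "L2_on T ?k" by (intro L2_on_add)
  obtain K where K: "\<And>a b. norm (prod a b) \<le> norm a * norm b * K" "K > 0" using pos_bounded by blast
  have ai: "g absolutely_integrable_on {0..T}" "v absolutely_integrable_on {0..T}" "?k absolutely_integrable_on {0..T}"
    using L Lk L2_on_absolutely_integrable by blast+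
  have int: "g integrable_on {0..T}" "v integrable_on {0..T}" "?k integrable_on {0..T}"
      "(\<lambda>t. norm (g t)) integrable_on {0..T}" "(\<lambda>t. norm (v t)) integrable_on {0..T}"
    using ai by (simp_all add: absolutely_integrable_on_def)
  define M where "M t = integral {0..t} (\<lambda>t. norm (g t) + norm (v t))" for t
  define D where "D t = prod (f t) (u t) - prod (f 0) (u 0) - integral {0..t} ?k" for t
  fix t assume t: "t \<in> {0..T}"
  have "D t = 0"
  proof (rule vanishing_if_increments_small[where T = T and M = M])
    show "D 0 = 0" by (simp add: D_def)
    fix \<epsilon> :: real assume "\<epsilon> > 0"
    then have eK: "\<epsilon> / K > 0" using K by simp
    obtain d1 where d1: "d1 > 0" "\<And>s t. s \<in> {0..T} \<Longrightarrow> t \<in> {0..T} \<Longrightarrow> \<bar>t - s\<bar> < d1 \<Longrightarrow> norm (f t - f s) \<le> \<epsilon> / K"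
      using uniform_modulus[OF cf eK] by metis
    obtain d2 where d2: "d2 > 0" "\<And>s t. s \<in> {0..T} \<Longrightarrow> t \<in> {0..T} \<Longrightarrow> \<bar>t - s\<bar> < d2 \<Longrightarrow> norm (u t - u s) \<le> \<epsilon> / K"
      using uniform_modulus[OF cu eK] by metis
    show "\<exists>\<delta>>0. \<forall>s t. 0 \<le> s \<longrightarrow> s \<le> t \<longrightarrow> t \<le> T \<longrightarrow> t - s < \<delta> \<longrightarrow> norm (D t - D s) \<le> \<epsilon> * (M t - M s)"
    proof (intro exI[of _ "min d1 d2"] conjI allI impI)
      show "min d1 d2 > 0" using d1 d2 by simp
      fix s t assume st: "0 \<le> s" "s \<le> t" "t \<le> T" "t - s < min d1 d2"
      have sub: "{s..t} \<subseteq> {0..T}" using st by auto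
      note isub = integrable_subinterval_real[OF _ sub]
      have "f t - f s = integral {s..t} g" "u t - u s = integral {s..t} v"
        by (rule has_weak_deriv_diff[OF f st(1-3)], rule has_weak_deriv_diff[OF u st(1-3)])
      then have e: "prod (f t - f s) (u t) = integral {s..t} (\<lambda>r. prod (g r) (u t))"
          "prod (f s) (u t - u s) = integral {s..t} (\<lambda>r. prod (f s) (v r))"
        using integral_linear[OF isub[OF int(1)] bounded_linear_left, of "u t"]
          integral_linear[OF isub[OF int(2)] bounded_linear_right, of "f s"] by (simp_all add: o_def)
      have il: "(\<lambda>r. prod (g r) (u t)) integrable_on {s..t}" "(\<lambda>r. prod (f s) (v r)) integrable_on {s..t}"
        using integrable_linear[OF isub[OF int(1)] bounded_linear_left, of "u t"]
          integrable_linear[OF isub[OF int(2)] bounded_linear_right, of "f s"] by (simp_all add: o_def)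
      have "D t - D s = prod (f t - f s) (u t) + prod (f s) (u t - u s) - integral {s..t} ?k"
        using integral_interval_diff[OF int(3) st(1-3)]
        by (simp add: D_def diff_left diff_right algebra_simps)
      also have "\<dots> = integral {s..t} (\<lambda>r. (prod (g r) (u t) + prod (f s) (v r)) - ?k r)"
        unfolding e using il isub[OF int(3)]
        by (simp add: Henstock_Kurzweil_Integration.integral_add Henstock_Kurzweil_Integration.integral_diff integrable_add)
      finally have eq: "D t - D s = integral {s..t} (\<lambda>r. (prod (g r) (u t) + prod (f s) (v r)) - ?k r)" .
      have "norm (integral {s..t} (\<lambda>r. (prod (g r) (u t) + prod (f s) (v r)) - ?k r)) \<le>
          integral {s..t} (\<lambda>r. \<epsilon> * (norm (g r) + norm (v r)))"
      proof (rule Henstock_Kurzweil_Integration.integral_norm_bound_integral)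
        show "(\<lambda>r. (prod (g r) (u t) + prod (f s) (v r)) - ?k r) integrable_on {s..t}"
          by (intro integrable_diff integrable_add il isub int)
        show "(\<lambda>r. \<epsilon> * (norm (g r) + norm (v r))) integrable_on {s..t}"
          by (intro integrable_on_mult_right integrable_add isub int)
        fix r assume r: "r \<in> {s..t}"
        have "(prod (g r) (u t) + prod (f s) (v r)) - ?k r = prod (g r) (u t - u r) + prod (f s - f r) (v r)"
          by (simp add: diff_left diff_right)
        also have "norm \<dots> \<le> norm (g r) * norm (u t - u r) * K + norm (f s - f r) * norm (v r) * K"
          by (intro norm_triangle_mono K)
        also have "\<dots> \<le> norm (g r) * (\<epsilon> / K) * K + (\<epsilon> / K) * norm (v r) * K"
          using d1(2)[of r s] d2(2)[of r t] r st K(2)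
          by (intro add_mono mult_right_mono mult_left_mono) auto
        also have "\<dots> = \<epsilon> * (norm (g r) + norm (v r))" using K(2) by (simp add: field_simps)
        finally show "norm ((prod (g r) (u t) + prod (f s) (v r)) - ?k r) \<le> \<epsilon> * (norm (g r) + norm (v r))" .
      qed
      also have "\<dots> = \<epsilon> * (M t - M s)"
        unfolding M_def using integral_interval_diff[OF integrable_add[OF int(4,5)] st(1-3)] by simp
      finally show "norm (D t - D s) \<le> \<epsilon> * (M t - M s)" unfolding eq .
    qed
  qed (use t in auto)
  then show "prod (f t) (u t) = prod (f 0) (u 0) + integral {0..t} ?k" by (simp add: D_def algebra_simps)
qed

section \<open>Sums, products and quotients of class H1\<close>

lemma H1_mult:
  fixes f :: "real \<Rightarrow> 'a::euclidean_space" and u :: "real \<Rightarrow> 'b::euclidean_space"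
    and prod :: "'a \<Rightarrow> 'b \<Rightarrow> 'c::euclidean_space"
  assumes "bounded_bilinear prod" "H1 T f" "H1 T u"
  shows "H1 T (\<lambda>t. prod (f t) (u t))"
  using assms has_weak_deriv_mult unfolding H1_def by blast

lemma H1_add:
  assumes "H1 T f" "H1 T u"
  shows "H1 T (\<lambda>t. f t + u t)"
proof -
  obtain g v where g: "has_weak_deriv T f g" and v: "has_weak_deriv T u v"
    using assms by (auto simp: H1_def)
  have "has_weak_deriv T (\<lambda>t. f t + u t) (\<lambda>t. g t + v t)"
    unfolding has_weak_deriv_iff
  proof (intro conjI ballI)
    show "L2_on T (\<lambda>t. g t + v t)" by (intro L2_on_add has_weak_deriv_L2[OF g] has_weak_deriv_L2[OF v])
    fix t assume t: "t \<in> {0..T}"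
    have "g integrable_on {0..T}" "v integrable_on {0..T}"
      using g v has_weak_deriv_integrable by blast+
    then have "g integrable_on {0..t}" "v integrable_on {0..t}"
      using t by (auto intro: integrable_subinterval_real)
    then have "integral {0..t} (\<lambda>t. g t + v t) = integral {0..t} g + integral {0..t} v"
      by (rule Henstock_Kurzweil_Integration.integral_add)
    then show "f t + u t = f 0 + u 0 + integral {0..t} (\<lambda>t. g t + v t)"
      by (subst has_weak_deriv_at[OF g t], subst has_weak_deriv_at[OF v t]) (simp add: algebra_simps)
  qed
  then show ?thesis by (auto simp: H1_def)
qed

lemma H1_diff:
  assumes "H1 T f" "H1 T u"
  shows "H1 T (\<lambda>t. f t - u t)"
proof -
  have "bounded_bilinear (\<lambda>(r::real) (x::'a). r *\<^sub>R x)" by (rule bounded_bilinear_scaleR)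
  moreover have "H1 T (\<lambda>t. - 1 :: real)"
    unfolding H1_def has_weak_deriv_iff by (intro exI[of _ "\<lambda>t. 0"]) (auto simp: L2_on_def)
  ultimately have "H1 T (\<lambda>t. (-1) *\<^sub>R u t)" by (rule H1_mult[OF _ _ assms(2)])
  then show ?thesis using H1_add[OF assms(1)] by fastforce
qed

lemma C1_imp_has_weak_deriv:
  fixes f :: "real \<Rightarrow> 'a::euclidean_space"
  assumes "\<And>t. t \<in> {0..T} \<Longrightarrow> (f has_vector_derivative f' t) (at t within {0..T})" "continuous_on {0..T} f'"
  shows "has_weak_deriv T f f'"
  unfolding has_weak_deriv_iff
proof (intro conjI ballI)
  show "L2_on T f'" by (rule continuous_imp_L2_on[OF assms(2)])
  fix t assume t: "t \<in> {0..T}"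
  have "(f' has_integral (f t - f 0)) {0..t}"
  proof (rule fundamental_theorem_of_calculus)
    show "(f has_vector_derivative f' x) (at x within {0..t})" if "x \<in> {0..t}" for x
      using assms(1)[of x] t that by (auto intro: has_vector_derivative_within_subset)
  qed (use t in auto)
  then show "f t = f 0 + integral {0..t} f'" by (simp add: integral_unique)
qed

text \<open>Regularity of a quotient: with \<open>prod\<close> as multiplication, the candidate
  derivative is A(w - p u), where p and w are weak derivatives of \<open>P\<close> and
  \<open>P u\<close>. Only continuity of the inverse \<open>A\<close> enters. The use is to recover
  the class of x' from that of P x'.\<close>

lemma H1_solve:
  fixes P :: "real \<Rightarrow> 'a::euclidean_space" and u :: "real \<Rightarrow> 'b::euclidean_space"
    and prod :: "'a \<Rightarrow> 'b \<Rightarrow> 'b" and A :: "real \<Rightarrow> 'a"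
  assumes b: "bounded_bilinear prod" and P: "H1 T P" and v: "H1 T (\<lambda>t. prod (P t) (u t))"
    and u: "continuous_on {0..T} u" and A: "continuous_on {0..T} A"
    and inv: "\<And>t x. t \<in> {0..T} \<Longrightarrow> prod (A t) (prod (P t) x) = x"
  shows "H1 T u"
proof -
  interpret bounded_bilinear prod by (rule b)
  obtain p where p: "has_weak_deriv T P p" using P by (auto simp: H1_def)
  obtain w where w: "has_weak_deriv T (\<lambda>t. prod (P t) (u t)) w" using v by (auto simp: H1_def)
  let ?m = "\<lambda>t. w t - prod (p t) (u t)"
  let ?k = "\<lambda>t. prod (A t) (?m t)"
  have L: "L2_on T p" "L2_on T w" using p w has_weak_deriv_L2 by blast+
  have "L2_on T (\<lambda>t. prod (p t) (- u t))"
    by (rule L2_on_bilinear[OF flip _ L(1)]) (intro continuous_intros u)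
  then have Lm: "L2_on T ?m" using L2_on_add[OF L(2), of "\<lambda>t. - prod (p t) (u t)"] by (simp add: minus_right)
  then have Lk: "L2_on T ?k" by (rule L2_on_bilinear[OF b A])
  obtain K where K: "\<And>a b. norm (prod a b) \<le> norm a * norm b * K" "K > 0" using pos_bounded by blast
  have "bounded (A ` {0..T})" using compact_continuous_image[OF A] compact_imp_bounded by auto
  then obtain C where C0: "C > 0" "\<forall>x\<in>A ` {0..T}. norm x \<le> C"
    unfolding bounded_pos by blast
  then have C: "\<And>t. t \<in> {0..T} \<Longrightarrow> norm (A t) \<le> C" "C > 0" by auto
  have ai: "p absolutely_integrable_on {0..T}" "w absolutely_integrable_on {0..T}"
      "?m absolutely_integrable_on {0..T}" "?k absolutely_integrable_on {0..T}"
    using L Lm Lk L2_on_absolutely_integrable by blast+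
  have int: "p integrable_on {0..T}" "w integrable_on {0..T}" "?k integrable_on {0..T}"
      "(\<lambda>t. norm (?m t)) integrable_on {0..T}" "(\<lambda>t. norm (p t)) integrable_on {0..T}"
    using ai by (simp_all add: absolutely_integrable_on_def)
  define M where "M t = integral {0..t} (\<lambda>t. norm (?m t) + norm (p t))" for t
  define D where "D t = u t - u 0 - integral {0..t} ?k" for t
  have "D t = 0" if t: "t \<in> {0..T}" for t
  proof (rule vanishing_if_increments_small[where T = T and M = M])
    show "D 0 = 0" by (simp add: D_def)
    fix \<epsilon> :: real assume "\<epsilon> > 0"
    then have e1: "\<epsilon> / K > 0" and e2: "\<epsilon> / (C * K * K) > 0" using K C by simp_all
    obtain d1 where d1: "d1 > 0" "\<And>s t. s \<in> {0..T} \<Longrightarrow> t \<in> {0..T} \<Longrightarrow> \<bar>t - s\<bar> < d1 \<Longrightarrow> norm (A t - A s) \<le> \<epsilon> / K"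
      using uniform_modulus[OF A e1] by metis
    obtain d2 where d2: "d2 > 0" "\<And>s t. s \<in> {0..T} \<Longrightarrow> t \<in> {0..T} \<Longrightarrow> \<bar>t - s\<bar> < d2 \<Longrightarrow> norm (u t - u s) \<le> \<epsilon> / (C * K * K)"
      using uniform_modulus[OF u e2] by metis
    show "\<exists>\<delta>>0. \<forall>s t. 0 \<le> s \<longrightarrow> s \<le> t \<longrightarrow> t \<le> T \<longrightarrow> t - s < \<delta> \<longrightarrow> norm (D t - D s) \<le> \<epsilon> * (M t - M s)"
    proof (intro exI[of _ "min d1 d2"] conjI allI impI)
      show "min d1 d2 > 0" using d1 d2 by simp
      fix s t assume st: "0 \<le> s" "s \<le> t" "t \<le> T" "t - s < min d1 d2"
      have sub: "{s..t} \<subseteq> {0..T}" using st by auto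
      note isub = integrable_subinterval_real[OF _ sub]
      have tT: "t \<in> {0..T}" "s \<in> {0..T}" using st by auto
      \<comment> \<open>The contribution of the change of \<open>P\<close> to the increment of
        \<open>u\<close>, with \<open>u\<close> frozen at s and the inverse at t.\<close>
      define L where "L a = prod (A t) (- prod a (u s))" for a
      have bl: "bounded_linear L"
        unfolding L_def
        by (intro bounded_linear_compose[OF bounded_linear_right] bounded_linear_minus bounded_linear_left)
      have e0: "P t - P s = integral {s..t} p" "prod (P t) (u t) - prod (P s) (u s) = integral {s..t} w"
        by (rule has_weak_deriv_diff[OF p st(1-3)], rule has_weak_deriv_diff[OF w st(1-3)])
      have il: "(\<lambda>r. prod (A t) (w r)) integrable_on {s..t}" "(\<lambda>r. L (p r)) integrable_on {s..t}"
        using integrable_linear[OF isub[OF int(2)] bounded_linear_right, of "A t"]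
          integrable_linear[OF isub[OF int(1)] bl] by (simp_all add: o_def)
      have "u t - u s = prod (A t) (prod (P t) (u t) - prod (P t) (u s))"
        using inv[OF tT(1)] by (simp add: diff_right)
      also have "\<dots> = prod (A t) (prod (P t) (u t) - prod (P s) (u s)) + L (P t - P s)"
        by (simp add: L_def diff_left diff_right minus_right add_right)
      also have "\<dots> = integral {s..t} (\<lambda>r. prod (A t) (w r)) + integral {s..t} (\<lambda>r. L (p r))"
        unfolding e0 using integral_linear[OF isub[OF int(2)] bounded_linear_right, of "A t"]
          integral_linear[OF isub[OF int(1)] bl] by (simp add: o_def)
      finally have "D t - D s = integral {s..t} (\<lambda>r. (prod (A t) (w r) + L (p r)) - ?k r)"
        using integral_interval_diff[OF int(3) st(1-3)] il isub[OF int(3)]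
        by (simp add: D_def Henstock_Kurzweil_Integration.integral_add Henstock_Kurzweil_Integration.integral_diff integrable_add algebra_simps)
      moreover have "norm (integral {s..t} (\<lambda>r. (prod (A t) (w r) + L (p r)) - ?k r)) \<le>
          integral {s..t} (\<lambda>r. \<epsilon> * (norm (?m r) + norm (p r)))"
      proof (rule Henstock_Kurzweil_Integration.integral_norm_bound_integral)
        show "(\<lambda>r. (prod (A t) (w r) + L (p r)) - ?k r) integrable_on {s..t}"
          by (intro integrable_diff integrable_add il isub int)
        show "(\<lambda>r. \<epsilon> * (norm (?m r) + norm (p r))) integrable_on {s..t}"
          by (intro integrable_on_mult_right integrable_add isub int)
        fix r assume r: "r \<in> {s..t}"
        have "(prod (A t) (w r) + L (p r)) - ?k r = prod (A t - A r) (?m r) + prod (A t) (prod (p r) (u r - u s))"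
          by (simp add: L_def diff_left diff_right minus_right)
        also have "norm \<dots> \<le> norm (A t - A r) * norm (?m r) * K + norm (A t) * (norm (p r) * norm (u r - u s) * K) * K"
          using K C by (intro norm_triangle_mono order_trans[OF K(1)] mult_right_mono mult_left_mono) auto
        also have "\<dots> \<le> (\<epsilon> / K) * norm (?m r) * K + C * (norm (p r) * (\<epsilon> / (C * K * K)) * K) * K"
          using d1(2)[of r t] d2(2)[of s r] r st K(2) C(1)[OF tT(1)] C(2)
          by (intro add_mono mult_right_mono mult_left_mono mult_mono) (auto intro!: mult_nonneg_nonneg)
        also have "\<dots> = \<epsilon> * (norm (?m r) + norm (p r))" using K(2) C(2) by (simp add: field_simps)
        finally show "norm ((prod (A t) (w r) + L (p r)) - ?k r) \<le> \<epsilon> * (norm (?m r) + norm (p r))" .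
      qed
      moreover have "integral {s..t} (\<lambda>r. \<epsilon> * (norm (?m r) + norm (p r))) = \<epsilon> * (M t - M s)"
        unfolding M_def using integral_interval_diff[OF integrable_add[OF int(4,5)] st(1-3)] by simp
      ultimately show "norm (D t - D s) \<le> \<epsilon> * (M t - M s)" by (simp only:)
    qed
  qed (use t in auto)
  note D_zero = this
  have "u t = u 0 + integral {0..t} ?k" if "t \<in> {0..T}" for t
  proof -
    have "u t - u 0 - integral {0..t} ?k = 0" using D_zero[OF that] by (simp only: D_def)
    then show ?thesis by (simp add: algebra_simps)
  qed
  then have "has_weak_deriv T u ?k"
    unfolding has_weak_deriv_iff using Lk by blast
  then show ?thesis by (auto simp: H1_def)
qed

text \<open>Integrals over intervals vanish, hence over Borel sets by complements and disjoint
  unions, hence over Lebesgue sets, which differ from Borel sets by null sets. A density with all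
  integrals zero is zero almost everywhere.\<close>

lemma AE_zero_if_indefinite_integral_zero:
  fixes k :: "real \<Rightarrow> 'a::euclidean_space"
  assumes k: "k absolutely_integrable_on {0..T}" and z: "\<And>t. t \<in> {0..T} \<Longrightarrow> integral {0..t} k = 0"
  shows "AE t in lebesgue_on {0..T}. k t = 0"
proof -
  define F where "F t = indicator {0..T} t *\<^sub>R k t" for t
  have iF: "integrable lebesgue F" using k by (simp add: set_integrable_def F_def[abs_def])
  have sF: "set_integrable lebesgue A F" if "A \<in> sets lebesgue" for A
    using integrable_mult_indicator[OF that iF] by (simp add: set_integrable_def)
  have tot: "integral\<^sup>L lebesgue F = 0"
  proof (cases "0 \<le> T")
    case True
    have "integral\<^sup>L lebesgue F = integral {0..T} k"
      using set_lebesgue_integral_eq_integral(2)[OF k] by (simp add: set_lebesgue_integral_def F_def[abs_def])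
    then show ?thesis using z[of T] True by simp
  qed (simp add: F_def[abs_def])
  have bor: "set_lebesgue_integral lebesgue A F = 0" if "A \<in> sets borel" for A
    using that
  proof (induction A rule: borel_set_induct)
    case empty
    then show ?case by (simp add: set_lebesgue_integral_def)
  next
    case (interval a b)
    define c d where "c = max a 0" and "d = min b T"
    have "set_lebesgue_integral lebesgue {a..b} F = (LINT t:{c..d}|lebesgue. k t)"
      unfolding set_lebesgue_integral_def
      by (intro Bochner_Integration.integral_cong) (auto simp: F_def c_def d_def indicator_def)
    also have "\<dots> = 0"
    proof (cases "c \<le> d")
      case True
      have sub: "{c..d} \<subseteq> {0..T}" by (auto simp: c_def d_def)
      have "(LINT t:{c..d}|lebesgue. k t) = integral {c..d} k"
        by (rule set_lebesgue_integral_eq_integral(2)[OF absolutely_integrable_on_subinterval[OF k sub]])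
      also have "\<dots> = integral {0..d} k - integral {0..c} k"
        using set_lebesgue_integral_eq_integral(1)[OF k] True
        by (intro integral_interval_diff[symmetric]) (auto simp: c_def d_def)
      also have "\<dots> = 0" using z True by (auto simp: c_def d_def)
      finally show ?thesis .
    qed (simp add: set_lebesgue_integral_def)
    finally show ?case .
  next
    case (compl A)
    then have "A \<in> sets lebesgue" by simp
    have "set_lebesgue_integral lebesgue (- A) F + set_lebesgue_integral lebesgue A F = integral\<^sup>L lebesgue F"
    proof -
      have "set_lebesgue_integral lebesgue (- A \<union> A) F =
          set_lebesgue_integral lebesgue (- A) F + set_lebesgue_integral lebesgue A F"
        using \<open>A \<in> sets lebesgue\<close> sets.compl_sets[OF \<open>A \<in> sets lebesgue\<close>]
        by (intro set_integral_Un sF) (auto simp: Compl_eq_Diff_UNIV)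
      then show ?thesis by (simp add: set_lebesgue_integral_def Compl_partition2)
    qed
    then show ?case using compl tot by simp
  next
    case (union f)
    have "set_lebesgue_integral lebesgue (\<Union>i. f i) F = (\<Sum>i. set_lebesgue_integral lebesgue (f i) F)"
      using union by (intro lebesgue_integral_countable_add sF) (auto simp: disjoint_family_on_def)
    then show ?case using union by simp
  qed
  have all: "set_lebesgue_integral lebesgue A F = 0" if A: "A \<in> sets lebesgue" for A
  proof -
    obtain S N N' where S: "A = S \<union> N" "N \<subseteq> N'" "N' \<in> null_sets lborel" "S \<in> sets lborel"
      using sets_completionE[OF A] by metis
    have "AE t in lebesgue. t \<notin> N'" using S(3) by (intro AE_not_in) (simp add: null_sets_completionI)
    then have ae: "AE t in lebesgue. indicator A t *\<^sub>R F t = indicator S t *\<^sub>R F t"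
    proof (rule eventually_mono)
      fix t assume "t \<notin> N'"
      then have "t \<in> A \<longleftrightarrow> t \<in> S" using S(1,2) by blast
      then show "indicator A t *\<^sub>R F t = indicator S t *\<^sub>R F t" by (simp add: indicator_def)
    qed
    have Sl: "S \<in> sets lebesgue" using S(4) by simp
    have m: "(\<lambda>t. indicator B t *\<^sub>R F t) \<in> borel_measurable lebesgue" if "B \<in> sets lebesgue" for B
      using sF[OF that] unfolding set_integrable_def by (rule borel_measurable_integrable)
    have "set_lebesgue_integral lebesgue A F = set_lebesgue_integral lebesgue S F"
      unfolding set_lebesgue_integral_def by (rule integral_cong_AE[OF m[OF A] m[OF Sl] ae])
    then show ?thesis using bor S by simp
  qed
  have "sigma_finite_measure (lebesgue :: real measure)"
  proof
    obtain A :: "real set set" where "countable A" "A \<subseteq> sets lborel" "\<Union> A = space lborel"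
        "\<forall>a\<in>A. emeasure lborel a \<noteq> \<infinity>"
      using lborel.sigma_finite_countable by metis
    then show "\<exists>A::real set set. countable A \<and> A \<subseteq> sets lebesgue \<and> \<Union> A = space lebesgue \<and>
        (\<forall>a\<in>A. emeasure lebesgue a \<noteq> \<infinity>)"
      by (intro exI[of _ A]) (auto simp: subset_eq)
  qed
  then have "AE t in lebesgue. F t = 0" by (rule sigma_finite_measure.density_zero[OF _ iF all])
  then show ?thesis
    by (auto simp: AE_restrict_space_iff F_def elim!: eventually_mono)
qed

text \<open>\<open>weak_deriv\<close> selects a representative by \<open>SOME\<close>; this makes
  the eigenvalue equation independent of the selection.\<close>

lemma has_weak_deriv_unique:
  assumes f: "has_weak_deriv T f g" and h: "has_weak_deriv T f h"
  shows "AE t in lebesgue_on {0..T}. g t = h t"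
proof -
  have a: "g absolutely_integrable_on {0..T}" "h absolutely_integrable_on {0..T}"
    by (rule L2_on_absolutely_integrable[OF has_weak_deriv_L2[OF f]],
        rule L2_on_absolutely_integrable[OF has_weak_deriv_L2[OF h]])
  have "AE t in lebesgue_on {0..T}. g t - h t = 0"
  proof (rule AE_zero_if_indefinite_integral_zero)
    show "(\<lambda>t. g t - h t) absolutely_integrable_on {0..T}" by (rule set_integral_diff(1)[OF a])
    fix t assume t: "t \<in> {0..T}"
    have "g integrable_on {0..t}" "h integrable_on {0..t}"
      using a[THEN set_lebesgue_integral_eq_integral(1)] t by (auto intro: integrable_subinterval_real)
    moreover have "integral {0..t} g = integral {0..t} h"
      by (rule add_left_imp_eq[of "f 0"])
        (rule trans[OF has_weak_deriv_at[OF f t, symmetric] has_weak_deriv_at[OF h t]])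
    ultimately show "integral {0..t} (\<lambda>t. g t - h t) = 0"
      by (simp add: Henstock_Kurzweil_Integration.integral_diff)
  qed
  then show ?thesis by simp
qed

section \<open>Initial value problems and the Hermitian product\<close>

text \<open>Picard iteration in the exponentially weighted supremum norm, which is a contraction on
  the whole interval at once. The unknown of the iteration is the weighted solution exp(-K t)
  z(t).\<close>

lemma ivp_exists:
  fixes F :: "real \<Rightarrow> 'a::euclidean_space \<Rightarrow> 'a"
  assumes T: "0 \<le> T"
    and cont: "\<And>z. continuous_on {0..T} z \<Longrightarrow> continuous_on {0..T} (\<lambda>t. F t (z t))"
    and lip: "\<And>t x y. t \<in> {0..T} \<Longrightarrow> norm (F t x - F t y) \<le> L * norm (x - y)" and L: "L > 0"
  shows "\<exists>z. z 0 = z0 \<and> (\<forall>t\<in>{0..T}. (z has_vector_derivative F t (z t)) (at t within {0..T}))"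
proof -
  \<comment> \<open>Clamping to [0,T] turns functions on the interval into bounded continuous
    functions on the line, a complete metric space.\<close>
  define cl where "cl t = max 0 (min t T)" for t :: real
  have cl: "cl t \<in> {0..T}" for t using T by (auto simp: cl_def)
  have clid: "cl t = t" if "t \<in> {0..T}" for t using that by (auto simp: cl_def)
  have ccl: "continuous_on UNIV cl" unfolding cl_def by (intro continuous_intros)
  \<comment> \<open>The contraction factor is L/K, hence 1/2.\<close>
  define K where "K = 2 * L"
  have K: "K > 0" using L by (simp add: K_def)
  define G where "G u s = F s (exp (K * s) *\<^sub>R u s)" for u :: "real \<Rightarrow> 'a" and s
  define H where "H u t = exp (- K * t) *\<^sub>R (z0 + integral {0..t} (G u))" for u t
  have cG: "continuous_on {0..T} (G u)" if "continuous_on UNIV u" for u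
    unfolding G_def by (intro cont continuous_intros continuous_on_subset[OF that]) auto
  have cH: "continuous_on {0..T} (H u)" if "continuous_on UNIV u" for u
    unfolding H_def
    by (intro continuous_intros indefinite_integral_continuous_1 integrable_continuous_interval cG that)
  have bc: "H u \<circ> cl \<in> bcontfun" if "continuous_on UNIV u" for u
  proof -
    have "continuous_on UNIV (H u \<circ> cl)"
      by (intro continuous_on_compose ccl continuous_on_subset[OF cH[OF that]]) (use cl in auto)
    have "bounded (H u ` {0..T})"
      using compact_continuous_image[OF cH[OF that]] compact_imp_bounded by auto
    then have "bounded (range (H u \<circ> cl))" by (rule bounded_subset) (use cl in auto)
    with \<open>continuous_on UNIV (H u \<circ> cl)\<close> show ?thesis by (simp add: bcontfun_def)
  qed
  define Op where "Op u = Bcontfun (H (apply_bcontfun u) \<circ> cl)" for u :: "real \<Rightarrow>\<^sub>C 'a"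
  have Op: "apply_bcontfun (Op u) t = H (apply_bcontfun u) (cl t)" for u t
    unfolding Op_def by (subst Bcontfun_inverse[OF bc]) auto
  have "\<exists>!u. Op u = u"
  proof (rule banach_fix_type[of "1/2"])
    show "\<forall>u v. dist (Op u) (Op v) \<le> 1 / 2 * dist u v"
    proof (intro allI dist_bound)
      fix u v :: "real \<Rightarrow>\<^sub>C 'a" and t :: real
      define \<tau> where "\<tau> = cl t"
      have \<tau>: "0 \<le> \<tau>" "\<tau> \<le> T" using cl[of t] by (auto simp: \<tau>_def)
      define d where "d = dist u v"
      have iG: "G (apply_bcontfun w) integrable_on {0..\<tau>}" for w
        using \<tau> by (intro integrable_continuous_interval continuous_on_subset[OF cG]) auto
      have ex: "((\<lambda>s. L * (exp (K * s) * d)) has_integral (d / 2 * exp (K * \<tau>) - d / 2 * exp (K * 0))) {0..\<tau>}"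
      proof (rule fundamental_theorem_of_calculus)
        fix s assume "s \<in> {0..\<tau>}"
        have "((\<lambda>s. d / 2 * exp (K * s)) has_real_derivative L * (exp (K * s) * d)) (at s within {0..\<tau>})"
          by (auto intro!: derivative_eq_intros simp: K_def)
        then show "((\<lambda>s. d / 2 * exp (K * s)) has_vector_derivative L * (exp (K * s) * d)) (at s within {0..\<tau>})"
          by (simp add: has_real_derivative_iff_has_vector_derivative)
      qed (use \<tau> in auto)
      have "norm (integral {0..\<tau>} (\<lambda>s. G (apply_bcontfun u) s - G (apply_bcontfun v) s)) \<le>
          integral {0..\<tau>} (\<lambda>s. L * (exp (K * s) * d))"
      proof (rule Henstock_Kurzweil_Integration.integral_norm_bound_integral)
        show "(\<lambda>s. L * (exp (K * s) * d)) integrable_on {0..\<tau>}" using ex by blast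
        fix s assume s: "s \<in> {0..\<tau>}"
        have "norm (G (apply_bcontfun u) s - G (apply_bcontfun v) s) \<le>
            L * norm (exp (K * s) *\<^sub>R apply_bcontfun u s - exp (K * s) *\<^sub>R apply_bcontfun v s)"
          unfolding G_def using s \<tau> by (intro lip) auto
        also have "\<dots> = L * (exp (K * s) * dist (apply_bcontfun u s) (apply_bcontfun v s))"
          by (simp add: dist_norm scaleR_right_diff_distrib[symmetric])
        also have "\<dots> \<le> L * (exp (K * s) * d)"
          using L dist_bounded[of u s v] by (intro mult_left_mono) (auto simp: d_def)
        finally show "norm (G (apply_bcontfun u) s - G (apply_bcontfun v) s) \<le> L * (exp (K * s) * d)" .
      qed (intro integrable_diff iG)
      also have "\<dots> \<le> d / 2 * exp (K * \<tau>)" using integral_unique[OF ex] by (simp add: d_def)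
      finally have n: "norm (integral {0..\<tau>} (\<lambda>s. G (apply_bcontfun u) s - G (apply_bcontfun v) s)) \<le> d / 2 * exp (K * \<tau>)" .
      have "dist (apply_bcontfun (Op u) t) (apply_bcontfun (Op v) t) =
          exp (- K * \<tau>) * norm (integral {0..\<tau>} (\<lambda>s. G (apply_bcontfun u) s - G (apply_bcontfun v) s))"
        unfolding Op \<tau>_def[symmetric] H_def dist_norm scaleR_right_diff_distrib[symmetric]
        by (simp add: Henstock_Kurzweil_Integration.integral_diff[OF iG iG])
      also have "\<dots> \<le> exp (- K * \<tau>) * (d / 2 * exp (K * \<tau>))" using n by (intro mult_left_mono) auto
      also have "\<dots> = 1 / 2 * d" by (simp add: exp_minus field_simps)
      finally show "dist (apply_bcontfun (Op u) t) (apply_bcontfun (Op v) t) \<le> 1 / 2 * dist u v"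
        by (simp add: d_def)
    qed
  qed auto
  then obtain u where u: "Op u = u" by blast
  let ?u = "apply_bcontfun u"
  define z where "z t = exp (K * t) *\<^sub>R ?u t" for t
  have zeq: "z t = z0 + integral {0..t} (G ?u)" if "t \<in> {0..T}" for t
  proof -
    have "?u t = H ?u t" using Op[of u t] u clid[OF that] by simp
    then have "z t = exp (K * t) *\<^sub>R (exp (- K * t) *\<^sub>R (z0 + integral {0..t} (G ?u)))"
      by (simp add: z_def H_def)
    then show ?thesis by (simp add: exp_minus)
  qed
  have Gz: "G ?u = (\<lambda>s. F s (z s))" by (simp add: G_def z_def fun_eq_iff)
  have "(z has_vector_derivative F t (z t)) (at t within {0..T})" if t: "t \<in> {0..T}" for t
  proof -
    have "((\<lambda>t. integral {0..t} (G ?u)) has_vector_derivative G ?u t) (at t within {0..T})"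
      by (rule integral_has_vector_derivative[OF cG t]) auto
    then have "((\<lambda>t. z0 + integral {0..t} (G ?u)) has_vector_derivative 0 + G ?u t) (at t within {0..T})"
      by (intro has_vector_derivative_add has_vector_derivative_const)
    then have "(z has_vector_derivative 0 + G ?u t) (at t within {0..T})"
      by (rule has_vector_derivative_transform[OF t zeq, rotated])
    then show ?thesis by (simp add: Gz)
  qed
  moreover have "z 0 = z0" using zeq[of 0] T by simp
  ultimately show ?thesis by blast
qed

text \<open>Gronwall's argument: exp(-2 L t) |z(t)|^2 is nonincreasing and starts at 0.\<close>

lemma ivp_zero:
  fixes z :: "real \<Rightarrow> 'a::euclidean_space"
  assumes T: "0 < T"
    and d: "\<And>t. t \<in> {0..T} \<Longrightarrow> (z has_vector_derivative z' t) (at t within {0..T})"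
    and b: "\<And>t. t \<in> {0..T} \<Longrightarrow> norm (z' t) \<le> L * norm (z t)" and z0: "z 0 = 0" and t: "t \<in> {0..T}"
  shows "z t = 0"
proof -
  define f where "f t = exp (- (2 * L * t)) * (z t \<bullet> z t)" for t
  have df: "(f has_real_derivative exp (- (2 * L * s)) * (2 * (z s \<bullet> z' s) - 2 * L * (z s \<bullet> z s))) (at s within {0..T})"
    if s: "s \<in> {0..T}" for s
  proof -
    have "((\<lambda>t. z t \<bullet> z t) has_vector_derivative (z s \<bullet> z' s + z' s \<bullet> z s)) (at s within {0..T})"
      by (rule bounded_bilinear.has_vector_derivative[OF bounded_bilinear_inner d[OF s] d[OF s]])
    then have "((\<lambda>t. z t \<bullet> z t) has_real_derivative (2 * (z s \<bullet> z' s))) (at s within {0..T})"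
      by (simp add: has_real_derivative_iff_has_vector_derivative inner_commute)
    then show ?thesis unfolding f_def
      by (auto intro!: derivative_eq_intros simp: algebra_simps)
  qed
  have "f t \<le> f 0"
  proof (rule DERIV_nonpos_imp_decreasing_open[of 0 t f])
    show "0 \<le> t" using t by simp
    have "continuous_on {0..T} f" by (rule DERIV_continuous_on[OF df])
    then show "continuous_on {0..t} f" by (rule continuous_on_subset) (use t in auto)
    fix s assume s: "0 < s" "s < t"
    then have sT: "s \<in> {0..T}" "s \<in> interior {0..T}" using t by auto
    have "z s \<bullet> z' s \<le> norm (z s) * norm (z' s)" by (rule norm_cauchy_schwarz)
    also have "\<dots> \<le> norm (z s) * (L * norm (z s))" using b[OF sT(1)] by (intro mult_left_mono) auto
    also have "\<dots> = L * (z s \<bullet> z s)" by (simp add: dot_square_norm power2_eq_square)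
    finally have "exp (- (2 * L * s)) * (2 * (z s \<bullet> z' s) - 2 * L * (z s \<bullet> z s)) \<le> 0"
      by (simp add: mult_nonneg_nonpos)
    moreover have "(f has_real_derivative exp (- (2 * L * s)) * (2 * (z s \<bullet> z' s) - 2 * L * (z s \<bullet> z s))) (at s)"
      using df[OF sT(1)] at_within_interior[OF sT(2)] by simp
    ultimately show "\<exists>y. (f has_real_derivative y) (at s) \<and> y \<le> 0" by blast
  qed
  then have "z t \<bullet> z t \<le> 0" by (simp add: f_def z0 mult_le_0_iff)
  then show ?thesis by (metis inner_ge_zero inner_eq_zero_iff order_antisym)
qed

section \<open>Algebra of the Hermitian product\<close>

lemma hermitian_add_left: "hermitian (u + v) w = hermitian u w + hermitian v w"
  by (simp add: hermitian_def distrib_right sum.distrib)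

lemma hermitian_add_right: "hermitian w (u + v) = hermitian w u + hermitian w v"
  by (simp add: hermitian_def distrib_left sum.distrib)

lemma hermitian_diff_left: "hermitian (u - v) w = hermitian u w - hermitian v w"
  by (simp add: hermitian_def left_diff_distrib sum_subtractf)

lemma hermitian_minus_left: "hermitian (- u) w = - hermitian u w"
  by (simp add: hermitian_def sum_negf)

lemma hermitian_scale_left: "hermitian (c *s u) w = c * hermitian u w"
  by (simp add: hermitian_def sum_distrib_left mult.assoc)

lemma hermitian_scale_right: "hermitian w (c *s u) = cnj c * hermitian w u"
  by (simp add: hermitian_def sum_distrib_left mult_ac)

lemma scaleR_eq_scale: "r *\<^sub>R (u :: complex ^ 'm) = complex_of_real r *s u"
  unfolding vec_eq_iff vector_scaleR_component vector_smult_component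
  by (simp add: scaleR_conv_of_real)

lemma hermitian_scaleR_left: "hermitian (r *\<^sub>R u) w = complex_of_real r * hermitian u w"
  by (simp add: scaleR_eq_scale hermitian_scale_left)

lemma hermitian_scaleR_right: "hermitian w (r *\<^sub>R u) = complex_of_real r * hermitian w u"
  by (simp add: scaleR_eq_scale hermitian_scale_right)

lemma hermitian_cnj: "hermitian v u = cnj (hermitian u v)"
  by (simp add: hermitian_def mult.commute)

lemma hermitian_zero_left [simp]: "hermitian 0 w = 0"
  by (simp add: hermitian_def)

lemma hermitian_zero_right [simp]: "hermitian w 0 = 0"
  by (simp add: hermitian_def)

lemma Re_hermitian: "Re (hermitian u v) = u \<bullet> v"
  by (simp add: hermitian_def inner_vec_def inner_complex_def)

lemma hermitian_self: "hermitian u u = complex_of_real ((norm u)\<^sup>2)"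
proof (rule complex_eqI)
  show "Re (hermitian u u) = Re (complex_of_real ((norm u)\<^sup>2))" by (simp add: Re_hermitian dot_square_norm)
  have "hermitian u u = cnj (hermitian u u)" by (rule hermitian_cnj)
  then have "Im (hermitian u u) = Im (cnj (hermitian u u))" by (rule arg_cong)
  then have "Im (hermitian u u) = - Im (hermitian u u)" by simp
  then show "Im (hermitian u u) = Im (complex_of_real ((norm u)\<^sup>2))" by simp
qed

text \<open>Bilinear over the reals, which suffices for continuity and the product rule although the
  second argument is conjugated.\<close>

lemma hermitian_bilinear: "bounded_bilinear (hermitian :: complex ^ 'm::finite \<Rightarrow> _)"
  unfolding bilinear_conv_bounded_bilinear[symmetric] bilinear_def
  by (auto intro!: linearI simp: hermitian_add_left hermitian_add_right hermitian_scaleR_left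
      hermitian_scaleR_right scaleR_complex.code complex_eq_iff)

lemma hermitian_sum_left: "hermitian (\<Sum>i\<in>A. f i) w = (\<Sum>i\<in>A. hermitian (f i) w)"
  by (induction A rule: infinite_finite_induct) (auto simp: hermitian_add_left)

section \<open>Real matrices acting on complex vectors\<close>

lemma cmat_nth: "cmat M $ i $ j = complex_of_real (M $ i $ j)"
  by (simp add: cmat_def map_matrix_def)

lemma cmat_mult_nth: "(cmat M *v v) $ i = (\<Sum>j\<in>UNIV. complex_of_real (M $ i $ j) * v $ j)"
  by (simp add: matrix_vector_mult_def cmat_nth)

lemma cmat_bilinear: "bounded_bilinear (\<lambda>M v. cmat M *v v :: complex ^ 'm::finite)"
proof -
  have "bilinear (\<lambda>M v. cmat M *v v :: complex ^ 'm::finite)"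
    unfolding bilinear_def
    by (auto intro!: linearI simp: vec_eq_iff cmat_mult_nth sum.distrib distrib_left distrib_right
        scaleR_eq_scale sum_distrib_left scaleR_conv_of_real[where 'a = complex] mult_ac)
  then show ?thesis by (simp add: bilinear_conv_bounded_bilinear)
qed

lemma cmat_mult_add: "cmat M *v (u + v) = cmat M *v u + cmat M *v v"
  by (rule matrix_vector_right_distrib)

lemma cmat_mult_scale: "cmat M *v (c *s u) = c *s (cmat M *v u)"
  by (simp add: vector_scalar_commute)

lemma cmat_mult_mult: "cmat M *v (cmat N *v v) = cmat (M ** N) *v v"
  by (simp add: vec_eq_iff cmat_mult_nth matrix_matrix_mult_def sum_distrib_left sum_distrib_right mult.assoc)
     (subst sum.swap, simp)

lemma cmat_mat_1: "cmat (mat 1) *v v = v"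
proof -
  have "cmat (mat 1 :: real ^ 'a ^ 'a) = mat 1" by (simp add: vec_eq_iff cmat_nth mat_def)
  then show ?thesis by simp
qed

lemma hermitian_adjoint: "hermitian (cmat M *v u) v = hermitian u (cmat (transpose M) *v v)"
  unfolding hermitian_def cmat_mult_nth transpose_def
  by (simp add: sum_distrib_left sum_distrib_right mult_ac) (subst sum.swap, simp)

lemma continuous_on_cmat_mult [continuous_intros]:
  "continuous_on S M \<Longrightarrow> continuous_on S v \<Longrightarrow> continuous_on S (\<lambda>t. cmat (M t) *v v t)"
  by (rule bounded_bilinear.continuous_on[OF cmat_bilinear])

lemma continuous_on_hermitian [continuous_intros]:
  "continuous_on S u \<Longrightarrow> continuous_on S v \<Longrightarrow> continuous_on S (\<lambda>t. hermitian (u t) (v t))"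
  by (rule bounded_bilinear.continuous_on[OF hermitian_bilinear])

lemma continuous_on_transpose [continuous_intros]:
  fixes M :: "'b::topological_space \<Rightarrow> real ^ 'k ^ 'm"
  assumes "continuous_on S M"
  shows "continuous_on S (\<lambda>t. transpose (M t))"
  unfolding transpose_def by (intro continuous_intros assms)

section \<open>Block vectors\<close>

lemma hermitian_join: "hermitian (join u v) (join u' v') = hermitian u u' + hermitian v v'"
proof -
  have "hermitian (join u v) (join u' v') =
      (\<Sum>i\<in>range Inl \<union> range Inr. join u v $ i * cnj (join u' v' $ i))"
    by (simp add: hermitian_def UNIV_sum)
  also have "\<dots> = hermitian u u' + hermitian v v'"
    by (subst sum.union_disjoint) (auto simp: sum.reindex join_def hermitian_def)
  finally show ?thesis .
qed

lemma join_add: "join u v + join u' v' = join (u + u') (v + v')"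
  by (simp add: vec_eq_iff join_def split: sum.split)

lemma join_scale: "c *s join u v = join (c *s u) (c *s v)"
  by (simp add: vec_eq_iff join_def split: sum.split)

lemma left_part_join [simp]: "left_part (join u v) = u"
  by (simp add: left_part_def join_def)

lemma right_part_join [simp]: "right_part (join u v) = v"
  by (simp add: right_part_def join_def)

lemma join_parts [simp]: "join (left_part w) (right_part w) = w"
  by (simp add: vec_eq_iff left_part_def right_part_def join_def split: sum.split)

lemma join_eq_iff [simp]: "join u v = join u' v' \<longleftrightarrow> u = u' \<and> v = v'"
  by (metis left_part_join right_part_join)

lemma left_part_linear: "left_part (u + v) = left_part u + left_part v" "left_part (c *s u) = c *s left_part u"
  "left_part (u - v) = left_part u - left_part v" "left_part 0 = 0"
  by (simp_all add: vec_eq_iff left_part_def)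

lemma right_part_linear: "right_part (u + v) = right_part u + right_part v" "right_part (c *s u) = c *s right_part u"
  "right_part (u - v) = right_part u - right_part v" "right_part 0 = 0"
  by (simp_all add: vec_eq_iff right_part_def)

text \<open>The index type stays free, so the same interpretation covers functions on the line and
  the sequences of data used later; \<open>vcs\<close> serves the boundary vectors.\<close>

interpretation cvs: complex_vector_space "scale_fun :: complex \<Rightarrow> ('b \<Rightarrow> complex ^ 'n::finite) \<Rightarrow> _"
  by unfold_locales

interpretation vcs: complex_vector_space "(*s) :: complex \<Rightarrow> complex ^ 'n::finite \<Rightarrow> _"
  by unfold_locales

lemma hform_hermitian: "vcs.hform UNIV hermitian"
  by (rule vcs.hformI) (auto simp: hermitian_add_left hermitian_scale_left intro: hermitian_cnj)

section \<open>The energy form\<close>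

lemma bounded_linear_vec_scale: "bounded_linear ((*s) c :: complex ^ 'm::finite \<Rightarrow> _)"
  unfolding linear_conv_bounded_linear[symmetric]
  by (intro linearI) (simp_all add: vec_eq_iff distrib_left)

locale sturm_liouville =
  fixes P Q R :: "real \<Rightarrow> real ^ 'n ^ 'n::finite" and T :: real
  assumes T_pos: "T > 0"
    and H1_P: "H1 T P" and H1_Q: "H1 T Q" and cont_R: "continuous_on {0..T} R"
    and sym_P: "\<And>t. t \<in> {0..T} \<Longrightarrow> transpose (P t) = P t"
    and sym_R: "\<And>t. t \<in> {0..T} \<Longrightarrow> transpose (R t) = R t"
    and pos_P: "\<And>t v. t \<in> {0..T} \<Longrightarrow> v \<noteq> 0 \<Longrightarrow> v \<bullet> (P t *v v) > 0"
begin

lemma cont_P: "continuous_on {0..T} P"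
  by (rule H1_continuous[OF H1_P])

lemma cont_Q: "continuous_on {0..T} Q"
  by (rule H1_continuous[OF H1_Q])

text \<open>The quadratic form attains a positive minimum on the compact product of [0,T] with the
  unit sphere; homogeneity does the rest.\<close>

lemma P_coercive: "\<exists>p>0. \<forall>t\<in>{0..T}. \<forall>v. p * (norm v)\<^sup>2 \<le> v \<bullet> (P t *v v)"
proof -
  let ?S = "{0..T} \<times> sphere (0 :: real ^ 'n) 1"
  define f where "f z = snd z \<bullet> (P (fst z) *v snd z)" for z
  have "(0, axis undefined 1) \<in> ?S" using T_pos by simp
  then have ne: "?S \<noteq> {}" by blast
  have "continuous_on ?S (\<lambda>z. P (fst z))"
    by (rule continuous_on_compose2[OF cont_P continuous_on_fst[OF continuous_on_id]]) auto
  then have "continuous_on ?S f"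
    unfolding f_def matrix_vector_mult_def by (intro continuous_intros)
  then obtain z where z: "z \<in> ?S" "\<And>y. y \<in> ?S \<Longrightarrow> f z \<le> f y"
    using continuous_attains_inf[OF compact_Times[OF compact_Icc compact_sphere] ne] by metis
  have "snd z \<noteq> 0" using z(1) by auto
  then have "f z > 0" using z(1) pos_P[of "fst z" "snd z"] by (auto simp: f_def)
  moreover have "f z * (norm v)\<^sup>2 \<le> v \<bullet> (P t *v v)" if t: "t \<in> {0..T}" for t v
  proof (cases "v = 0")
    case False
    define u where "u = (1 / norm v) *\<^sub>R v"
    have v: "v = norm v *\<^sub>R u" using False by (simp add: u_def)
    have "f z \<le> f (t, u)" using z(2) t False by (simp add: u_def)
    then have "f z * (norm v)\<^sup>2 \<le> (u \<bullet> (P t *v u)) * (norm v)\<^sup>2"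
      by (intro mult_right_mono) (auto simp: f_def)
    also have "\<dots> = (norm v *\<^sub>R u) \<bullet> (P t *v (norm v *\<^sub>R u))"
      by (simp add: matrix_vector_mult_scaleR power2_eq_square)
    finally show ?thesis using v by simp
  qed simp
  ultimately show ?thesis by blast
qed

lemma P_coercive_complex:
  "\<exists>p>0. \<forall>t\<in>{0..T}. \<forall>v :: complex ^ 'n. p * (norm v)\<^sup>2 \<le> v \<bullet> (cmat (P t) *v v)"
proof -
  obtain p where p: "p > 0" "\<And>t v. t \<in> {0..T} \<Longrightarrow> p * (norm v)\<^sup>2 \<le> v \<bullet> (P t *v v)"
    using P_coercive by blast
  have "p * (norm v)\<^sup>2 \<le> v \<bullet> (cmat (P t) *v v)" if t: "t \<in> {0..T}" for t and v :: "complex ^ 'n"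
  proof -
    define a b where "a = (\<chi> i. Re (v $ i))" and "b = (\<chi> i. Im (v $ i))"
    have "(norm v)\<^sup>2 = (norm a)\<^sup>2 + (norm b)\<^sup>2"
      by (simp add: power2_norm_eq_inner inner_vec_def a_def b_def inner_complex_def sum.distrib)
    moreover have "v \<bullet> (cmat (P t) *v v) = a \<bullet> (P t *v a) + b \<bullet> (P t *v b)"
      unfolding inner_vec_def cmat_mult_nth
      by (simp add: inner_complex_def sum.distrib matrix_vector_mult_def a_def b_def)
    ultimately show ?thesis using p(2)[OF t, of a] p(2)[OF t, of b] by (simp add: distrib_left)
  qed
  then show ?thesis using p(1) by blast
qed

section \<open>The inverse of the leading coefficient\<close>

definition Pinv :: "real \<Rightarrow> real ^ 'n ^ 'n" where
  "Pinv t = (SOME B. B ** P t = mat 1)"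

lemma Pinv:
  assumes "t \<in> {0..T}"
  shows "cmat (Pinv t) *v (cmat (P t) *v v) = v" "cmat (P t) *v (cmat (Pinv t) *v v) = v"
proof -
  have "\<forall>x. P t *v x = 0 \<longrightarrow> x = 0" using pos_P[OF assms] by force
  then have "\<exists>B. B ** P t = mat 1" by (simp add: matrix_left_invertible_ker)
  then have l: "Pinv t ** P t = mat 1" unfolding Pinv_def by (rule someI_ex)
  then have r: "P t ** Pinv t = mat 1" by (simp add: matrix_left_right_inverse)
  show "cmat (Pinv t) *v (cmat (P t) *v v) = v" "cmat (P t) *v (cmat (Pinv t) *v v) = v"
    by (simp_all add: cmat_mult_mult l r cmat_mat_1)
qed

lemma matrix_bound:
  fixes M :: "real \<Rightarrow> real ^ 'n ^ 'n"
  assumes "continuous_on {0..T} M"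
  shows "\<exists>B>0. \<forall>t\<in>{0..T}. \<forall>v :: complex ^ 'n. norm (cmat (M t) *v v) \<le> B * norm v"
proof -
  obtain K where K: "K > 0" "\<And>M v. norm (cmat M *v v :: complex ^ 'n) \<le> norm (M :: real ^ 'n ^ 'n) * norm v * K"
    using bounded_bilinear.pos_bounded[OF cmat_bilinear] by blast
  have "bounded (M ` {0..T})" using compact_continuous_image[OF assms] compact_imp_bounded by auto
  then obtain C where C: "C > 0" "\<forall>x\<in>M ` {0..T}. norm x \<le> C"
    unfolding bounded_pos by blast
  have "norm (cmat (M t) *v v) \<le> (C * K) * norm v" if "t \<in> {0..T}" for t and v :: "complex ^ 'n"
  proof -
    have "norm (cmat (M t) *v v) \<le> norm (M t) * norm v * K" by (rule K)
    also have "\<dots> \<le> C * norm v * K" using C that K by (intro mult_right_mono) auto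
    finally show ?thesis by (simp add: mult_ac)
  qed
  then show ?thesis using C(1) K(1) by (intro exI[of _ "C * K"]) auto
qed

lemma Pinv_bound: "\<exists>B>0. \<forall>t\<in>{0..T}. \<forall>v :: complex ^ 'n. norm (cmat (Pinv t) *v v) \<le> B * norm v"
proof -
  obtain p where p: "p > 0" "\<And>t v. t \<in> {0..T} \<Longrightarrow> p * (norm v)\<^sup>2 \<le> (v :: complex ^ 'n) \<bullet> (cmat (P t) *v v)"
    using P_coercive_complex by blast
  have "norm (cmat (Pinv t) *v v) \<le> 1 / p * norm v" if t: "t \<in> {0..T}" for t and v :: "complex ^ 'n"
  proof -
    let ?u = "cmat (Pinv t) *v v"
    have "p * (norm ?u)\<^sup>2 \<le> ?u \<bullet> v" using p(2)[OF t, of ?u] Pinv(2)[OF t, of v] by simp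
    also have "\<dots> \<le> norm ?u * norm v" by (rule norm_cauchy_schwarz)
    finally have "norm ?u * (p * norm ?u) \<le> norm ?u * norm v" by (simp add: power2_eq_square mult_ac)
    then have "p * norm ?u \<le> norm v" by (cases "norm ?u = 0") (auto simp: mult_le_cancel_left)
    then show ?thesis using p(1) by (simp add: field_simps)
  qed
  then show ?thesis using p(1) by (intro exI[of _ "1 / p"]) auto
qed

text \<open>With u = P(s)^{-1} w one has u - P(t)^{-1} w = P(t)^{-1}(P(t) u - w), and P(t)^{-1} is
  bounded uniformly in t by coercivity.\<close>

lemma cont_Pinv: "continuous_on {0..T} Pinv"
proof -
  obtain B where B: "B > 0" "\<And>t v. t \<in> {0..T} \<Longrightarrow> norm (cmat (Pinv t) *v v :: complex ^ 'n) \<le> B * norm v"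
    using Pinv_bound by blast
  have c: "continuous_on {0..T} (\<lambda>t. cmat (Pinv t) *v w)" for w :: "complex ^ 'n"
    unfolding continuous_on_def
  proof
    fix s assume s: "s \<in> {0..T}"
    define u where "u = cmat (Pinv s) *v w"
    have "((\<lambda>t. cmat (P t) *v u) \<longlongrightarrow> cmat (P s) *v u) (at s within {0..T})"
      using continuous_on_cmat_mult[OF cont_P continuous_on_const, of u] s by (simp add: continuous_on_def)
    then have "((\<lambda>t. cmat (P t) *v u - w) \<longlongrightarrow> 0) (at s within {0..T})"
      using Pinv(2)[OF s, of w] by (simp add: u_def LIM_zero)
    then have lim: "((\<lambda>t. B * norm (cmat (P t) *v u - w)) \<longlongrightarrow> 0) (at s within {0..T})"
      using tendsto_mult_right_zero tendsto_norm_zero by blast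
    have "((\<lambda>t. u - cmat (Pinv t) *v w) \<longlongrightarrow> 0) (at s within {0..T})"
    proof (rule Lim_null_comparison[OF _ lim])
      show "\<forall>\<^sub>F t in at s within {0..T}. norm (u - cmat (Pinv t) *v w) \<le> B * norm (cmat (P t) *v u - w)"
        unfolding eventually_at_filter
      proof (intro always_eventually allI impI)
        fix t assume t: "t \<in> {0..T}"
        have "u - cmat (Pinv t) *v w = cmat (Pinv t) *v (cmat (P t) *v u - w)"
          using Pinv(1)[OF t, of u] by (simp add: matrix_vector_mult_diff_distrib)
        then show "norm (u - cmat (Pinv t) *v w) \<le> B * norm (cmat (P t) *v u - w)"
          using B(2)[OF t] by simp
      qed
    qed
    then have "((\<lambda>t. u - (u - cmat (Pinv t) *v w)) \<longlongrightarrow> u - 0) (at s within {0..T})"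
      by (intro tendsto_diff tendsto_const)
    then show "((\<lambda>t. cmat (Pinv t) *v w) \<longlongrightarrow> cmat (Pinv s) *v w) (at s within {0..T})"
      by (simp add: u_def)
  qed
  have e: "Pinv t $ i $ j = Re ((cmat (Pinv t) *v axis j 1) $ i)" for t i j
    by (simp add: cmat_mult_nth axis_def if_distrib cong: if_cong)
  have "continuous_on {0..T} (\<lambda>t. \<chi> i j. Pinv t $ i $ j)"
    unfolding e by (intro continuous_intros c)
  then show ?thesis by simp
qed

text \<open>C^1 on the closed interval, extended by 0 as in \<open>SL_dom\<close>. Derivatives are
  classical, and eigenfunctions belong to this space, so the kernels of the forms taken here are the
  full eigenspaces.\<close>

definition func_space :: "(real \<Rightarrow> complex ^ 'n) set" where
  "func_space = {x. (\<forall>t. t \<notin> {0..T} \<longrightarrow> x t = 0) \<and> x differentiable_on {0..T} \<and>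
     continuous_on {0..T} (deriv_on T x)}"

abbreviation dd :: "(real \<Rightarrow> complex ^ 'n) \<Rightarrow> real \<Rightarrow> complex ^ 'n" where
  "dd \<equiv> deriv_on T"

abbreviation qd :: "(real \<Rightarrow> complex ^ 'n) \<Rightarrow> real \<Rightarrow> complex ^ 'n" where
  "qd \<equiv> quasi_deriv P Q T"

text \<open>With this lower-order part the operator reads -(\<open>qd x\<close>)' +
  \<open>low x\<close>.\<close>

definition low :: "(real \<Rightarrow> complex ^ 'n) \<Rightarrow> real \<Rightarrow> complex ^ 'n" where
  "low x t = cmat (transpose (Q t)) *v dd x t + cmat (R t) *v x t"

lemma deriv_on_eq:
  assumes "(x has_vector_derivative x') (at t within {0..T})" "t \<in> {0..T}"
  shows "deriv_on T x t = (x' :: complex ^ 'n)"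
  unfolding deriv_on_def using vector_derivative_within_closed_interval[OF T_pos assms(2,1)] .

lemma func_spaceI:
  assumes "\<And>t. t \<notin> {0..T} \<Longrightarrow> x t = 0"
    and "\<And>t. t \<in> {0..T} \<Longrightarrow> (x has_vector_derivative x' t) (at t within {0..T})"
    and "continuous_on {0..T} x'"
  shows "x \<in> func_space"
proof -
  have "continuous_on {0..T} (dd x)"
    by (rule continuous_on_eq[OF assms(3)]) (use assms(2) deriv_on_eq in metis)
  moreover have "x differentiable_on {0..T}"
    using assms(2) unfolding differentiable_on_def has_vector_derivative_def differentiable_def by blast
  ultimately show ?thesis using assms(1) by (auto simp: func_space_def)
qed

lemma func_space_deriv:
  assumes "x \<in> func_space" "t \<in> {0..T}"
  shows "(x has_vector_derivative dd x t) (at t within {0..T})"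
  using assms unfolding func_space_def differentiable_on_def deriv_on_def
  by (simp add: vector_derivative_works)

lemma func_space_cont:
  assumes "x \<in> func_space"
  shows "continuous_on {0..T} x" "continuous_on {0..T} (dd x)" "continuous_on {0..T} (qd x)"
    "continuous_on {0..T} (low x)"
proof -
  show x: "continuous_on {0..T} x"
    using assms differentiable_imp_continuous_on by (auto simp: func_space_def)
  show d: "continuous_on {0..T} (dd x)" using assms by (simp add: func_space_def)
  show "continuous_on {0..T} (qd x)"
    unfolding quasi_deriv_def by (intro continuous_intros x d cont_P cont_Q)
  show "continuous_on {0..T} (low x)"
    unfolding low_def by (intro continuous_intros x d cont_R cont_Q)
qed

lemma func_space_zero: "x \<in> func_space \<Longrightarrow> t \<notin> {0..T} \<Longrightarrow> x t = 0"
  by (simp add: func_space_def)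

lemma deriv_on_add: "x \<in> func_space \<Longrightarrow> y \<in> func_space \<Longrightarrow> t \<in> {0..T} \<Longrightarrow> dd (x + y) t = dd x t + dd y t"
  unfolding plus_fun_def by (intro deriv_on_eq has_vector_derivative_add func_space_deriv)

lemma deriv_on_scale: "x \<in> func_space \<Longrightarrow> t \<in> {0..T} \<Longrightarrow> dd (scale_fun c x) t = c *s dd x t"
  unfolding scale_fun_def
  by (intro deriv_on_eq bounded_linear.has_vector_derivative[OF bounded_linear_vec_scale] func_space_deriv)

lemma func_space_subspace: "cfun.subspace func_space"
proof (rule cfun.subspaceI)
  show "0 \<in> func_space"
    by (rule func_spaceI[where x' = "\<lambda>_. 0"]) (auto simp: zero_fun_def)
  show "x + y \<in> func_space" if "x \<in> func_space" "y \<in> func_space" for x y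
  proof (rule func_spaceI[where x' = "\<lambda>t. dd x t + dd y t"])
    show "continuous_on {0..T} (\<lambda>t. dd x t + dd y t)"
      by (rule continuous_on_add[OF func_space_cont(2)[OF that(1)] func_space_cont(2)[OF that(2)]])
    show "(x + y has_vector_derivative dd x t + dd y t) (at t within {0..T})" if "t \<in> {0..T}" for t
      unfolding plus_fun_def by (intro has_vector_derivative_add func_space_deriv) fact+
  qed (simp add: func_space_zero that)
  show "scale_fun c x \<in> func_space" if "x \<in> func_space" for c x
  proof (rule func_spaceI[where x' = "\<lambda>t. c *s dd x t"])
    show "(scale_fun c x has_vector_derivative c *s dd x t) (at t within {0..T})" if "t \<in> {0..T}" for t
      unfolding scale_fun_def
      by (rule bounded_linear.has_vector_derivative[OF bounded_linear_vec_scale func_space_deriv]) fact+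
    show "continuous_on {0..T} (\<lambda>t. c *s dd x t)"
      by (rule bounded_linear.continuous_on[OF bounded_linear_vec_scale func_space_cont(2)]) fact
  qed (simp add: scale_fun_def func_space_zero that)
qed

lemma scale_fun_apply: "scale_fun c x t = c *s x t"
  by (simp add: scale_fun_def)

lemma qd_add: "x \<in> func_space \<Longrightarrow> y \<in> func_space \<Longrightarrow> t \<in> {0..T} \<Longrightarrow> qd (x + y) t = qd x t + qd y t"
  by (simp add: quasi_deriv_def deriv_on_add cmat_mult_add)

lemma qd_scale: "x \<in> func_space \<Longrightarrow> t \<in> {0..T} \<Longrightarrow> qd (scale_fun c x) t = c *s qd x t"
  by (simp add: quasi_deriv_def deriv_on_scale scale_fun_apply cmat_mult_scale vector_add_ldistrib)

lemma low_add: "x \<in> func_space \<Longrightarrow> y \<in> func_space \<Longrightarrow> t \<in> {0..T} \<Longrightarrow> low (x + y) t = low x t + low y t"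
  by (simp add: low_def deriv_on_add cmat_mult_add)

lemma low_scale: "x \<in> func_space \<Longrightarrow> t \<in> {0..T} \<Longrightarrow> low (scale_fun c x) t = c *s low x t"
  by (simp add: low_def deriv_on_scale scale_fun_apply cmat_mult_scale vector_add_ldistrib)

text \<open>The pairing of the operator applied to x with w, integrated by parts and with the
  boundary terms dropped.\<close>

definition energy :: "(real \<Rightarrow> complex ^ 'n) \<Rightarrow> (real \<Rightarrow> complex ^ 'n) \<Rightarrow> complex" where
  "energy x w = integral {0..T} (\<lambda>t. hermitian (qd x t) (dd w t) + hermitian (low x t) (w t))"

definition l2 :: "(real \<Rightarrow> complex ^ 'n) \<Rightarrow> (real \<Rightarrow> complex ^ 'n) \<Rightarrow> complex" where
  "l2 x w = integral {0..T} (\<lambda>t. hermitian (x t) (w t))"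

definition bd :: "(real \<Rightarrow> complex ^ 'n) \<Rightarrow> complex ^ ('n + 'n)" where
  "bd x = join (x 0) (x T)"

lemma bd_add: "bd (x + y) = bd x + bd y"
  by (simp add: bd_def join_add)

lemma bd_scale: "bd (scale_fun c x) = c *s bd x"
  by (simp add: bd_def scale_fun_def join_scale)

lemma integrable_energy:
  "x \<in> func_space \<Longrightarrow> w \<in> func_space \<Longrightarrow>
    (\<lambda>t. hermitian (qd x t) (dd w t) + hermitian (low x t) (w t)) integrable_on {0..T}"
  by (intro integrable_continuous_interval continuous_intros func_space_cont)

lemma integrable_l2: "x \<in> func_space \<Longrightarrow> w \<in> func_space \<Longrightarrow> (\<lambda>t. hermitian (x t) (w t)) integrable_on {0..T}"
  by (intro integrable_continuous_interval continuous_intros func_space_cont)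

text \<open>The terms with \<open>P\<close> and \<open>R\<close> are symmetric by hypothesis; the
  one with \<open>Q\<close> and the one with its transpose exchange under conjugation.\<close>

lemma hform_energy: "cvs.hform func_space energy"
proof (rule cvs.hformI[OF func_space_subspace])
  fix x y z assume m: "x \<in> func_space" "y \<in> func_space" "z \<in> func_space"
  have "energy (x + y) z = integral {0..T} (\<lambda>t. (hermitian (qd x t) (dd z t) + hermitian (low x t) (z t)) +
      (hermitian (qd y t) (dd z t) + hermitian (low y t) (z t)))"
    unfolding energy_def by (rule integral_cong) (simp add: m qd_add low_add hermitian_add_left)
  then show "energy (x + y) z = energy x z + energy y z"
    unfolding energy_def
    using Henstock_Kurzweil_Integration.integral_add[OF integrable_energy[OF m(1,3)] integrable_energy[OF m(2,3)]] by simp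
next
  fix c x y assume m: "x \<in> func_space" "y \<in> func_space"
  have "energy (scale_fun c x) y = integral {0..T} (\<lambda>t. c * (hermitian (qd x t) (dd y t) + hermitian (low x t) (y t)))"
    unfolding energy_def by (rule integral_cong) (simp add: m qd_scale low_scale hermitian_scale_left distrib_left)
  then show "energy (scale_fun c x) y = c * energy x y" by (simp add: energy_def)
next
  fix x w assume m: "x \<in> func_space" "w \<in> func_space"
  have "cnj (energy x w) = integral {0..T} (\<lambda>t. cnj (hermitian (qd x t) (dd w t) + hermitian (low x t) (w t)))"
    unfolding energy_def by (rule integral_cnj)
  also have "\<dots> = integral {0..T} (\<lambda>t. hermitian (qd w t) (dd x t) + hermitian (low w t) (x t))"
  proof (rule integral_cong)
    fix t assume t: "t \<in> {0..T}"
    have "hermitian (cmat (P t) *v dd w t) (dd x t) = cnj (hermitian (cmat (P t) *v dd x t) (dd w t))"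
      using sym_P[OF t] hermitian_adjoint[of "P t" "dd w t" "dd x t"] by (simp add: hermitian_cnj[of "dd w t"])
    moreover have "hermitian (cmat (R t) *v w t) (x t) = cnj (hermitian (cmat (R t) *v x t) (w t))"
      using sym_R[OF t] hermitian_adjoint[of "R t" "w t" "x t"] by (simp add: hermitian_cnj[of "w t"])
    moreover have "hermitian (cmat (Q t) *v w t) (dd x t) = cnj (hermitian (cmat (transpose (Q t)) *v dd x t) (w t))"
      using hermitian_adjoint[of "Q t" "w t" "dd x t"] by (simp add: hermitian_cnj[of "w t"])
    moreover have "hermitian (cmat (transpose (Q t)) *v dd w t) (x t) = cnj (hermitian (cmat (Q t) *v x t) (dd w t))"
      using hermitian_adjoint[of "transpose (Q t)" "dd w t" "x t"] by (simp add: hermitian_cnj[of "dd w t"])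
    ultimately show "cnj (hermitian (qd x t) (dd w t) + hermitian (low x t) (w t)) =
        hermitian (qd w t) (dd x t) + hermitian (low w t) (x t)"
      by (simp add: quasi_deriv_def low_def hermitian_add_left)
  qed
  finally show "energy w x = cnj (energy x w)" by (simp add: energy_def)
qed

lemma hform_l2: "cvs.hform func_space l2"
proof (rule cvs.hformI[OF func_space_subspace])
  fix x y z assume m: "x \<in> func_space" "y \<in> func_space" "z \<in> func_space"
  show "l2 (x + y) z = l2 x z + l2 y z"
    unfolding l2_def
    using Henstock_Kurzweil_Integration.integral_add[OF integrable_l2[OF m(1,3)] integrable_l2[OF m(2,3)]]
    by (simp add: hermitian_add_left)
next
  fix c x y
  show "l2 (scale_fun c x) y = c * l2 x y" by (simp add: l2_def scale_fun_def hermitian_scale_left)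
next
  fix x w
  have "cnj (l2 x w) = integral {0..T} (\<lambda>t. cnj (hermitian (x t) (w t)))"
    unfolding l2_def by (rule integral_cnj)
  then show "l2 w x = cnj (l2 x w)" by (simp add: l2_def hermitian_cnj[of "w _"])
qed

lemma hform_bd:
  assumes "vcs.hform UNIV S"
  shows "cvs.hform func_space (\<lambda>x w. S (bd x) (bd w))"
proof (rule cvs.hformI[OF func_space_subspace])
  show "S (bd (x + y)) (bd z) = S (bd x) (bd z) + S (bd y) (bd z)" for x y z
    by (simp add: bd_add vcs.hform_add_left[OF assms])
  show "S (bd (scale_fun c x)) (bd y) = c * S (bd x) (bd y)" for c x y
    by (simp add: bd_scale vcs.hform_scale_left[OF assms])
  show "S (bd y) (bd x) = cnj (S (bd x) (bd y))" for x y
    by (rule vcs.hform_cnj[OF assms]) auto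
qed

definition dnorm2 :: "(real \<Rightarrow> complex ^ 'n) \<Rightarrow> real" where
  "dnorm2 x = integral {0..T} (\<lambda>t. (norm (dd x t))\<^sup>2)"

lemma Re_l2: "x \<in> func_space \<Longrightarrow> Re (l2 x x) = integral {0..T} (\<lambda>t. (norm (x t))\<^sup>2)"
  unfolding l2_def using integral_linear[OF integrable_l2 bounded_linear_Re, of x x]
  by (simp add: o_def hermitian_self)

lemma integrable_norm2:
  "x \<in> func_space \<Longrightarrow> (\<lambda>t. (norm (x t))\<^sup>2) integrable_on {0..T}"
  "x \<in> func_space \<Longrightarrow> (\<lambda>t. (norm (dd x t))\<^sup>2) integrable_on {0..T}"
  by (intro integrable_continuous_interval continuous_intros func_space_cont; assumption)+

lemma l2_pos:
  assumes x: "x \<in> func_space" and nz: "x \<noteq> 0"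
  shows "Re (l2 x x) > 0"
proof (rule ccontr)
  assume "\<not> ?thesis"
  moreover have "integral {0..T} (\<lambda>t. (norm (x t))\<^sup>2) \<ge> 0"
    by (rule Henstock_Kurzweil_Integration.integral_nonneg[OF integrable_norm2(1)[OF x]]) simp
  ultimately have z: "integral {0..T} (\<lambda>t. (norm (x t))\<^sup>2) = 0" using Re_l2[OF x] by simp
  have "x t = 0" for t
  proof (cases "t \<in> {0..T}")
    case True
    have "(norm (x t))\<^sup>2 = 0"
    proof (rule has_integral_0_cbox_imp_0[of 0 T "\<lambda>t. (norm (x t))\<^sup>2"])
      show "continuous_on (cbox 0 T) (\<lambda>t. (norm (x t))\<^sup>2)"
        unfolding box_real by (intro continuous_intros func_space_cont x)
      show "((\<lambda>t. (norm (x t))\<^sup>2) has_integral 0) (cbox 0 T)"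
        using integrable_integral[OF integrable_norm2(1)[OF x]] z by simp
    qed (use True T_pos in auto)
    then show ?thesis by simp
  qed (use func_space_zero[OF x] in auto)
  then show False using nz by (auto simp: zero_fun_def)
qed

text \<open>Garding's inequality: half of the ellipticity of \<open>P\<close> absorbs the mixed
  terms with \<open>Q\<close>, the rest is of order zero.\<close>

lemma energy_lower:
  "\<exists>p>0. \<exists>C. \<forall>x\<in>func_space. p * dnorm2 x - C * Re (l2 x x) \<le> Re (energy x x)"
proof -
  obtain p where p: "p > 0" "\<And>t v. t \<in> {0..T} \<Longrightarrow> p * (norm v)\<^sup>2 \<le> (v :: complex ^ 'n) \<bullet> (cmat (P t) *v v)"
    using P_coercive_complex by blast
  obtain q where q: "q > 0" "\<And>t v. t \<in> {0..T} \<Longrightarrow> norm (cmat (Q t) *v (v :: complex ^ 'n)) \<le> q * norm v"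
    using matrix_bound[OF cont_Q] by blast
  obtain r where r: "r > 0" "\<And>t v. t \<in> {0..T} \<Longrightarrow> norm (cmat (R t) *v (v :: complex ^ 'n)) \<le> r * norm v"
    using matrix_bound[OF cont_R] by blast
  define C where "C = 2 * q\<^sup>2 / p + r"
  have "p / 2 * dnorm2 x - C * Re (l2 x x) \<le> Re (energy x x)" if x: "x \<in> func_space" for x
  proof -
    have "p / 2 * dnorm2 x - C * Re (l2 x x) = integral {0..T} (\<lambda>t. p / 2 * (norm (dd x t))\<^sup>2 - C * (norm (x t))\<^sup>2)"
      unfolding dnorm2_def Re_l2[OF x]
      using Henstock_Kurzweil_Integration.integral_diff[OF integrable_on_mult_right[OF integrable_norm2(2)[OF x], of "p / 2"]
          integrable_on_mult_right[OF integrable_norm2(1)[OF x], of C]]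
      by (simp only: integral_mult_right)
    also have "\<dots> \<le> integral {0..T} (\<lambda>t. Re (hermitian (qd x t) (dd x t) + hermitian (low x t) (x t)))"
    proof (rule integral_le)
      show "(\<lambda>t. p / 2 * (norm (dd x t))\<^sup>2 - C * (norm (x t))\<^sup>2) integrable_on {0..T}"
        by (intro integrable_diff integrable_on_mult_right integrable_norm2 x)
      show "(\<lambda>t. Re (hermitian (qd x t) (dd x t) + hermitian (low x t) (x t))) integrable_on {0..T}"
        using integrable_linear[OF integrable_energy[OF x x] bounded_linear_Re] by (simp add: o_def)
      fix t assume t: "t \<in> {0..T}"
      let ?u = "norm (x t)" and ?v = "norm (dd x t)"
      have a1: "p * ?v\<^sup>2 \<le> dd x t \<bullet> (cmat (P t) *v dd x t)" by (rule p(2)[OF t])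
      have "\<bar>dd x t \<bullet> (cmat (Q t) *v x t)\<bar> \<le> ?v * norm (cmat (Q t) *v x t)" by (rule Cauchy_Schwarz_ineq2)
      also have "\<dots> \<le> ?v * (q * ?u)" using q(2)[OF t] by (intro mult_left_mono) auto
      finally have a2: "\<bar>dd x t \<bullet> (cmat (Q t) *v x t)\<bar> \<le> q * (?u * ?v)" by (simp add: mult_ac)
      have "\<bar>x t \<bullet> (cmat (R t) *v x t)\<bar> \<le> ?u * norm (cmat (R t) *v x t)" by (rule Cauchy_Schwarz_ineq2)
      also have "\<dots> \<le> ?u * (r * ?u)" using r(2)[OF t] by (intro mult_left_mono) auto
      finally have a3: "\<bar>x t \<bullet> (cmat (R t) *v x t)\<bar> \<le> r * ?u\<^sup>2" by (simp add: power2_eq_square mult_ac)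
      \<comment> \<open>Completing the square is Young's inequality for the mixed term and yields
        the summand 2 q^2 / p of \<open>C\<close>.\<close>
      have "0 \<le> p / 2 * (?v - 2 * q / p * ?u)\<^sup>2" using p(1) by simp
      also have "\<dots> = p / 2 * ?v\<^sup>2 - 2 * q * (?u * ?v) + 2 * q\<^sup>2 / p * ?u\<^sup>2"
        using p(1) by (simp add: power2_eq_square field_simps)
      finally have a4: "2 * q * (?u * ?v) \<le> p / 2 * ?v\<^sup>2 + 2 * q\<^sup>2 / p * ?u\<^sup>2" by simp
      have "Re (hermitian (cmat (transpose (Q t)) *v dd x t) (x t)) = dd x t \<bullet> (cmat (Q t) *v x t)"
        using hermitian_adjoint[of "transpose (Q t)" "dd x t" "x t"] by (simp add: Re_hermitian)
      then have "Re (hermitian (qd x t) (dd x t) + hermitian (low x t) (x t)) =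
          dd x t \<bullet> (cmat (P t) *v dd x t) + 2 * (dd x t \<bullet> (cmat (Q t) *v x t)) + x t \<bullet> (cmat (R t) *v x t)"
        by (simp add: quasi_deriv_def low_def hermitian_add_left Re_hermitian inner_commute)
      moreover have "C * ?u\<^sup>2 = 2 * q\<^sup>2 / p * ?u\<^sup>2 + r * ?u\<^sup>2" by (simp add: C_def distrib_right)
      ultimately show "p / 2 * ?v\<^sup>2 - C * ?u\<^sup>2 \<le> Re (hermitian (qd x t) (dd x t) + hermitian (low x t) (x t))"
        using a1 a2 a3 a4 by (simp add: abs_le_iff)
    qed
    also have "\<dots> = Re (energy x x)"
      unfolding energy_def using integral_linear[OF integrable_energy[OF x x] bounded_linear_Re] by (simp add: o_def)
    finally show ?thesis .
  qed
  then show ?thesis using p(1) by (intro exI[of _ "p / 2"] conjI exI[of _ C]) auto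
qed

text \<open>Boundary values cost an arbitrarily small amount of the derivative norm. This is what
  lets any boundary form \<open>S\<close> be absorbed into the energy.\<close>

lemma trace_bound:
  assumes x: "x \<in> func_space" and e: "\<eta> > 0"
  shows "(norm (bd x))\<^sup>2 \<le> \<eta> * dnorm2 x + (2 / T + 1 / \<eta>) * Re (l2 x x)"
proof -
  \<comment> \<open>The affine weight is -1 at 0 and 1 at T, so the increment of this function is
    the sum of both squared boundary values.\<close>
  let ?f = "\<lambda>t. (2 * t / T - 1) * (x t \<bullet> x t)"
  let ?g = "\<lambda>t. 2 / T * (norm (x t))\<^sup>2 + (2 * t / T - 1) * (2 * (x t \<bullet> dd x t))"
  have "(?g has_integral ?f T - ?f 0) {0..T}"
  proof (rule fundamental_theorem_of_calculus)
    fix t assume t: "t \<in> {0..T}"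
    have "((\<lambda>t. x t \<bullet> x t) has_vector_derivative (x t \<bullet> dd x t + dd x t \<bullet> x t)) (at t within {0..T})"
      by (rule bounded_bilinear.has_vector_derivative[OF bounded_bilinear_inner func_space_deriv[OF x t] func_space_deriv[OF x t]])
    then have "((\<lambda>t. x t \<bullet> x t) has_vector_derivative (2 * (x t \<bullet> dd x t))) (at t within {0..T})"
      by (simp only: inner_commute[of "dd x t"] mult_2)
    then have "((\<lambda>t. x t \<bullet> x t) has_real_derivative (2 * (x t \<bullet> dd x t))) (at t within {0..T})"
      by (simp only: has_real_derivative_iff_has_vector_derivative)
    moreover have "((\<lambda>t. 2 * t / T - 1) has_real_derivative 2 / T) (at t within {0..T})"
      using T_pos by (auto intro!: derivative_eq_intros)
    ultimately have "(?f has_real_derivative 2 / T * (x t \<bullet> x t) + 2 * (x t \<bullet> dd x t) * (2 * t / T - 1)) (at t within {0..T})"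
      by (intro DERIV_mult)
    then have "(?f has_real_derivative ?g t) (at t within {0..T})"
      by (simp only: dot_square_norm mult.commute[of "2 * (x t \<bullet> dd x t)"])
    then show "(?f has_vector_derivative ?g t) (at t within {0..T})"
      by (simp add: has_real_derivative_iff_has_vector_derivative)
  qed (use T_pos in auto)
  moreover have "(norm (bd x))\<^sup>2 = ?f T - ?f 0"
  proof -
    have "complex_of_real ((norm (bd x))\<^sup>2) = complex_of_real ((norm (x 0))\<^sup>2 + (norm (x T))\<^sup>2)"
      unfolding hermitian_self[symmetric] bd_def hermitian_join by (simp add: hermitian_self)
    then show ?thesis using T_pos by (simp add: dot_square_norm del: of_real_add of_real_power)
  qed
  ultimately have i: "(?g has_integral (norm (bd x))\<^sup>2) {0..T}" by simp
  have "(norm (bd x))\<^sup>2 = integral {0..T} ?g" using integral_unique[OF i] by simp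
  also have "\<dots> \<le> integral {0..T} (\<lambda>t. \<eta> * (norm (dd x t))\<^sup>2 + (2 / T + 1 / \<eta>) * (norm (x t))\<^sup>2)"
  proof (rule integral_le)
    show "?g integrable_on {0..T}" using i by blast
    show "(\<lambda>t. \<eta> * (norm (dd x t))\<^sup>2 + (2 / T + 1 / \<eta>) * (norm (x t))\<^sup>2) integrable_on {0..T}"
      by (intro integrable_add integrable_on_mult_right integrable_norm2 x)
    fix t assume t: "t \<in> {0..T}"
    let ?u = "norm (x t)" and ?v = "norm (dd x t)"
    have "\<bar>2 * t / T - 1\<bar> \<le> 1" using t T_pos by (auto simp: abs_le_iff field_simps)
    then have "\<bar>(2 * t / T - 1) * (x t \<bullet> dd x t)\<bar> \<le> 1 * \<bar>x t \<bullet> dd x t\<bar>"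
      unfolding abs_mult by (intro mult_right_mono) auto
    also have "\<dots> \<le> ?u * ?v" using Cauchy_Schwarz_ineq2 by simp
    finally have "(2 * t / T - 1) * (2 * (x t \<bullet> dd x t)) \<le> 2 * (?u * ?v)" by (simp add: abs_le_iff)
    moreover have "0 \<le> \<eta> * (?v - 1 / \<eta> * ?u)\<^sup>2" using e by simp
    moreover have "\<eta> * (?v - 1 / \<eta> * ?u)\<^sup>2 = \<eta> * ?v\<^sup>2 - 2 * (?u * ?v) + 1 / \<eta> * ?u\<^sup>2"
      using e by (simp add: power2_eq_square field_simps)
    ultimately show "?g t \<le> \<eta> * ?v\<^sup>2 + (2 / T + 1 / \<eta>) * ?u\<^sup>2" by (simp add: distrib_right)
  qed
  also have "\<dots> = \<eta> * dnorm2 x + (2 / T + 1 / \<eta>) * Re (l2 x x)"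
    unfolding dnorm2_def Re_l2[OF x]
    by (simp add: Henstock_Kurzweil_Integration.integral_add integrable_norm2[OF x] integrable_on_mult_right)
  finally show ?thesis .
qed

end

section \<open>Coercivity and the inhomogeneous equation\<close>

context complex_vector_space begin

lemma independent_card_eq_spans:
  assumes "finite B" "independent A" "A \<subseteq> span B" "card A = card B"
  shows "span B \<subseteq> span A"
proof -
  have fA: "finite A" using independent_span_bound[OF assms(1-3)] by blast
  have "x \<in> span A" if "x \<in> B" for x
  proof (rule ccontr)
    assume n: "x \<notin> span A"
    then have "independent (insert x A)" using assms(2) by (rule independent_insertI)
    moreover have "insert x A \<subseteq> span B" using assms(3) that span_base by blast
    ultimately have "card (insert x A) \<le> card B" using independent_span_bound[OF assms(1)] by blast
    moreover have "x \<notin> A" using n span_base by blast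
    ultimately show False using fA assms(4) by simp
  qed
  then show ?thesis by (intro span_minimal) auto
qed

end

context sturm_liouville begin

text \<open>Vanishing moments against these bumps replace nodal conditions \<open>x t\<^sub>k = 0\<close>: they imply the same
  Poincare inequality, but their Lagrange multipliers are continuous, so that the orthogonal
  complement of the constrained functions consists of \<open>C\<^sup>1\<close> functions.\<close>

definition bump :: "nat \<Rightarrow> nat \<Rightarrow> real \<Rightarrow> real" where
  "bump N k t = max 0 ((t - real k * (T / real N)) * (real (Suc k) * (T / real N) - t))"

definition moment :: "nat \<Rightarrow> nat \<Rightarrow> (real \<Rightarrow> complex ^ 'n) \<Rightarrow> complex ^ 'n" where
  "moment N k x = integral {0..T} (\<lambda>t. bump N k t *\<^sub>R x t)"

section \<open>Bumps, moments and the Poincare inequality\<close>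

lemma bump_cont [continuous_intros]: "continuous_on S (bump N k)"
  unfolding bump_def by (intro continuous_intros)

lemma bump_nonneg: "bump N k t \<ge> 0"
  by (simp add: bump_def)

lemma bump_outside:
  assumes "N > 0" "t \<notin> {real k * (T / real N)..real (Suc k) * (T / real N)}"
  shows "bump N k t = 0"
proof -
  have "real k * (T / real N) \<le> real (Suc k) * (T / real N)"
    using T_pos by (intro mult_right_mono) auto
  then have "(t - real k * (T / real N)) * (real (Suc k) * (T / real N) - t) \<le> 0"
    using assms(2) by (auto simp: mult_le_0_iff)
  then show ?thesis by (simp add: bump_def)
qed

lemma bump_mid:
  assumes "N > 0"
  shows "bump N k ((real k + 1 / 2) * (T / real N)) > 0"
proof -
  have "((real k + 1 / 2) * (T / real N) - real k * (T / real N)) *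
      (real (Suc k) * (T / real N) - (real k + 1 / 2) * (T / real N)) = (T / real N / 2)\<^sup>2"
    by (simp add: algebra_simps power2_eq_square add_divide_distrib)
  moreover have "(T / real N / 2)\<^sup>2 > 0" using T_pos assms by simp
  ultimately show ?thesis unfolding bump_def by simp
qed

lemma piece_subset:
  assumes "N > 0" "k < N"
  shows "0 \<le> real k * (T / real N)" "real k * (T / real N) < real (Suc k) * (T / real N)"
    "real (Suc k) * (T / real N) \<le> T"
proof -
  show "0 \<le> real k * (T / real N)" using T_pos by simp
  show "real k * (T / real N) < real (Suc k) * (T / real N)"
    using T_pos assms by (intro mult_strict_right_mono) auto
  have "real (Suc k) * (T / real N) \<le> real N * (T / real N)"
    using T_pos assms by (intro mult_right_mono) auto
  then show "real (Suc k) * (T / real N) \<le> T" using assms by simp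
qed

text \<open>Each cell midpoint sees only its own bump, so evaluation there recovers the coefficients
  of a combination of bumps.\<close>

lemma bump_mid_other:
  assumes "N > 0" "l \<noteq> k"
  shows "bump N l ((real k + 1 / 2) * (T / real N)) = 0"
proof (rule bump_outside[OF assms(1)])
  have d: "T / real N > 0" using T_pos assms by simp
  show "(real k + 1 / 2) * (T / real N) \<notin> {real l * (T / real N)..real (Suc l) * (T / real N)}"
  proof
    assume "(real k + 1 / 2) * (T / real N) \<in> {real l * (T / real N)..real (Suc l) * (T / real N)}"
    then have "real l * (T / real N) \<le> (real k + 1 / 2) * (T / real N)"
      "(real k + 1 / 2) * (T / real N) \<le> real (Suc l) * (T / real N)" by auto
    then have "real l \<le> real k + 1 / 2" "real k + 1 / 2 \<le> real (Suc l)"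
      using d mult_le_cancel_right_pos by blast+
    then show False using assms(2) by linarith
  qed
qed

lemma integrable_bump: "x \<in> func_space \<Longrightarrow> (\<lambda>t. bump N k t *\<^sub>R x t) integrable_on {0..T}"
  by (intro integrable_continuous_interval continuous_intros func_space_cont)

lemma moment_add:
  assumes "x \<in> func_space" "y \<in> func_space"
  shows "moment N k (x + y) = moment N k x + moment N k y"
  unfolding moment_def
  using Henstock_Kurzweil_Integration.integral_add[OF integrable_bump[OF assms(1)] integrable_bump[OF assms(2)]]
  by (simp add: scaleR_right_distrib)

lemma moment_scale:
  assumes "x \<in> func_space"
  shows "moment N k (scale_fun c x) = c *s moment N k x"
proof -
  have e: "c *s (bump N k t *\<^sub>R x t) = bump N k t *\<^sub>R scale_fun c x t" for t
    by (simp add: scale_fun_apply scaleR_eq_scale)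
  have "integral {0..T} ((*s) c \<circ> (\<lambda>t. bump N k t *\<^sub>R x t)) = c *s moment N k x"
    unfolding moment_def by (rule integral_linear[OF integrable_bump[OF assms] bounded_linear_vec_scale])
  then show ?thesis by (simp add: o_def e moment_def)
qed

lemma func_space_increment:
  assumes x: "x \<in> func_space" and st: "0 \<le> s" "s \<le> t" "t \<le> T"
  shows "x t - x s = integral {s..t} (dd x)"
proof -
  have "(dd x has_integral (x t - x s)) {s..t}"
  proof (rule fundamental_theorem_of_calculus)
    fix r assume "r \<in> {s..t}"
    then show "(x has_vector_derivative dd x r) (at r within {s..t})"
      using st by (intro has_vector_derivative_within_subset[OF func_space_deriv[OF x]]) auto
  qed (use st in auto)
  then show ?thesis by (simp add: integral_unique)
qed

text \<open>Because the weighted mean of x vanishes, x(t) is the weighted mean of x(t) - x(s), which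
  is bounded by \<open>M\<close>, the integral of |x'|. Cauchy-Schwarz then bounds M^2.\<close>

lemma piece_bound:
  assumes x: "x \<in> func_space" and cd: "0 \<le> c" "c < d" "d \<le> T" and t: "t \<in> {c..d}"
    and \<phi>: "continuous_on UNIV \<phi>" "\<And>s. \<phi> s \<ge> 0" "s0 \<in> {c..d}" "\<phi> s0 > (0::real)"
    and z: "integral {c..d} (\<lambda>s. \<phi> s *\<^sub>R x s) = 0"
  shows "(norm (x t))\<^sup>2 \<le> (d - c) * integral {c..d} (\<lambda>s. (norm (dd x s))\<^sup>2)"
proof -
  have sub: "{c..d} \<subseteq> {0..T}" using cd by auto
  note cx = continuous_on_subset[OF func_space_cont(1)[OF x] sub]
  note cdx = continuous_on_subset[OF func_space_cont(2)[OF x] sub]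
  have c\<phi>: "continuous_on {c..d} \<phi>" by (rule continuous_on_subset[OF \<phi>(1)]) simp
  define M where "M = integral {c..d} (\<lambda>s. norm (dd x s))"
  have iM: "(\<lambda>s. norm (dd x s)) integrable_on {c..d}"
    by (intro integrable_continuous_interval continuous_intros cdx)
  have osc0: "norm (x b - x a) \<le> M" if "c \<le> a" "a \<le> b" "b \<le> d" for a b
  proof -
    have sub2: "{a..b} \<subseteq> {c..d}" using that by auto
    have "norm (x b - x a) = norm (integral {a..b} (dd x))"
      using func_space_increment[OF x, of a b] that cd by simp
    also have "\<dots> \<le> integral {a..b} (\<lambda>s. norm (dd x s))"
      by (intro Henstock_Kurzweil_Integration.integral_norm_bound_integral integrable_continuous_interval
          continuous_intros continuous_on_subset[OF cdx sub2]) auto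
    also have "\<dots> \<le> M"
      unfolding M_def by (intro integral_subset_le sub2 iM integrable_continuous_interval
          continuous_intros continuous_on_subset[OF cdx sub2]) auto
    finally show ?thesis .
  qed
  have osc: "norm (x t - x s) \<le> M" if "s \<in> {c..d}" for s
    using osc0[of s t] osc0[of t s] that t by (cases "s \<le> t") (auto simp: norm_minus_commute)
  define m where "m = integral {c..d} \<phi>"
  have i\<phi>: "\<phi> integrable_on {c..d}" by (intro integrable_continuous_interval c\<phi>)
  have "m \<ge> 0" unfolding m_def by (intro Henstock_Kurzweil_Integration.integral_nonneg i\<phi> \<phi>)
  moreover have "m \<noteq> 0"
  proof
    assume "m = 0"
    then have "(\<phi> has_integral 0) (cbox c d)" using i\<phi> by (simp add: m_def has_integral_integrable_integral)
    then have "\<phi> s0 = 0"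
      using \<phi> cd c\<phi> by (intro has_integral_0_cbox_imp_0[of c d \<phi>]) auto
    then show False using \<phi>(4) by simp
  qed
  ultimately have m: "m > 0" by simp
  have ip: "(\<lambda>s. \<phi> s *\<^sub>R x s) integrable_on {c..d}" "(\<lambda>s. \<phi> s *\<^sub>R x t) integrable_on {c..d}"
    by (intro integrable_continuous_interval continuous_intros cx c\<phi>)+
  have "m *\<^sub>R x t = integral {c..d} (\<lambda>s. \<phi> s *\<^sub>R x t)"
    unfolding m_def using integral_linear[OF i\<phi> bounded_linear_scaleR_left, of "x t"] by (simp add: o_def)
  also have "\<dots> = integral {c..d} (\<lambda>s. \<phi> s *\<^sub>R (x t - x s))"
    unfolding scaleR_right_diff_distrib using z by (simp add: Henstock_Kurzweil_Integration.integral_diff[OF ip(2,1)])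
  finally have "norm (m *\<^sub>R x t) = norm (integral {c..d} (\<lambda>s. \<phi> s *\<^sub>R (x t - x s)))" by simp
  also have "\<dots> \<le> integral {c..d} (\<lambda>s. \<phi> s * M)"
  proof (rule Henstock_Kurzweil_Integration.integral_norm_bound_integral)
    show "(\<lambda>s. \<phi> s *\<^sub>R (x t - x s)) integrable_on {c..d}"
      by (intro integrable_continuous_interval continuous_intros cx c\<phi>)
    show "(\<lambda>s. \<phi> s * M) integrable_on {c..d}"
      by (intro integrable_continuous_interval continuous_intros c\<phi>)
    show "norm (\<phi> s *\<^sub>R (x t - x s)) \<le> \<phi> s * M" if "s \<in> {c..d}" for s
      using osc[OF that] \<phi>(2)[of s] by (simp add: mult_left_mono)
  qed
  also have "\<dots> = m * M" by (simp add: m_def)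
  finally have xM: "norm (x t) \<le> M" using m by simp
  define e where "e = integral {c..d} (\<lambda>s. (norm (dd x s))\<^sup>2)"
  have ie: "(\<lambda>s. (norm (dd x s))\<^sup>2) integrable_on {c..d}"
    by (intro integrable_continuous_interval continuous_intros cdx)
  \<comment> \<open>Cauchy-Schwarz, obtained by integrating the squared deviation of |x'| from its
    mean M/(d-c).\<close>
  have "0 \<le> integral {c..d} (\<lambda>s. (norm (dd x s) - M / (d - c))\<^sup>2)"
    by (intro Henstock_Kurzweil_Integration.integral_nonneg integrable_continuous_interval continuous_intros cdx) auto
  also have "\<dots> = integral {c..d} (\<lambda>s. ((norm (dd x s))\<^sup>2 - 2 * (M / (d - c)) * norm (dd x s)) + (M / (d - c))\<^sup>2)"
    by (simp add: power2_diff algebra_simps)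
  also have "\<dots> = (e - 2 * (M / (d - c)) * M) + (M / (d - c))\<^sup>2 * (d - c)"
  proof -
    have i1: "(\<lambda>s. 2 * (M / (d - c)) * norm (dd x s)) integrable_on {c..d}"
      by (intro integrable_on_mult_right iM)
    have i2: "((\<lambda>s. (M / (d - c))\<^sup>2) has_integral (M / (d - c))\<^sup>2 * (d - c)) {c..d}"
      using has_integral_const_real[of "(M / (d - c))\<^sup>2" c d] cd by (simp add: mult.commute)
    have "integral {c..d} (\<lambda>s. (norm (dd x s))\<^sup>2 - 2 * (M / (d - c)) * norm (dd x s)) = e - 2 * (M / (d - c)) * M"
      unfolding e_def M_def Henstock_Kurzweil_Integration.integral_diff[OF ie i1, unfolded M_def] integral_mult_right ..
    then show ?thesis
      using Henstock_Kurzweil_Integration.integral_add[OF integrable_diff[OF ie i1] has_integral_integrable[OF i2]]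
        integral_unique[OF i2] by (simp only:)
  qed
  also have "\<dots> = e - M\<^sup>2 / (d - c)"
  proof -
    define g where "g = d - c"
    have "g > 0" using cd by (simp add: g_def)
    then show ?thesis unfolding g_def[symmetric] by (simp add: power2_eq_square field_simps)
  qed
  finally have "M\<^sup>2 \<le> (d - c) * e" using cd by (simp add: field_simps)
  moreover have "(norm (x t))\<^sup>2 \<le> M\<^sup>2" using xM by (intro power_mono) auto
  ultimately show ?thesis by (simp add: e_def)
qed

text \<open>Summed cell by cell: on a cell of length T/N the pointwise bound contributes one factor
  T/N and the integration another.\<close>

lemma poincare:
  assumes x: "x \<in> func_space" and N: "N > 0" and z: "\<And>k. k < N \<Longrightarrow> moment N k x = 0"
  shows "Re (l2 x x) \<le> (T / real N)\<^sup>2 * dnorm2 x"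
proof -
  define \<delta> where "\<delta> = T / real N"
  have d0: "\<delta> > 0" using T_pos N by (simp add: \<delta>_def)
  have ind: "integral {0..real k * \<delta>} (\<lambda>t. (norm (x t))\<^sup>2) \<le> \<delta>\<^sup>2 * integral {0..real k * \<delta>} (\<lambda>t. (norm (dd x t))\<^sup>2)"
    if "k \<le> N" for k
    using that
  proof (induction k)
    case (Suc k)
    let ?c = "real k * \<delta>" and ?d = "real (Suc k) * \<delta>"
    have kN: "k < N" using Suc by simp
    have cd: "0 \<le> ?c" "?c < ?d" "?d \<le> T"
      using piece_subset[OF N kN] unfolding \<delta>_def by auto
    have diff: "?d - ?c = \<delta>" by (simp add: algebra_simps)
    \<comment> \<open>The bump vanishes outside its cell, so the moment over [0,T] equals the
      integral over the cell.\<close>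
    have "((\<lambda>t. bump N k t *\<^sub>R x t) has_integral integral {?c..?d} (\<lambda>t. bump N k t *\<^sub>R x t)) {?c..?d}"
      by (rule integrable_integral[OF integrable_subinterval_real[OF integrable_bump[OF x]]]) (use cd in auto)
    then have "((\<lambda>t. bump N k t *\<^sub>R x t) has_integral integral {?c..?d} (\<lambda>t. bump N k t *\<^sub>R x t)) {0..T}"
      by (rule has_integral_on_superset) (use cd bump_outside[OF N] in \<open>auto simp: \<delta>_def\<close>)
    from integral_unique[OF this] have m0: "integral {?c..?d} (\<lambda>t. bump N k t *\<^sub>R x t) = 0"
      using z[OF kN] by (simp add: moment_def)
    define e where "e = integral {?c..?d} (\<lambda>t. (norm (dd x t))\<^sup>2)"
    have pw: "(norm (x t))\<^sup>2 \<le> \<delta> * e" if t: "t \<in> {?c..?d}" for t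
    proof -
      have "(norm (x t))\<^sup>2 \<le> (?d - ?c) * integral {?c..?d} (\<lambda>s. (norm (dd x s))\<^sup>2)"
      proof (rule piece_bound[OF x cd t bump_cont bump_nonneg _ bump_mid[OF N] m0])
        show "(real k + 1 / 2) * (T / real N) \<in> {?c..?d}"
          using d0 by (auto simp: \<delta>_def[symmetric] intro!: mult_right_mono)
      qed
      then show ?thesis by (simp only: diff e_def)
    qed
    have i: "(\<lambda>t. (norm (x t))\<^sup>2) integrable_on {0..?d}" "(\<lambda>t. (norm (dd x t))\<^sup>2) integrable_on {0..?d}"
      "(\<lambda>t. (norm (x t))\<^sup>2) integrable_on {?c..?d}"
      using cd by (auto intro: integrable_subinterval_real[OF integrable_norm2(1)[OF x]]
          integrable_subinterval_real[OF integrable_norm2(2)[OF x]])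
    have "integral {?c..?d} (\<lambda>t. (norm (x t))\<^sup>2) \<le> integral {?c..?d} (\<lambda>t. \<delta> * e)"
      using pw by (intro integral_le i) auto
    also have "\<dots> = (?d - ?c) * (\<delta> * e)" using cd by simp
    also have "\<dots> = \<delta>\<^sup>2 * e" by (simp only: diff power2_eq_square mult.assoc)
    finally have "integral {?c..?d} (\<lambda>t. (norm (x t))\<^sup>2) \<le> \<delta>\<^sup>2 * e" .
    moreover have "integral {0..?c} (\<lambda>t. (norm (x t))\<^sup>2) \<le> \<delta>\<^sup>2 * integral {0..?c} (\<lambda>t. (norm (dd x t))\<^sup>2)"
      using Suc by simp
    moreover have "integral {0..?d} (\<lambda>t. (norm (x t))\<^sup>2) = integral {0..?c} (\<lambda>t. (norm (x t))\<^sup>2) + integral {?c..?d} (\<lambda>t. (norm (x t))\<^sup>2)"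
      "integral {0..?d} (\<lambda>t. (norm (dd x t))\<^sup>2) = integral {0..?c} (\<lambda>t. (norm (dd x t))\<^sup>2) + e"
      unfolding e_def
      by (rule Henstock_Kurzweil_Integration.integral_combine[symmetric, OF cd(1) less_imp_le[OF cd(2)]], rule i)+
    ultimately show ?case by (simp only: distrib_left)
  qed simp
  have "real N * \<delta> = T" using N by (simp add: \<delta>_def)
  then show ?thesis using ind[of N] Re_l2[OF x] by (simp add: dnorm2_def \<delta>_def)
qed

text \<open>All constraints packed into one sequence: N moments followed by the two boundary
  values.\<close>

definition Psi :: "nat \<Rightarrow> (real \<Rightarrow> complex ^ 'n) \<Rightarrow> nat \<Rightarrow> complex ^ 'n" where
  "Psi N x = (\<lambda>l. if l < N then moment N l x else if l = N then x 0 else if l = Suc N then x T else 0)"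

lemma Psi_add: "x \<in> func_space \<Longrightarrow> y \<in> func_space \<Longrightarrow> Psi N (x + y) = Psi N x + Psi N y"
  by (auto simp: Psi_def fun_eq_iff moment_add)

lemma Psi_scale: "x \<in> func_space \<Longrightarrow> Psi N (scale_fun c x) = scale_fun c (Psi N x)"
  by (auto simp: Psi_def fun_eq_iff moment_scale scale_fun_apply)

lemma Psi_eq_0D:
  assumes "Psi N x = 0"
  shows "k < N \<Longrightarrow> moment N k x = 0" "x 0 = 0" "x T = 0" "bd x = 0"
proof -
  have e: "Psi N x l = 0" for l using assms by simp
  show "k < N \<Longrightarrow> moment N k x = 0" using e[of k] by (simp add: Psi_def)
  show "x 0 = 0" using e[of N] by (simp add: Psi_def)
  moreover show "x T = 0" using e[of "Suc N"] by (simp add: Psi_def)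
  ultimately show "bd x = 0" by (simp add: bd_def vec_eq_iff join_def split: sum.split)
qed

definition constrained :: "nat \<Rightarrow> (real \<Rightarrow> complex ^ 'n) set" where
  "constrained N = {x \<in> func_space. Psi N x = 0}"

lemma constrained_subspace: "cfun.subspace (constrained N)"
proof (rule cfun.subspaceI)
  have z: "0 \<in> func_space" by (rule cfun.subspace_0[OF func_space_subspace])
  have "Psi N (scale_fun 0 0) = scale_fun 0 (Psi N 0)" by (rule Psi_scale[OF z])
  then show "0 \<in> constrained N" using z by (simp add: constrained_def)
qed (use func_space_subspace in \<open>auto simp: constrained_def Psi_add Psi_scale intro: cfun.subspace_add cfun.subspace_scale\<close>)

text \<open>The margin is one full L2 form. Constrained functions have zero boundary values, so on
  them it is the whole comparison form \<open>gform\<close>.\<close>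

definition coercive :: "real \<Rightarrow> nat \<Rightarrow> bool" where
  "coercive \<mu> N \<longleftrightarrow> N > 0 \<and> (\<forall>x\<in>constrained N. Re (l2 x x) \<le> Re (energy x x) - \<mu> * Re (l2 x x))"

text \<open>The Poincare constant tends to 0 and eventually beats the zero-order loss in Garding's
  inequality. Validity for all large N is needed to obtain spaces of arbitrarily large dimension
  later.\<close>

lemma coercive_exists: "\<exists>N0. \<forall>N\<ge>N0. coercive \<mu> N"
proof -
  obtain p C where p: "p > 0" "\<And>x. x \<in> func_space \<Longrightarrow> p * dnorm2 x - C * Re (l2 x x) \<le> Re (energy x x)"
    using energy_lower by blast
  \<comment> \<open>A positive bound for 1 + C + \<mu>: the unit margin, the Garding loss and the
    spectral shift.\<close>
  define B where "B = \<bar>1 + C + \<mu>\<bar> + 1"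
  obtain N0 :: nat where N0: "B * T\<^sup>2 / p < real N0" using reals_Archimedean2 by blast
  have "coercive \<mu> N" if "N \<ge> Suc N0" for N
    unfolding coercive_def
  proof (intro conjI ballI)
    show N: "N > 0" using that by simp
    fix x assume "x \<in> constrained N"
    then have x: "x \<in> func_space" and z: "Psi N x = 0" by (auto simp: constrained_def)
    have d0: "dnorm2 x \<ge> 0"
      unfolding dnorm2_def by (intro Henstock_Kurzweil_Integration.integral_nonneg integrable_norm2 x) auto
    have l0: "Re (l2 x x) \<ge> 0"
      unfolding Re_l2[OF x] by (intro Henstock_Kurzweil_Integration.integral_nonneg integrable_norm2 x) auto
    have NN: "real N0 \<le> (real N)\<^sup>2"
    proof -
      have "real N0 \<le> real N" "1 \<le> real N" using that by auto
      then have "real N0 * 1 \<le> real N * real N" by (intro mult_mono) auto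
      then show ?thesis by (simp add: power2_eq_square)
    qed
    have "B * T\<^sup>2 < real N0 * p" using N0 p(1) by (simp add: pos_divide_less_eq)
    also have "\<dots> \<le> (real N)\<^sup>2 * p" using NN p(1) by (intro mult_right_mono) auto
    finally have "B * T\<^sup>2 \<le> p * (real N)\<^sup>2" by (simp add: mult.commute)
    then have BN: "B * (T / real N)\<^sup>2 \<le> p" using N by (simp add: power_divide field_simps)
    have "B * Re (l2 x x) \<le> B * ((T / real N)\<^sup>2 * dnorm2 x)"
      using poincare[OF x N] Psi_eq_0D(1)[OF z] by (intro mult_left_mono) (auto simp: B_def)
    also have "\<dots> = (B * (T / real N)\<^sup>2) * dnorm2 x" by simp
    also have "\<dots> \<le> p * dnorm2 x" using BN d0 by (rule mult_right_mono)
    finally have "B * Re (l2 x x) \<le> p * dnorm2 x" .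
    moreover have "(1 + C + \<mu>) * Re (l2 x x) \<le> B * Re (l2 x x)"
      using l0 by (intro mult_right_mono) (auto simp: B_def)
    ultimately show "Re (l2 x x) \<le> Re (energy x x) - \<mu> * Re (l2 x x)"
      using p(2)[OF x] by (simp add: algebra_simps)
  qed
  then show ?thesis by blast
qed

lemma green:
  assumes x: "x \<in> func_space" and w: "w \<in> func_space"
    and d: "\<And>t. t \<in> {0..T} \<Longrightarrow> (qd x has_vector_derivative yd t) (at t within {0..T})"
    and c: "continuous_on {0..T} yd"
  shows "energy x w = hermitian (qd x T) (w T) - hermitian (qd x 0) (w 0) +
    integral {0..T} (\<lambda>t. hermitian (low x t - yd t) (w t))"
proof -
  have h: "((\<lambda>t. hermitian (qd x t) (dd w t) + hermitian (yd t) (w t)) has_integral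
      hermitian (qd x T) (w T) - hermitian (qd x 0) (w 0)) {0..T}"
  proof (rule fundamental_theorem_of_calculus)
    fix t assume t: "t \<in> {0..T}"
    show "((\<lambda>t. hermitian (qd x t) (w t)) has_vector_derivative hermitian (qd x t) (dd w t) + hermitian (yd t) (w t))
        (at t within {0..T})"
      by (rule bounded_bilinear.has_vector_derivative[OF hermitian_bilinear d[OF t] func_space_deriv[OF w t]])
  qed (use T_pos in simp)
  have i: "(\<lambda>t. hermitian (low x t - yd t) (w t)) integrable_on {0..T}"
    by (intro integrable_continuous_interval continuous_intros func_space_cont x w c)
  have "energy x w = integral {0..T} (\<lambda>t. (hermitian (qd x t) (dd w t) + hermitian (yd t) (w t)) + hermitian (low x t - yd t) (w t))"
    unfolding energy_def by (rule integral_cong) (simp add: hermitian_diff_left)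
  also have "\<dots> = integral {0..T} (\<lambda>t. hermitian (qd x t) (dd w t) + hermitian (yd t) (w t)) +
      integral {0..T} (\<lambda>t. hermitian (low x t - yd t) (w t))"
    by (rule Henstock_Kurzweil_Integration.integral_add[OF has_integral_integrable[OF h] i])
  finally show ?thesis using integral_unique[OF h] by simp
qed

text \<open>The equation (A - \<mu>)x = sum of bumps times c(k): the stationarity condition of the
  form under the moment constraints, with Lagrange multipliers c(k). For N = 0 it is the eigenvalue
  equation.\<close>

definition solves :: "real \<Rightarrow> nat \<Rightarrow> (nat \<Rightarrow> complex ^ 'n) \<Rightarrow> (real \<Rightarrow> complex ^ 'n) \<Rightarrow> bool" where
  "solves \<mu> N c x \<longleftrightarrow> x \<in> func_space \<and> (\<forall>t\<in>{0..T}. (qd x has_vector_derivative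
     (low x t - \<mu> *\<^sub>R x t - (\<Sum>k<N. bump N k t *\<^sub>R c k))) (at t within {0..T}))"

text \<open>Against such a solution the form sees w only through its boundary values and moments;
  hence solutions are orthogonal to constrained functions.\<close>

lemma solves_energy:
  assumes s: "solves \<mu> N c x" and w: "w \<in> func_space"
  shows "energy x w + complex_of_real (- \<mu>) * l2 x w =
    hermitian (qd x T) (w T) - hermitian (qd x 0) (w 0) + (\<Sum>k<N. hermitian (c k) (moment N k w))"
proof -
  have x: "x \<in> func_space" using s by (simp add: solves_def)
  let ?yd = "\<lambda>t. low x t - \<mu> *\<^sub>R x t - (\<Sum>k<N. bump N k t *\<^sub>R c k)"
  have c: "continuous_on {0..T} ?yd" by (intro continuous_intros func_space_cont x)
  have m: "integral {0..T} (\<lambda>t. hermitian (bump N k t *\<^sub>R c k) (w t)) = hermitian (c k) (moment N k w)" for k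
    unfolding moment_def
    using integral_linear[OF integrable_bump[OF w, of N k] bounded_bilinear.bounded_linear_right[OF hermitian_bilinear, of "c k"]]
    by (simp add: o_def hermitian_scaleR_left hermitian_scaleR_right)
  have i: "(\<lambda>t. hermitian (bump N k t *\<^sub>R c k) (w t)) integrable_on {0..T}" for k
    by (intro integrable_continuous_interval continuous_intros func_space_cont w)
  have "integral {0..T} (\<lambda>t. hermitian (low x t - ?yd t) (w t)) =
      integral {0..T} (\<lambda>t. complex_of_real \<mu> * hermitian (x t) (w t) + (\<Sum>k<N. hermitian (bump N k t *\<^sub>R c k) (w t)))"
    by (rule integral_cong) (simp add: hermitian_add_left hermitian_sum_left hermitian_scaleR_left)
  also have "\<dots> = integral {0..T} (\<lambda>t. complex_of_real \<mu> * hermitian (x t) (w t)) +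
      integral {0..T} (\<lambda>t. \<Sum>k<N. hermitian (bump N k t *\<^sub>R c k) (w t))"
    by (intro Henstock_Kurzweil_Integration.integral_add integrable_on_mult_right integrable_l2 x w integrable_sum i) simp
  also have "integral {0..T} (\<lambda>t. \<Sum>k<N. hermitian (bump N k t *\<^sub>R c k) (w t)) = (\<Sum>k<N. hermitian (c k) (moment N k w))"
    using i m by (subst Henstock_Kurzweil_Integration.integral_sum) auto
  also have "integral {0..T} (\<lambda>t. complex_of_real \<mu> * hermitian (x t) (w t)) = complex_of_real \<mu> * l2 x w"
    by (simp add: l2_def)
  finally show ?thesis
    using green[OF x w _ c] s by (simp add: solves_def)
qed

lemma dd_Pinv: "t \<in> {0..T} \<Longrightarrow> dd x t = cmat (Pinv t) *v (qd x t - cmat (Q t) *v x t)"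
  using Pinv(1) by (simp add: quasi_deriv_def)

text \<open>The first-order system for (y, x), with x' expressed as P^{-1}(y - Q x). It turns the
  equation of second order into an initial value problem with continuous coefficients.\<close>

definition lin :: "real \<Rightarrow> real \<Rightarrow> (complex ^ 'n) \<times> (complex ^ 'n) \<Rightarrow> (complex ^ 'n) \<times> (complex ^ 'n)" where
  "lin \<mu> t z = (cmat (transpose (Q t)) *v (cmat (Pinv t) *v (fst z - cmat (Q t) *v snd z)) + cmat (R t) *v snd z - \<mu> *\<^sub>R snd z,
     cmat (Pinv t) *v (fst z - cmat (Q t) *v snd z))"

lemma lin_diff: "lin \<mu> t z - lin \<mu> t z' = lin \<mu> t (z - z')"
  by (simp add: lin_def prod_eq_iff matrix_vector_mult_diff_distrib scaleR_right_diff_distrib algebra_simps)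

lemma lin_bound: "\<exists>L>0. \<forall>t\<in>{0..T}. \<forall>z. norm (lin \<mu> t z) \<le> L * norm z"
proof -
  obtain a where a: "a > 0" "\<And>t v. t \<in> {0..T} \<Longrightarrow> norm (cmat (Pinv t) *v (v :: complex ^ 'n)) \<le> a * norm v"
    using matrix_bound[OF cont_Pinv] by blast
  obtain q where q: "q > 0" "\<And>t v. t \<in> {0..T} \<Longrightarrow> norm (cmat (Q t) *v (v :: complex ^ 'n)) \<le> q * norm v"
    using matrix_bound[OF cont_Q] by blast
  obtain q' where q': "q' > 0" "\<And>t v. t \<in> {0..T} \<Longrightarrow> norm (cmat (transpose (Q t)) *v (v :: complex ^ 'n)) \<le> q' * norm v"
    using matrix_bound[OF continuous_on_transpose[OF cont_Q]] by blast
  obtain r where r: "r > 0" "\<And>t v. t \<in> {0..T} \<Longrightarrow> norm (cmat (R t) *v (v :: complex ^ 'n)) \<le> r * norm v"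
    using matrix_bound[OF cont_R] by blast
  define b where "b = a * (1 + q)"
  have b0: "b > 0" using a q by (simp add: b_def)
  have "norm (lin \<mu> t z) \<le> (q' * b + r + \<bar>\<mu>\<bar> + b) * norm z" if t: "t \<in> {0..T}" for t z
  proof -
    let ?u = "cmat (Pinv t) *v (fst z - cmat (Q t) *v snd z)"
    have n: "norm (fst z) \<le> norm z" "norm (snd z) \<le> norm z"
      using norm_fst_le[of "fst z" "snd z"] norm_snd_le[of "snd z" "fst z"] by simp_all
    have "norm (fst z - cmat (Q t) *v snd z) \<le> norm (fst z) + norm (cmat (Q t) *v snd z)"
      by (rule norm_triangle_ineq4)
    also have "\<dots> \<le> norm z + q * norm z"
      using n q(2)[OF t, of "snd z"] q(1) by (intro add_mono) (auto intro: order_trans mult_left_mono)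
    finally have "a * norm (fst z - cmat (Q t) *v snd z) \<le> a * (norm z + q * norm z)"
      using a(1) by (intro mult_left_mono) auto
    then have u: "norm ?u \<le> b * norm z"
      using a(2)[OF t, of "fst z - cmat (Q t) *v snd z"] by (simp add: b_def algebra_simps)
    have "q' * norm ?u \<le> q' * (b * norm z)" using u q'(1) by (intro mult_left_mono) auto
    then have 1: "norm (cmat (transpose (Q t)) *v ?u) \<le> q' * b * norm z"
      using q'(2)[OF t, of ?u] by simp
    have "r * norm (snd z) \<le> r * norm z" using n r(1) by (intro mult_left_mono) auto
    then have 2: "norm (cmat (R t) *v snd z) \<le> r * norm z" using r(2)[OF t, of "snd z"] by linarith
    have 3: "norm (\<mu> *\<^sub>R snd z) \<le> \<bar>\<mu>\<bar> * norm z" using n by (simp add: mult_left_mono)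
    have "norm (lin \<mu> t z) \<le> norm (cmat (transpose (Q t)) *v ?u + cmat (R t) *v snd z - \<mu> *\<^sub>R snd z) + norm ?u"
      unfolding lin_def by (rule norm_Pair_le)
    also have "\<dots> \<le> (q' * b * norm z + r * norm z + \<bar>\<mu>\<bar> * norm z) + b * norm z"
      by (intro add_mono u norm_triangle_le_diff norm_triangle_le 1 2 3)
    finally show ?thesis by (simp add: algebra_simps)
  qed
  moreover have "q' * b + r + \<bar>\<mu>\<bar> + b > 0" using q' b0 r by (intro add_pos_pos add_pos_nonneg) auto
  ultimately show ?thesis by blast
qed

lemma solves_exists: "\<exists>x. solves \<mu> N c x \<and> qd x 0 = \<eta> \<and> x 0 = \<xi>"
proof -
  define f where "f t = (\<Sum>k<N. bump N k t *\<^sub>R c k)" for t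
  define F where "F t z = lin \<mu> t z - (f t, 0)" for t z
  obtain L where L: "L > 0" "\<And>t z. t \<in> {0..T} \<Longrightarrow> norm (lin \<mu> t z) \<le> L * norm z"
    using lin_bound by blast
  have "\<exists>z. z 0 = (\<eta>, \<xi>) \<and> (\<forall>t\<in>{0..T}. (z has_vector_derivative F t (z t)) (at t within {0..T}))"
  proof (rule ivp_exists[OF _ _ _ L(1)])
    show "continuous_on {0..T} (\<lambda>t. F t (z t))" if "continuous_on {0..T} z" for z
      unfolding F_def lin_def f_def
      by (intro continuous_intros cont_Q cont_R cont_Pinv that)
    show "norm (F t x - F t y) \<le> L * norm (x - y)" if "t \<in> {0..T}" for t x y
      using L(2)[OF that, of "x - y"] by (simp add: F_def lin_diff)
  qed (use T_pos in simp)
  then obtain z where z0: "z 0 = (\<eta>, \<xi>)"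
    and zd: "\<And>t. t \<in> {0..T} \<Longrightarrow> (z has_vector_derivative F t (z t)) (at t within {0..T})" by blast
  define x where "x t = (if t \<in> {0..T} then snd (z t) else 0)" for t
  have cz: "continuous_on {0..T} z"
    using zd has_vector_derivative_continuous continuous_on_eq_continuous_within by blast
  let ?x' = "\<lambda>t. cmat (Pinv t) *v (fst (z t) - cmat (Q t) *v snd (z t))"
  have xd: "(x has_vector_derivative ?x' t) (at t within {0..T})" if t: "t \<in> {0..T}" for t
  proof -
    have "((\<lambda>t. snd (z t)) has_vector_derivative snd (F t (z t))) (at t within {0..T})"
      by (rule bounded_linear.has_vector_derivative[OF bounded_linear_snd zd[OF t]])
    then have "((\<lambda>t. snd (z t)) has_vector_derivative ?x' t) (at t within {0..T})"
      by (simp add: F_def lin_def)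
    then show ?thesis by (rule has_vector_derivative_transform[OF t, rotated]) (simp add: x_def)
  qed
  have x: "x \<in> func_space"
    by (rule func_spaceI[OF _ xd]) (auto simp: x_def intro!: continuous_intros cont_Pinv cont_Q cz)
  have dx: "dd x t = ?x' t" if "t \<in> {0..T}" for t by (rule deriv_on_eq[OF xd[OF that] that])
  have qx: "qd x t = fst (z t)" if t: "t \<in> {0..T}" for t
    using dx[OF t] Pinv(2)[OF t] t by (simp add: quasi_deriv_def x_def)
  have "(qd x has_vector_derivative (low x t - \<mu> *\<^sub>R x t - f t)) (at t within {0..T})" if t: "t \<in> {0..T}" for t
  proof -
    have "((\<lambda>t. fst (z t)) has_vector_derivative fst (F t (z t))) (at t within {0..T})"
      by (rule bounded_linear.has_vector_derivative[OF bounded_linear_fst zd[OF t]])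
    moreover have "fst (F t (z t)) = low x t - \<mu> *\<^sub>R x t - f t"
      using t by (simp add: F_def lin_def low_def dx x_def)
    ultimately have "((\<lambda>t. fst (z t)) has_vector_derivative low x t - \<mu> *\<^sub>R x t - f t) (at t within {0..T})" by simp
    then show ?thesis by (rule has_vector_derivative_transform[OF t, rotated]) (simp add: qx)
  qed
  then have "solves \<mu> N c x" using x by (simp add: solves_def f_def)
  moreover have "qd x 0 = \<eta>" "x 0 = \<xi>" using qx[of 0] z0 T_pos by (auto simp: x_def)
  ultimately show ?thesis by blast
qed

text \<open>Unique continuation from the left end point, the analytic source of every strict
  inequality in the result.\<close>

lemma solves_zero:
  assumes s: "solves \<mu> N c x" and c: "\<And>k. k < N \<Longrightarrow> c k = 0" and "qd x 0 = 0" "x 0 = 0"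
  shows "x = 0"
proof -
  have x: "x \<in> func_space" using s by (simp add: solves_def)
  obtain L where L: "L > 0" "\<And>t z. t \<in> {0..T} \<Longrightarrow> norm (lin \<mu> t z) \<le> L * norm z"
    using lin_bound by blast
  have "(qd x t, x t) = 0" if t: "t \<in> {0..T}" for t
  proof (rule ivp_zero[OF T_pos, where z' = "\<lambda>t. lin \<mu> t (qd x t, x t)" and L = L and z = "\<lambda>t. (qd x t, x t)"])
    fix t assume t: "t \<in> {0..T}"
    have "lin \<mu> t (qd x t, x t) = (low x t - \<mu> *\<^sub>R x t - (\<Sum>k<N. bump N k t *\<^sub>R c k), dd x t)"
      using t c by (simp add: lin_def low_def dd_Pinv)
    then show "((\<lambda>t. (qd x t, x t)) has_vector_derivative lin \<mu> t (qd x t, x t)) (at t within {0..T})"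
      using s t func_space_deriv[OF x t] by (simp add: solves_def has_vector_derivative_Pair)
    show "norm (lin \<mu> t (qd x t, x t)) \<le> L * norm (qd x t, x t)" by (rule L(2)[OF t])
  qed (use assms t in \<open>auto simp: zero_prod_def\<close>)
  then have "x t = 0" for t
    using func_space_zero[OF x, of t] by (cases "t \<in> {0..T}") (auto simp: zero_prod_def)
  then show ?thesis by (simp add: zero_fun_def fun_eq_iff)
qed

lemma solves_add:
  assumes "solves \<mu> N c x" "solves \<mu> N c' x'"
  shows "solves \<mu> N (c + c') (x + x')"
proof -
  have m: "x \<in> func_space" "x' \<in> func_space" using assms by (auto simp: solves_def)
  have "(qd (x + x') has_vector_derivative (low (x + x') t - \<mu> *\<^sub>R (x + x') t - (\<Sum>k<N. bump N k t *\<^sub>R (c + c') k))) (at t within {0..T})"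
    if t: "t \<in> {0..T}" for t
  proof -
    have "((\<lambda>t. qd x t + qd x' t) has_vector_derivative
        (low x t - \<mu> *\<^sub>R x t - (\<Sum>k<N. bump N k t *\<^sub>R c k)) + (low x' t - \<mu> *\<^sub>R x' t - (\<Sum>k<N. bump N k t *\<^sub>R c' k))) (at t within {0..T})"
      using assms t by (intro has_vector_derivative_add) (auto simp: solves_def)
    then have "(qd (x + x') has_vector_derivative
        (low x t - \<mu> *\<^sub>R x t - (\<Sum>k<N. bump N k t *\<^sub>R c k)) + (low x' t - \<mu> *\<^sub>R x' t - (\<Sum>k<N. bump N k t *\<^sub>R c' k))) (at t within {0..T})"
      by (rule has_vector_derivative_transform[OF t, rotated]) (simp add: qd_add m)
    then show ?thesis
      using t by (simp add: low_add m scaleR_right_distrib sum.distrib algebra_simps)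
  qed
  then show ?thesis using m cfun.subspace_add[OF func_space_subspace] by (simp add: solves_def)
qed

lemma solves_scale:
  assumes "solves \<mu> N c x"
  shows "solves \<mu> N (scale_fun a c) (scale_fun a x)"
proof -
  have m: "x \<in> func_space" using assms by (auto simp: solves_def)
  have "(qd (scale_fun a x) has_vector_derivative (low (scale_fun a x) t - \<mu> *\<^sub>R (scale_fun a x) t - (\<Sum>k<N. bump N k t *\<^sub>R (scale_fun a c) k))) (at t within {0..T})"
    if t: "t \<in> {0..T}" for t
  proof -
    have "((\<lambda>t. a *s qd x t) has_vector_derivative a *s (low x t - \<mu> *\<^sub>R x t - (\<Sum>k<N. bump N k t *\<^sub>R c k))) (at t within {0..T})"
      using assms t by (intro bounded_linear.has_vector_derivative[OF bounded_linear_vec_scale]) (auto simp: solves_def)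
    then have "(qd (scale_fun a x) has_vector_derivative a *s (low x t - \<mu> *\<^sub>R x t - (\<Sum>k<N. bump N k t *\<^sub>R c k))) (at t within {0..T})"
      by (rule has_vector_derivative_transform[OF t, rotated]) (simp add: qd_scale m)
    moreover have "a *s (low x t - \<mu> *\<^sub>R x t - (\<Sum>k<N. bump N k t *\<^sub>R c k)) =
        low (scale_fun a x) t - \<mu> *\<^sub>R (scale_fun a x) t - (\<Sum>k<N. bump N k t *\<^sub>R (scale_fun a c) k)"
      using t by (simp add: low_scale m scale_fun_apply scaleR_eq_scale vec_eq_iff sum_distrib_left algebra_simps)
    ultimately show ?thesis by simp
  qed
  then show ?thesis using m cfun.subspace_scale[OF func_space_subspace] by (simp add: solves_def)
qed

end

section \<open>Decomposition of the form domain\<close>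

definition bd_x :: "'n::finite bdspace \<Rightarrow> complex ^ ('n + 'n)" where
  "bd_x v = join (right_part (left_part v)) (right_part (right_part v))"

definition pairing :: "'n::finite bdspace \<Rightarrow> complex ^ ('n + 'n) \<Rightarrow> complex" where
  "pairing v \<eta> = hermitian (left_part (right_part v)) (right_part \<eta>) - hermitian (left_part (left_part v)) (left_part \<eta>)"

text \<open>A boundary condition is given by a subspace \<open>E\<close> for the values of \<open>x\<close> and a Hermitian form
  \<open>S\<close>, which is added to the energy; the condition on \<open>y\<close> is the natural one.\<close>

definition represents :: "(complex ^ ('n + 'n)) set \<Rightarrow> (complex ^ ('n + 'n) \<Rightarrow> complex ^ ('n + 'n) \<Rightarrow> complex)
    \<Rightarrow> 'n::finite bdspace set \<Rightarrow> bool" where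
  "represents E S L \<longleftrightarrow> vec.subspace E \<and> vcs.hform UNIV S \<and>
     (\<forall>v. v \<in> L \<longleftrightarrow> bd_x v \<in> E \<and> (\<forall>\<eta>\<in>E. pairing v \<eta> + S (bd_x v) \<eta> = 0))"

text \<open>Room for N + 2 vectors. The same space holds multipliers with initial data and moments
  with boundary values, so that the map between them is an endomorphism.\<close>

definition seq_data :: "nat \<Rightarrow> (nat \<Rightarrow> complex ^ 'n::finite) set" where
  "seq_data N = {d. \<forall>k\<ge>N + 2. d k = 0}"

lemma seq_data_subspace: "cfun.subspace (seq_data N)"
  by (rule cfun.subspaceI) (auto simp: seq_data_def scale_fun_def)

lemma sum_fun_apply: "(\<Sum>i\<in>A. f i) x = (\<Sum>i\<in>A. f i x)"
  by (induction A rule: infinite_finite_induct) auto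

lemma join_zero [simp]: "join 0 0 = 0"
  by (simp add: join_def vec_eq_iff split: sum.split)

lemma seq_data_basis:
  obtains B :: "(nat \<Rightarrow> complex ^ 'n::finite) set" where "finite B" "cfun.independent B" "cfun.span B = seq_data N"
proof -
  define e :: "nat \<Rightarrow> 'n \<Rightarrow> nat \<Rightarrow> complex ^ 'n" where "e k i = (\<lambda>l. if l = k then axis i 1 else 0)" for k i
  define F where "F = (\<lambda>(k, i). e k i) ` ({..<N + 2} \<times> UNIV)"
  have "(seq_data N :: (nat \<Rightarrow> complex ^ 'n) set) \<subseteq> cfun.span F"
  proof
    fix d :: "nat \<Rightarrow> complex ^ 'n" assume d: "d \<in> seq_data N"
    have eq: "d = (\<Sum>k<N + 2. \<Sum>i\<in>UNIV. scale_fun (d k $ i) (e k i))"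
    proof
      fix l
      have inner: "(\<Sum>i\<in>UNIV. scale_fun (d k $ i) (e k i)) l = (if l = k then d k else 0)" for k
        by (simp add: sum_fun_apply scale_fun_def e_def vec_eq_iff axis_def if_distrib cong: if_cong)
      show "d l = (\<Sum>k<N + 2. \<Sum>i\<in>UNIV. scale_fun (d k $ i) (e k i)) l"
        using d unfolding sum_fun_apply[of _ "{..<N + 2}"] inner by (auto simp: seq_data_def)
    qed
    have eF: "e k i \<in> cfun.span F" if "k \<in> {..<N + 2}" for k i
      using that by (intro cfun.span_base) (auto simp: F_def)
    show "d \<in> cfun.span F"
      by (subst eq) (intro cfun.span_sum cfun.span_scale eF)
  qed
  moreover obtain B :: "(nat \<Rightarrow> complex ^ 'n) set" where B: "B \<subseteq> seq_data N" "cfun.independent B" "seq_data N \<subseteq> cfun.span B"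
    using cfun.maximal_independent_subset[of "seq_data N"] by blast
  moreover have "finite F" by (simp add: F_def)
  ultimately have "finite B" using cfun.independent_span_bound[of F B] by blast
  moreover have "cfun.span B = seq_data N"
    using B cfun.span_minimal[OF B(1) seq_data_subspace] by blast
  ultimately show ?thesis using that B by blast
qed

context sturm_liouville begin

text \<open>Entries below N are the multipliers, entry N is the initial quasi-derivative and entry N
  + 1 the initial value.\<close>

definition sol :: "real \<Rightarrow> nat \<Rightarrow> (nat \<Rightarrow> complex ^ 'n) \<Rightarrow> real \<Rightarrow> complex ^ 'n" where
  "sol \<mu> N d = (SOME x. solves \<mu> N d x \<and> qd x 0 = d N \<and> x 0 = d (Suc N))"

lemma sol: "solves \<mu> N d (sol \<mu> N d)" "qd (sol \<mu> N d) 0 = d N" "sol \<mu> N d 0 = d (Suc N)"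
  using someI_ex[OF solves_exists[of \<mu> N d "d N" "d (Suc N)"]] by (auto simp: sol_def)

lemma zero_in_T: "0 \<in> {0..T}"
  using T_pos by simp

lemma solves_in: "solves \<mu> N c x \<Longrightarrow> x \<in> func_space"
  by (simp add: solves_def)

lemma sol_unique:
  assumes s: "solves \<mu> N c x" and c: "\<And>k. k < N \<Longrightarrow> c k = d k" and "qd x 0 = d N" "x 0 = d (Suc N)"
  shows "x = sol \<mu> N d"
proof -
  let ?y = "sol \<mu> N d"
  have m: "x \<in> func_space" "scale_fun (-1) ?y \<in> func_space"
    by (rule solves_in[OF s], rule cfun.subspace_scale[OF func_space_subspace solves_in[OF sol(1)]])
  have "x + scale_fun (-1) ?y = 0"
  proof (rule solves_zero[OF solves_add[OF s solves_scale[OF sol(1)[of \<mu> N d], of "-1"]]])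
    show "(c + scale_fun (- 1) d) k = 0" if "k < N" for k using c[OF that] by (simp add: scale_fun_def)
    show "qd (x + scale_fun (- 1) ?y) 0 = 0"
      unfolding qd_add[OF m zero_in_T] qd_scale[OF solves_in[OF sol(1)] zero_in_T] assms(3) sol(2)
      by simp
    show "(x + scale_fun (- 1) ?y) 0 = 0" using assms(4) sol(3)[of \<mu> N d] by (simp add: scale_fun_def)
  qed
  then show ?thesis by (simp add: eq_neg_iff_add_eq_0 cfun.scale_minus_left)
qed

lemma sol_hom: "module_hom scale_fun scale_fun (sol \<mu> N)"
proof
  show "sol \<mu> N (d + d') = sol \<mu> N d + sol \<mu> N d'" for d d'
    by (rule sol_unique[OF solves_add[OF sol(1) sol(1)], symmetric])
      (simp_all add: qd_add[OF solves_in[OF sol(1)] solves_in[OF sol(1)] zero_in_T] sol)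
  show "sol \<mu> N (scale_fun a d) = scale_fun a (sol \<mu> N d)" for a d
    by (rule sol_unique[OF solves_scale[OF sol(1)], symmetric])
      (simp_all add: qd_scale[OF solves_in[OF sol(1)] zero_in_T] sol scale_fun_apply)
qed

lemma Psi_sol_hom: "module_hom scale_fun scale_fun (\<lambda>d. Psi N (sol \<mu> N d))"
proof
  interpret s: module_hom scale_fun scale_fun "sol \<mu> N" by (rule sol_hom)
  show "Psi N (sol \<mu> N (d + d')) = Psi N (sol \<mu> N d) + Psi N (sol \<mu> N d')" for d d'
    by (simp add: s.add Psi_add solves_in[OF sol(1)])
  show "Psi N (sol \<mu> N (scale_fun a d)) = scale_fun a (Psi N (sol \<mu> N d))" for a d
    by (simp add: s.scale Psi_scale solves_in[OF sol(1)])
qed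

lemma Psi_in_data: "Psi N x \<in> seq_data N"
  by (simp add: Psi_def seq_data_def)

lemma zero_func: "dd 0 t = 0" "qd 0 t = 0" "low 0 t = 0" if "t \<in> {0..T}"
proof -
  have "((0 :: real \<Rightarrow> complex ^ 'n) has_vector_derivative 0) (at t within {0..T})"
    by (simp add: zero_fun_def)
  then show d: "dd 0 t = 0" using that by (rule deriv_on_eq)
  show "qd 0 t = 0" "low 0 t = 0" using d by (simp_all add: quasi_deriv_def low_def)
qed

text \<open>Such an x is orthogonal to itself for the form, which is positive on constrained
  functions.\<close>

lemma solves_constrained_zero:
  assumes c: "coercive \<mu> N" and s: "solves \<mu> N d x" and z: "Psi N x = 0"
  shows "x = 0"
proof (rule ccontr)
  assume nz: "x \<noteq> 0"
  have x: "x \<in> func_space" by (rule solves_in[OF s])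
  have "energy x x + complex_of_real (- \<mu>) * l2 x x = 0"
    using solves_energy[OF s x] Psi_eq_0D[OF z] by simp
  then have "Re (energy x x) - \<mu> * Re (l2 x x) = 0"
    by (metis Re_complex_of_real add_uminus_conv_diff minus_complex.sel(1) mult_minus_left of_real_minus
        times_complex.sel(1) zero_complex.sel(1) Im_complex_of_real diff_zero mult_zero_left)
  moreover have "x \<in> constrained N" using x z by (simp add: constrained_def)
  ultimately have "Re (l2 x x) \<le> 0" using c by (force simp: coercive_def)
  then show False using l2_pos[OF x nz] by simp
qed

text \<open>The solution is 0, so its initial data vanish and its equation says that the combination
  of bumps is 0.\<close>

lemma Psi_sol_inj:
  assumes c: "coercive \<mu> N" and d: "d \<in> seq_data N" and z: "Psi N (sol \<mu> N d) = 0"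
  shows "d = 0"
proof -
  have N: "N > 0" using c by (simp add: coercive_def)
  have x0: "sol \<mu> N d = 0" by (rule solves_constrained_zero[OF c sol(1) z])
  have s: "solves \<mu> N d 0" using sol(1)[of \<mu> N d] by (simp add: x0)
  have sum0: "(\<Sum>k<N. bump N k t *\<^sub>R d k) = 0" if t: "t \<in> {0..T}" for t
  proof -
    have "(qd 0 has_vector_derivative - (\<Sum>k<N. bump N k t *\<^sub>R d k)) (at t within {0..T})"
      using bspec[OF conjunct2[OF s[unfolded solves_def]] t] zero_func(3)[OF t] by simp
    moreover have "((\<lambda>_. 0) has_vector_derivative (0 :: complex ^ 'n)) (at t within {0..T})" by simp
    then have "(qd 0 has_vector_derivative 0) (at t within {0..T})"
      by (rule has_vector_derivative_transform[OF t, rotated]) (simp add: zero_func)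
    ultimately show ?thesis
      using vector_derivative_within_closed_interval[OF T_pos t] by (metis neg_equal_0_iff_equal)
  qed
  have "d k = 0" for k
  proof -
    consider "k < N" | "k = N" | "k = Suc N" | "k \<ge> N + 2" by linarith
    then show ?thesis
    proof cases
      case 1
      \<comment> \<open>The midpoint of the k-th cell isolates the k-th coefficient.\<close>
      let ?t = "(real k + 1 / 2) * (T / real N)"
      have "T / real N > 0" using T_pos N by simp
      then have "real k * (T / real N) \<le> ?t" "?t \<le> real (Suc k) * (T / real N)"
        by (rule_tac mult_right_mono; simp)+
      then have "?t \<in> {0..T}" using piece_subset[OF N 1] by auto
      then have "0 = (\<Sum>l<N. bump N l ?t *\<^sub>R d l)" using sum0 by simp
      also have "\<dots> = (\<Sum>l<N. if l = k then bump N k ?t *\<^sub>R d k else 0)"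
        using bump_mid_other[OF N] by (intro sum.cong) auto
      also have "\<dots> = bump N k ?t *\<^sub>R d k" using 1 by simp
      finally show ?thesis using bump_mid[OF N, of k] by auto
    next
      case 2
      then show ?thesis using sol(2)[of \<mu> N d] zero_func(2)[OF zero_in_T] by (simp add: x0)
    next
      case 3
      then show ?thesis using sol(3)[of \<mu> N d] by (simp add: x0)
    qed (use d in \<open>auto simp: seq_data_def\<close>)
  qed
  then show ?thesis by (simp add: fun_eq_iff)
qed

text \<open>Fredholm alternative by dimension: the injective endomorphism sending data of a solution
  to its moments and boundary values is onto.\<close>

lemma Psi_surj:
  assumes c: "coercive \<mu> N" and d: "d \<in> seq_data N"
  shows "\<exists>c x. solves \<mu> N c x \<and> Psi N x = d"
proof -
  interpret p: module_hom scale_fun scale_fun "\<lambda>d. Psi N (sol \<mu> N d)" by (rule Psi_sol_hom)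
  let ?f = "\<lambda>d. Psi N (sol \<mu> N d)"
  obtain B :: "(nat \<Rightarrow> complex ^ 'n) set" where B: "finite B" "cfun.independent B" "cfun.span B = seq_data N"
    using seq_data_basis .
  have inj: "inj_on ?f (cfun.span B)"
    unfolding p.inj_on_iff_eq_0[OF cfun.subspace_span] using Psi_sol_inj[OF c] by (auto simp: B(3))
  have ind: "cfun.independent (?f ` B)" by (rule p.independent_injective_image[OF B(2) inj])
  have "card (?f ` B) = card B"
    using inj_on_subset[OF inj cfun.span_superset] by (rule card_image)
  moreover have "?f ` B \<subseteq> cfun.span B" unfolding B(3) using Psi_in_data by blast
  ultimately have "cfun.span B \<subseteq> cfun.span (?f ` B)"
    using cvs.independent_card_eq_spans[OF B(1) ind] by blast
  then have "d \<in> ?f ` cfun.span B" using d unfolding p.span_image B(3) by blast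
  then show ?thesis using sol(1) by blast
qed

definition sols :: "real \<Rightarrow> nat \<Rightarrow> (real \<Rightarrow> complex ^ 'n) set" where
  "sols \<mu> N = {x. \<exists>c. solves \<mu> N c x}"

lemma sols_subspace: "cfun.subspace (sols \<mu> N)"
proof (rule cfun.subspaceI)
  have "solves \<mu> N (scale_fun 0 0) (scale_fun 0 (sol \<mu> N 0))" by (rule solves_scale[OF sol(1)])
  then show "0 \<in> sols \<mu> N" by (auto simp: sols_def)
qed (auto simp: sols_def intro: solves_add solves_scale)

lemma sols_finite_dim: "\<exists>F. finite F \<and> sols \<mu> N \<subseteq> cfun.span F"
proof -
  interpret s: module_hom scale_fun scale_fun "sol \<mu> N" by (rule sol_hom)
  obtain B :: "(nat \<Rightarrow> complex ^ 'n) set" where B: "finite B" "cfun.independent B" "cfun.span B = seq_data N"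
    using seq_data_basis .
  have "x \<in> cfun.span (sol \<mu> N ` B)" if x: "x \<in> sols \<mu> N" for x
  proof -
    obtain c where c: "solves \<mu> N c x" using x by (auto simp: sols_def)
    \<comment> \<open>\<open>solves\<close> reads only the multipliers below N, so the data may be
      normalized to finite support.\<close>
    define d where "d = (\<lambda>l. if l < N then c l else if l = N then qd x 0 else if l = Suc N then x 0 else 0)"
    have "d \<in> seq_data N" by (simp add: d_def seq_data_def)
    moreover have "x = sol \<mu> N d" by (rule sol_unique[OF c]) (simp_all add: d_def)
    ultimately show ?thesis unfolding s.span_image B(3) by blast
  qed
  then show ?thesis using B(1) by (intro exI[of _ "sol \<mu> N ` B"]) auto
qed

definition dom_space :: "(complex ^ ('n + 'n)) set \<Rightarrow> (real \<Rightarrow> complex ^ 'n) set" where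
  "dom_space E = {x \<in> func_space. bd x \<in> E}"

lemma bd_zero [simp]: "bd 0 = 0"
  by (simp add: bd_def)

lemma dom_space_subspace: "vec.subspace E \<Longrightarrow> cfun.subspace (dom_space E)"
  using func_space_subspace
  by (auto simp: dom_space_def cfun.subspace_def vec.subspace_def bd_add bd_scale)

lemma dom_space_UNIV: "dom_space UNIV = func_space"
  by (auto simp: dom_space_def)

abbreviation sform :: "(complex ^ ('n + 'n) \<Rightarrow> complex ^ ('n + 'n) \<Rightarrow> complex) \<Rightarrow> (real \<Rightarrow> complex ^ 'n) \<Rightarrow>
    (real \<Rightarrow> complex ^ 'n) \<Rightarrow> complex" where
  "sform S \<equiv> \<lambda>x w. energy x w + S (bd x) (bd w)"

abbreviation lform :: "(complex ^ ('n + 'n) \<Rightarrow> complex ^ ('n + 'n) \<Rightarrow> complex) \<Rightarrow> real \<Rightarrow> (real \<Rightarrow> complex ^ 'n) \<Rightarrow>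
    (real \<Rightarrow> complex ^ 'n) \<Rightarrow> complex" where
  "lform S \<mu> \<equiv> \<lambda>x w. sform S x w + complex_of_real (- \<mu>) * l2 x w"

text \<open>The comparison form: it dominates the L2 form, by which \<mu> acts, and the Euclidean
  boundary form, by which the Robin parameter acts.\<close>

definition gform :: "(real \<Rightarrow> complex ^ 'n) \<Rightarrow> (real \<Rightarrow> complex ^ 'n) \<Rightarrow> complex" where
  "gform x w = l2 x w + hermitian (bd x) (bd w)"

lemma hform_sform: "vcs.hform UNIV S \<Longrightarrow> cvs.hform func_space (sform S)"
  by (intro cvs.hform_add hform_energy hform_bd)

lemma hform_lform: "vcs.hform UNIV S \<Longrightarrow> cvs.hform func_space (lform S \<mu>)"
  by (intro cvs.hform_add cvs.hform_cmult hform_sform hform_l2)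

lemma hform_gform: "cvs.hform func_space gform"
  unfolding gform_def[abs_def] by (intro cvs.hform_add hform_l2 hform_bd hform_hermitian)

lemma hform_dom: "cvs.hform func_space h \<Longrightarrow> vec.subspace E \<Longrightarrow> cvs.hform (dom_space E) h"
  by (erule cvs.hform_mono[OF _ dom_space_subspace]) (auto simp: dom_space_def)

lemma l2_le_gform: "Re (l2 x x) \<le> Re (gform x x)"
  by (simp add: gform_def hermitian_self)

lemma gform_pos: "x \<in> func_space \<Longrightarrow> x \<noteq> 0 \<Longrightarrow> Re (gform x x) > 0"
  using l2_pos l2_le_gform by (meson less_le_trans)

lemma lform_solves:
  assumes "solves \<mu> N c x" "w \<in> func_space"
  shows "lform S \<mu> x w = hermitian (qd x T) (w T) - hermitian (qd x 0) (w 0) +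
    (\<Sum>k<N. hermitian (c k) (moment N k w)) + S (bd x) (bd w)"
  using solves_energy[OF assms] by simp

lemma constrained_sub: "vec.subspace E \<Longrightarrow> constrained N \<subseteq> dom_space E"
  using Psi_eq_0D(4) by (auto simp: constrained_def dom_space_def vec.subspace_0)

lemma lform_orth:
  assumes S: "vcs.hform UNIV S" and "x \<in> constrained N" "y \<in> sols \<mu> N"
  shows "lform S \<mu> x y = 0"
proof -
  obtain c where c: "solves \<mu> N c y" using assms by (auto simp: sols_def)
  have m: "x \<in> func_space" "y \<in> func_space" and z: "Psi N x = 0"
    using assms solves_in[OF c] by (auto simp: constrained_def)
  have "lform S \<mu> y x = 0"
    unfolding lform_solves[OF c m(1)] using Psi_eq_0D[OF z] vcs.hform_zero_right[OF S] by simp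
  then show ?thesis using cvs.hform_cnj[OF hform_lform[OF S, of \<mu>] m(2,1)] by simp
qed

text \<open>Subtracts the solution with the same moments and boundary values. Since boundary values
  are unchanged on the solution part, the decomposition restricts to every
  \<open>dom_space E\<close>.\<close>

lemma decompose_sols:
  assumes c: "coercive \<mu> N" and x: "x \<in> func_space"
  shows "\<exists>x0\<in>constrained N. \<exists>y\<in>sols \<mu> N. bd y = bd x \<and> x = x0 + y"
proof -
  obtain d y where y: "solves \<mu> N d y" "Psi N y = Psi N x"
    using Psi_surj[OF c Psi_in_data] by blast
  have ym: "y \<in> func_space" by (rule solves_in[OF y(1)])
  have m: "x - y \<in> func_space" by (rule cfun.subspace_diff[OF func_space_subspace x ym])
  have "Psi N ((x - y) + y) = Psi N (x - y) + Psi N y" by (rule Psi_add[OF m ym])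
  then have z: "Psi N (x - y) = 0" using y(2) by simp
  have "bd ((x - y) + y) = bd (x - y) + bd y" by (rule bd_add)
  then have "bd y = bd x" using Psi_eq_0D(4)[OF z] by simp
  then show ?thesis
    using y m z by (intro bexI[of _ "x - y"] bexI[of _ y]) (auto simp: constrained_def sols_def)
qed

lemma lform_constrained:
  assumes c: "coercive \<mu> N" and S: "vcs.hform UNIV S" and x: "x \<in> constrained N"
  shows "1 * Re (gform x x) \<le> Re (lform S \<mu> x x)"
proof -
  have "bd x = 0" using x Psi_eq_0D(4) by (auto simp: constrained_def)
  then show ?thesis
    using c x vcs.hform_zero_left[OF S] by (auto simp: gform_def coercive_def)
qed

lemma lform_diag:
  assumes c: "coercive \<mu> N" and S: "vcs.hform UNIV S" and E: "vec.subspace E"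
  obtains Bp Bz Bn where "cvs.diag (dom_space E) (lform S \<mu>) (constrained N) Bp Bz Bn"
proof -
  obtain F where F: "finite F" "sols \<mu> N \<subseteq> cfun.span F" using sols_finite_dim by blast
  have hE: "cvs.hform (dom_space E) (lform S \<mu>)" by (rule hform_dom[OF hform_lform[OF S] E])
  show ?thesis
  proof (rule cvs.diag_exists[OF hE constrained_subspace constrained_sub[OF E], of "sols \<mu> N \<inter> dom_space E" F])
    show "cfun.subspace (sols \<mu> N \<inter> dom_space E)"
      by (intro cfun.subspace_inter sols_subspace dom_space_subspace E)
    show "\<exists>x0\<in>constrained N. \<exists>y\<in>sols \<mu> N \<inter> dom_space E. x = x0 + y" if "x \<in> dom_space E" for x
    proof -
      have x: "x \<in> func_space" "bd x \<in> E" using that by (auto simp: dom_space_def)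
      then obtain x0 y where "x0 \<in> constrained N" "y \<in> sols \<mu> N" "bd y = bd x" "x = x0 + y"
        using decompose_sols[OF c] by blast
      moreover from this have "y \<in> dom_space E" using x by (auto simp: dom_space_def sols_def solves_in)
      ultimately show ?thesis by blast
    qed
    show "lform S \<mu> x y = 0" if "x \<in> constrained N" "y \<in> sols \<mu> N \<inter> dom_space E" for x y
      using lform_orth[OF S] that by blast
  qed (use F that in auto)
qed

lemma lform_regular:
  assumes S: "vcs.hform UNIV S" and E: "vec.subspace E"
  shows "cvs.regular (dom_space E) gform (lform S \<mu>)"
proof -
  obtain N where N: "coercive \<mu> N" using coercive_exists by blast
  obtain Bp Bz Bn where "cvs.diag (dom_space E) (lform S \<mu>) (constrained N) Bp Bz Bn"
    using lform_diag[OF N S E] .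
  then show ?thesis
    unfolding cvs.regular_def using lform_constrained[OF N S] zero_less_one by blast
qed

lemma bd_sum: "bd (\<Sum>i\<in>I. scale_fun (u i) (c i)) = (\<Sum>i\<in>I. u i *s bd (c i))"
proof (induction I rule: infinite_finite_induct)
  case (infinite A)
  then show ?case by (simp add: bd_def)
next
  case empty
  then show ?case by (simp add: bd_def)
next
  case (insert x F)
  then show ?case by (simp only: sum.insert[OF insert(1,2)] bd_add bd_scale)
qed

lemma lift_boundary:
  assumes c: "coercive \<mu> N"
  shows "\<exists>x\<in>sols \<mu> N. bd x = \<eta> \<and> (\<forall>k<N. moment N k x = f k)"
proof -
  define d where "d = (\<lambda>l. if l < N then f l else if l = N then left_part \<eta> else if l = Suc N then right_part \<eta> else 0)"
  have "d \<in> seq_data N" by (simp add: d_def seq_data_def)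
  then obtain c x where x: "solves \<mu> N c x" "Psi N x = d" using Psi_surj[OF c] by blast
  have "moment N k x = f k" if "k < N" for k using fun_cong[OF x(2), of k] that by (simp add: Psi_def d_def)
  moreover have "bd x = \<eta>"
    using fun_cong[OF x(2), of N] fun_cong[OF x(2), of "Suc N"] by (simp add: Psi_def d_def bd_def)
  ultimately show ?thesis using x(1) by (auto simp: sols_def)
qed

lemma vec_axis_sum: "(\<Sum>i\<in>UNIV. u i *s axis i 1) = ((\<chi> i. u i) :: complex ^ 'm::finite)"
  by (simp add: vec_eq_iff axis_def if_distrib cong: if_cong)

text \<open>Lifting the coordinate vectors of boundary values shows that vanishing at both ends has
  codimension 2n. The lifts are taken among solutions, so they are orthogonal to the constrained
  functions for every form involved.\<close>

lemma boundary_complement: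
  assumes c: "coercive \<mu> N"
  obtains C where "finite C" "C \<subseteq> sols \<mu> N" "cfun.independent C" "card C = 2 * CARD('n)"
    "cfun.span C \<inter> dom_space {0} \<subseteq> {0}" "\<And>x. x \<in> func_space \<Longrightarrow> \<exists>w\<in>cfun.span C. x - w \<in> dom_space {0}"
proof -
  have "\<exists>x. x \<in> sols \<mu> N \<and> bd x = axis i 1" for i :: "'n + 'n"
    using lift_boundary[OF c, of "axis i 1" "\<lambda>_. 0"] by blast
  then obtain f where f: "\<And>i. f i \<in> sols \<mu> N" "\<And>i. bd (f i) = axis i 1" by metis
  have inj: "inj f"
  proof (rule injI)
    fix i j assume "f i = f j"
    then have "axis i (1::complex) = axis j 1" using f(2) by metis
    then show "i = j" by (simp add: axis_eq_axis)
  qed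
  have bdf: "bd (\<Sum>i\<in>UNIV. scale_fun (u i) (f i)) = (\<chi> i. u i)" for u
    by (simp add: bd_sum f(2) vec_axis_sum)
  have sp: "\<exists>u. w = (\<Sum>i\<in>UNIV. scale_fun (u i) (f i))" if w: "w \<in> cfun.span (range f)" for w
  proof -
    obtain u where "w = (\<Sum>v\<in>range f. scale_fun (u v) v)" using cvs.span_finite_sum[OF _ w] by auto
    then show ?thesis by (intro exI[of _ "u \<circ> f"]) (simp add: sum.reindex[OF inj])
  qed
  have bd0: "bd 0 = 0" by (simp add: bd_def)
  show ?thesis
  proof (rule that[of "range f"])
    show "cfun.independent (range f)"
    proof (rule cfun.independent_if_scalars_zero)
      fix g x assume g: "(\<Sum>x\<in>range f. scale_fun (g x) x) = 0" "x \<in> range f"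
      then have "(\<Sum>i\<in>UNIV. scale_fun ((g \<circ> f) i) (f i)) = 0" by (simp add: sum.reindex[OF inj])
      then have "(\<chi> i. (g \<circ> f) i) = 0" using bdf[of "g \<circ> f"] bd0 by simp
      then have "(g \<circ> f) i = 0" for i by (simp add: vec_eq_iff)
      then show "g x = 0" using g(2) by auto
    qed simp
    show "card (range f) = 2 * CARD('n)" using card_image[OF inj] by simp
    show "cfun.span (range f) \<inter> dom_space {0} \<subseteq> {0}"
    proof clarify
      fix w assume w: "w \<in> cfun.span (range f)" "w \<in> dom_space {0}"
      obtain u where u: "w = (\<Sum>i\<in>UNIV. scale_fun (u i) (f i))" using sp[OF w(1)] by blast
      then have "(\<chi> i. u i) = 0" using w(2) bdf[of u] by (simp add: dom_space_def)
      then have "u i = 0" for i by (simp add: vec_eq_iff)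
      then show "w = 0" by (simp add: u)
    qed
    show "\<exists>w\<in>cfun.span (range f). x - w \<in> dom_space {0}" if x: "x \<in> func_space" for x
    proof
      let ?w = "\<Sum>i\<in>UNIV. scale_fun (bd x $ i) (f i)"
      show w: "?w \<in> cfun.span (range f)" by (intro cfun.span_sum cfun.span_scale cfun.span_base rangeI)
      have "f i \<in> func_space" for i using f(1)[of i] solves_in by (auto simp: sols_def)
      then have wf: "?w \<in> func_space"
        using func_space_subspace by (intro cfun.subspace_sum cfun.subspace_scale) auto
      have "bd ((x - ?w) + ?w) = bd (x - ?w) + bd ?w" by (rule bd_add)
      then have "bd (x - ?w) = 0" by (simp add: bdf)
      then show "x - ?w \<in> dom_space {0}"
        using cfun.subspace_diff[OF func_space_subspace x wf] by (simp add: dom_space_def)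
    qed
  qed (use f in auto)
qed

lemma moment_sum:
  assumes "\<And>i. i \<in> I \<Longrightarrow> c i \<in> func_space"
  shows "moment N k (\<Sum>i\<in>I. scale_fun (u i) (c i)) = (\<Sum>i\<in>I. u i *s moment N k (c i))"
  using assms
proof (induction I rule: infinite_finite_induct)
  case (insert x F)
  have "(\<Sum>i\<in>F. scale_fun (u i) (c i)) \<in> func_space" "scale_fun (u x) (c x) \<in> func_space"
    using insert func_space_subspace by (auto intro!: cfun.subspace_sum cfun.subspace_scale)
  then show ?case using insert by (simp only: sum.insert[OF insert(1,2)] moment_add moment_scale insertI1 insertI2)
qed (simp_all add: moment_def)

text \<open>Functions with zero boundary values and moments dual to the first k bumps; this requires
  at least k bumps, hence coercivity for the larger number.\<close>

lemma infinite_dimensional: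
  assumes E: "vec.subspace E"
  shows "\<exists>C\<subseteq>dom_space E. finite C \<and> cfun.independent C \<and> card C = k"
proof -
  obtain N0 where "\<And>N. N \<ge> N0 \<Longrightarrow> coercive 0 N" using coercive_exists by blast
  then have c: "coercive 0 (max N0 k)" by simp
  define N where "N = max N0 k"
  have "\<exists>x. x \<in> sols 0 N \<and> bd x = 0 \<and> (\<forall>l<N. moment N l x = (if l = i then axis undefined 1 else 0))" for i
    using lift_boundary[OF c, of 0 "\<lambda>l. if l = i then axis undefined 1 else 0"] unfolding N_def by blast
  then obtain f where f: "\<And>i. f i \<in> sols 0 N" "\<And>i. bd (f i) = 0"
      "\<And>i l. l < N \<Longrightarrow> moment N l (f i) = (if l = i then axis undefined 1 else 0)"
    by metis
  have fs: "f i \<in> func_space" for i using f(1)[of i] solves_in by (auto simp: sols_def)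
  have key: "u i = 0" if "(\<Sum>i<k. scale_fun (u i) (f i)) = 0" "i < k" for u i
  proof -
    have iN: "i < N" using that by (simp add: N_def)
    have "0 = moment N i (\<Sum>i<k. scale_fun (u i) (f i))" using that by (simp add: moment_def)
    also have "\<dots> = (\<Sum>l<k. u l *s moment N i (f l))" using fs by (intro moment_sum)
    also have "\<dots> = (\<Sum>l<k. if l = i then u i *s axis undefined 1 else 0)"
      unfolding f(3)[OF iN] by (intro sum.cong) auto
    also have "\<dots> = u i *s axis undefined 1" using that by simp
    finally have "u i *s axis undefined 1 = (0 :: complex ^ 'n)" by simp
    then show ?thesis by (simp add: vec_eq_iff axis_def split: if_splits)
  qed
  have inj: "inj_on f {..<k}"
  proof (rule inj_onI, rule ccontr)
    fix i j assume ij: "i \<in> {..<k}" "j \<in> {..<k}" "f i = f j" "i \<noteq> j"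
    then have "moment N i (f i) = moment N i (f j)" by simp
    moreover have "i < N" using ij by (simp add: N_def)
    ultimately show False using f(3)[of i] ij(4) by (simp add: axis_eq_0_iff)
  qed
  have "cfun.independent (f ` {..<k})"
  proof (rule cfun.independent_if_scalars_zero)
    fix g x assume g: "(\<Sum>x\<in>f ` {..<k}. scale_fun (g x) x) = 0" "x \<in> f ` {..<k}"
    then have "(\<Sum>i<k. scale_fun ((g \<circ> f) i) (f i)) = 0" by (simp add: sum.reindex[OF inj])
    then show "g x = 0" using key[of "g \<circ> f"] g(2) by auto
  qed simp
  moreover have "f ` {..<k} \<subseteq> dom_space E" using fs f(2) vec.subspace_0[OF E] by (auto simp: dom_space_def)
  ultimately show ?thesis using card_image[OF inj] by (intro exI[of _ "f ` {..<k}"]) auto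
qed

end

section \<open>Lagrangian boundary conditions and eigenvalues\<close>

text \<open>A nondecreasing sequence is determined by its counting function, and that function by
  the multiplicities. Finiteness of the counts is assumed for \<open>l\<close> only and carries over
  to \<open>l'\<close>.\<close>

lemma enumeration_unique:
  fixes l l' :: "nat \<Rightarrow> real"
  assumes mono: "\<And>i k. 1 \<le> i \<Longrightarrow> i \<le> k \<Longrightarrow> l i \<le> l k" "\<And>i k. 1 \<le> i \<Longrightarrow> i \<le> k \<Longrightarrow> l' i \<le> l' k"
    and fin: "\<And>t. finite {i. 1 \<le> i \<and> l i \<le> t}"
    and fib: "\<And>\<mu>. finite {i. 1 \<le> i \<and> l i = \<mu>}" "\<And>\<mu>. finite {i. 1 \<le> i \<and> l' i = \<mu>}"
    and card: "\<And>\<mu>. card {i. 1 \<le> i \<and> l i = \<mu>} = card {i. 1 \<le> i \<and> l' i = \<mu>}"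
    and i: "1 \<le> i"
  shows "l i = l' i"
proof -
  have initial: "m i \<le> t \<longleftrightarrow> i \<le> card {k. 1 \<le> k \<and> m k \<le> t}"
    if m: "\<And>i k. 1 \<le> i \<Longrightarrow> i \<le> k \<Longrightarrow> m i \<le> m k" and f: "finite {k. 1 \<le> k \<and> m k \<le> t}" for m :: "nat \<Rightarrow> real" and t
  proof
    assume "m i \<le> t"
    then have "{1..i} \<subseteq> {k. 1 \<le> k \<and> m k \<le> t}" using m[of _ i] by fastforce
    from card_mono[OF f this] show "i \<le> card {k. 1 \<le> k \<and> m k \<le> t}" by simp
  next
    assume c: "i \<le> card {k. 1 \<le> k \<and> m k \<le> t}"
    show "m i \<le> t"
    proof (rule ccontr)
      assume n: "\<not> m i \<le> t"
      have "{k. 1 \<le> k \<and> m k \<le> t} \<subseteq> {1..<i}"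
      proof
        fix k assume k: "k \<in> {k. 1 \<le> k \<and> m k \<le> t}"
        have "\<not> i \<le> k" using m[OF i, of k] k n by auto
        then show "k \<in> {1..<i}" using k by simp
      qed
      then have "card {k. 1 \<le> k \<and> m k \<le> t} \<le> card {1..<i}" by (intro card_mono) auto
      then show False using c i by simp
    qed
  qed
  have same: "finite {k. 1 \<le> k \<and> l' k \<le> t} \<and> card {k. 1 \<le> k \<and> l' k \<le> t} = card {k. 1 \<le> k \<and> l k \<le> t}" for t
  proof -
    \<comment> \<open>Equal fibres have equal support, so both counts are sums over this one finite
      set of values.\<close>
    define M where "M = l ` {k. 1 \<le> k \<and> l k \<le> t}"
    have fM: "finite M" using fin by (simp add: M_def)
    have ne: "{k. 1 \<le> k \<and> l' k = \<mu>} \<noteq> {} \<longleftrightarrow> {k. 1 \<le> k \<and> l k = \<mu>} \<noteq> {}" for \<mu>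
      using card[of \<mu>] fib[of \<mu>] by (metis card_eq_0_iff)
    have u1: "{k. 1 \<le> k \<and> l k \<le> t} = (\<Union>\<mu>\<in>M. {k. 1 \<le> k \<and> l k = \<mu>})" by (auto simp: M_def)
    have u2: "{k. 1 \<le> k \<and> l' k \<le> t} = (\<Union>\<mu>\<in>M. {k. 1 \<le> k \<and> l' k = \<mu>})"
    proof (intro equalityI subsetI)
      fix k assume k: "k \<in> {k. 1 \<le> k \<and> l' k \<le> t}"
      then have "{i. 1 \<le> i \<and> l i = l' k} \<noteq> {}" using ne[of "l' k"] by auto
      then have "l' k \<in> M" using k by (force simp: M_def)
      then show "k \<in> (\<Union>\<mu>\<in>M. {k. 1 \<le> k \<and> l' k = \<mu>})" using k by auto
    qed (auto simp: M_def)
    have "card {k. 1 \<le> k \<and> l k \<le> t} = (\<Sum>\<mu>\<in>M. card {k. 1 \<le> k \<and> l k = \<mu>})"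
      unfolding u1 by (rule card_UN_disjoint[OF fM]) (use fib in auto)
    moreover have "card {k. 1 \<le> k \<and> l' k \<le> t} = (\<Sum>\<mu>\<in>M. card {k. 1 \<le> k \<and> l' k = \<mu>})"
      unfolding u2 by (rule card_UN_disjoint[OF fM]) (use fib in auto)
    moreover have "finite {k. 1 \<le> k \<and> l' k \<le> t}" unfolding u2 using fM fib(2) by blast
    ultimately show ?thesis using card by simp
  qed
  have "l i \<le> t \<longleftrightarrow> l' i \<le> t" for t
    using initial[of l t, OF mono(1) fin] initial[of l' t, OF mono(2)] same[of t] by simp
  then show ?thesis by (meson order_antisym order_refl)
qed

text \<open>The boundary form of Green's identity. It separates the y-part, seen by
  \<open>pairing\<close>, from the x-part, seen by \<open>bd_x\<close>.\<close>

lemma Omega_eq: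
  fixes u v :: "'n::finite bdspace"
  shows "Omega u v = pairing u (bd_x v) - cnj (pairing v (bd_x u))"
proof -
  have J: "J_mat *v w = join (- right_part w) (left_part w)" for w :: "'n phase"
  proof -
    have "(J_mat *v w) $ i = join (- right_part w) (left_part w) $ i" for i
      unfolding matrix_vector_mult_def J_mat_def
      by (cases i) (simp_all add: UNIV_Plus_UNIV[symmetric] sum.Plus join_def left_part_def right_part_def if_distrib if_distribR
          del: UNIV_Plus_UNIV cong: if_cong)
    then show ?thesis by (simp add: vec_eq_iff)
  qed
  have om: "omega a b = hermitian (left_part a) (right_part b) - hermitian (right_part a) (left_part b)" for a b :: "'n phase"
  proof -
    have "omega a b = hermitian (join (- right_part a) (left_part a)) (join (left_part b) (right_part b))"
      by (simp add: omega_def J)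
    then show ?thesis unfolding hermitian_join by (simp add: hermitian_minus_left)
  qed
  have c: "cnj (hermitian a b) = hermitian b a" for a b :: "complex ^ 'n" by (rule hermitian_cnj[symmetric])
  show ?thesis by (simp add: Omega_def om pairing_def bd_x_def c)
qed

lemma bd_x_linear: "bd_x (u + v) = bd_x u + bd_x v" "bd_x (c *s u) = c *s bd_x u" "bd_x (u - v) = bd_x u - bd_x v"
proof -
  show "bd_x (u + v) = bd_x u + bd_x v" by (simp add: bd_x_def left_part_linear right_part_linear join_add)
  show "bd_x (c *s u) = c *s bd_x u" by (simp add: bd_x_def left_part_linear right_part_linear join_scale)
  show "bd_x (u - v) = bd_x u - bd_x v"
    by (simp add: bd_x_def left_part_linear right_part_linear join_def vec_eq_iff split: sum.split)
qed

lemma pairing_linear: "pairing (u + v) \<eta> = pairing u \<eta> + pairing v \<eta>" "pairing (c *s u) \<eta> = c * pairing u \<eta>"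
  "pairing (u - v) \<eta> = pairing u \<eta> - pairing v \<eta>" "pairing u 0 = 0"
  by (simp_all add: pairing_def left_part_linear right_part_linear hermitian_add_left hermitian_scale_left
      hermitian_diff_left algebra_simps)

lemma vec_linearI:
  assumes "\<And>u v. f (u + v) = f u + f v" "\<And>c u. f (c *s u) = c *s f u"
  shows "Vector_Spaces.linear (*s) (*s) (f :: complex ^ 'a::finite \<Rightarrow> complex ^ 'b::finite)"
  by unfold_locales (simp_all add: assms)

lemma dim_range_inj:
  fixes f :: "complex ^ ('n::finite + 'n) \<Rightarrow> 'n bdspace"
  assumes "Vector_Spaces.linear (*s) (*s) f" "inj f"
  shows "vec.subspace (range f)" "vec.dim (range f) = 2 * CARD('n)"
proof -
  show "vec.subspace (range f)" by (rule vec.linear_subspace_image[OF assms(1) vec.subspace_UNIV])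
  have "vec.dim (f ` UNIV) = vec.dim (UNIV :: (complex ^ ('n + 'n)) set)"
    by (rule vec.dim_image_eq[OF assms(1)]) (use assms(2) in \<open>auto intro: inj_on_subset\<close>)
  then show "vec.dim (range f) = 2 * CARD('n)" by (simp add: card_cart_basis)
qed

text \<open>Multiplication by the block diagonal matrix with blocks -J and J, which converts
  \<open>Omega\<close> into the Hermitian product.\<close>

definition omega_rotate :: "'n::finite bdspace \<Rightarrow> 'n bdspace" where
  "omega_rotate u = join (join (right_part (left_part u)) (- left_part (left_part u)))
     (join (- right_part (right_part u)) (left_part (right_part u)))"

lemma hermitian_omega_rotate: "hermitian (omega_rotate u) v = Omega u v"
proof -
  have "hermitian (omega_rotate u) (join (join (left_part (left_part v)) (right_part (left_part v)))
      (join (left_part (right_part v)) (right_part (right_part v)))) = Omega u v"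
    unfolding omega_rotate_def hermitian_join Omega_eq
    by (simp add: pairing_def bd_x_def hermitian_minus_left hermitian_cnj[of "left_part _" "right_part _"])
  then show ?thesis by simp
qed

lemma omega_rotate_eq_0: "omega_rotate u = 0 \<Longrightarrow> u = 0"
proof -
  assume z: "omega_rotate u = 0"
  have e: "u = join (join (left_part (left_part u)) (right_part (left_part u)))
      (join (left_part (right_part u)) (right_part (right_part u)))" by simp
  have "join (join (right_part (left_part u)) (- left_part (left_part u)))
     (join (- right_part (right_part u)) (left_part (right_part u))) = join (join 0 0) (join 0 0)"
    using z by (simp add: omega_rotate_def)
  then have "right_part (left_part u) = 0" "left_part (left_part u) = 0" "right_part (right_part u) = 0" "left_part (right_part u) = 0"
    by (simp_all only: join_eq_iff neg_equal_0_iff_equal)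
  then show "u = 0" by (subst e) simp
qed

lemma omega_rotate_linear: "Vector_Spaces.linear (*s) (*s) omega_rotate"
  by (rule vec_linearI)
    (simp_all add: omega_rotate_def left_part_linear right_part_linear join_add join_scale minus_add_distrib
      vector_smult_rneg)

text \<open>The rotated copy of \<open>L\<close> is orthogonal to \<open>L\<close>, and two spaces
  of dimension 2n fill the whole space of dimension 4n. The component of v in the rotated copy is
  then orthogonal to itself.\<close>

lemma Lag_maximal:
  assumes L: "L \<in> Lag" and v: "\<And>u. u \<in> L \<Longrightarrow> Omega u v = 0"
  shows "v \<in> (L :: 'n::finite bdspace set)"
proof -
  have s: "vec.subspace L" and iso: "\<And>u v. u \<in> L \<Longrightarrow> v \<in> L \<Longrightarrow> Omega u v = 0" and d: "vec.dim L = 2 * CARD('n)"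
    using L by (auto simp: Lag_def)
  let ?J = "omega_rotate ` L"
  have sJ: "vec.subspace ?J" by (rule vec.linear_subspace_image[OF omega_rotate_linear s])
  have "inj_on omega_rotate (vec.span L)"
    unfolding vec.linear_inj_on_iff_eq_0[OF omega_rotate_linear vec.subspace_span] using omega_rotate_eq_0 by blast
  then have dJ: "vec.dim ?J = 2 * CARD('n)" using vec.dim_image_eq[OF omega_rotate_linear] d by metis
  have "?J \<inter> L \<subseteq> {0}"
  proof clarify
    fix u assume u: "u \<in> L" "omega_rotate u \<in> L"
    then have "hermitian (omega_rotate u) (omega_rotate u) = 0" using iso hermitian_omega_rotate by metis
    then show "omega_rotate u = 0" by (simp add: hermitian_self)
  qed
  then have "vec.dim (?J \<inter> L) = 0" by simp
  then have "vec.dim {x + y |x y. x \<in> ?J \<and> y \<in> L} = 4 * CARD('n)"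
    using vec.dim_sums_Int[OF sJ s] d dJ by linarith
  moreover have "vec.dim (UNIV :: 'n bdspace set) = 4 * CARD('n)" by (simp add: card_cart_basis)
  ultimately have "{x + y |x y. x \<in> ?J \<and> y \<in> L} = UNIV"
    by (intro vec.subspace_dim_equal vec.subspace_sums sJ s vec.subspace_UNIV) auto
  then obtain u w where w: "u \<in> L" "w \<in> L" "v = omega_rotate u + w" by blast
  have "0 = hermitian (omega_rotate u) v" using v[OF w(1)] by (simp add: hermitian_omega_rotate)
  also have "\<dots> = hermitian (omega_rotate u) (omega_rotate u) + hermitian (omega_rotate u) w"
    unfolding w(3) by (rule hermitian_add_right)
  also have "hermitian (omega_rotate u) w = 0" using iso[OF w(1,2)] by (simp add: hermitian_omega_rotate)
  finally have "omega_rotate u = 0" by (simp add: hermitian_self)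
  then show ?thesis using w by simp
qed

text \<open>Isotropy makes the y-part of a vector in \<open>L\<close>, tested against admissible
  x-values, depend only on its x-part, and makes this dependence Hermitian. Maximality of
  \<open>L\<close> gives the converse inclusion.\<close>

lemma Lag_represents:
  assumes L: "L \<in> Lag"
  shows "\<exists>S. represents (bd_x ` L) S (L :: 'n::finite bdspace set)"
proof -
  have s: "vec.subspace L" and iso: "\<And>u v. u \<in> L \<Longrightarrow> v \<in> L \<Longrightarrow> Omega u v = 0"
    using L by (auto simp: Lag_def)
  have lin: "Vector_Spaces.linear (*s) (*s) (bd_x :: 'n bdspace \<Rightarrow> _)"
    by (rule vec_linearI) (simp_all add: bd_x_linear)
  obtain G where G: "range G \<subseteq> L" "Vector_Spaces.linear (*s) (*s) G" "\<And>\<xi>. \<xi> \<in> bd_x ` L \<Longrightarrow> bd_x (G \<xi>) = \<xi>"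
    using vec.linear_exists_right_inverse_on[OF lin s] by blast
  have GL: "G \<xi> \<in> L" for \<xi> using G(1) by blast
  \<comment> \<open>\<open>G\<close> inverts \<open>bd_x\<close> only over the admissible values but
    always lands in \<open>L\<close>. Writing \<open>bd_x (G \<eta>)\<close> in place of \<eta>
    therefore makes \<open>S\<close> Hermitian on all boundary vectors.\<close>
  define S where "S \<xi> \<eta> = - pairing (G \<xi>) (bd_x (G \<eta>))" for \<xi> \<eta>
  have "vcs.hform UNIV S"
  proof (rule vcs.hformI)
    show "S (x + y) z = S x z + S y z" for x y z
      by (simp add: S_def vec.linear_add[OF G(2)] pairing_linear)
    show "S (c *s x) y = c * S x y" for c x y
      by (simp add: S_def vec.linear_scale[OF G(2)] pairing_linear)
    show "S y x = cnj (S x y)" for x y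
      using iso[OF GL[of y] GL[of x]] by (simp add: S_def Omega_eq)
  qed simp
  moreover have "v \<in> L \<longleftrightarrow> bd_x v \<in> bd_x ` L \<and> (\<forall>\<eta>\<in>bd_x ` L. pairing v \<eta> + S (bd_x v) \<eta> = 0)" for v
  proof
    assume v: "v \<in> L"
    have "pairing v \<eta> + S (bd_x v) \<eta> = 0" if \<eta>: "\<eta> \<in> bd_x ` L" for \<eta>
    proof -
      let ?u = "v - G (bd_x v)"
      have u: "?u \<in> L" by (rule vec.subspace_diff[OF s v GL])
      have "bd_x ?u = 0" using G(3)[of "bd_x v"] v by (simp add: bd_x_linear)
      then have "pairing ?u \<eta> = 0" using iso[OF u GL[of \<eta>]] G(3)[OF \<eta>] by (simp add: Omega_eq pairing_linear)
      then show ?thesis using G(3)[OF \<eta>] by (simp add: S_def pairing_linear)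
    qed
    then show "bd_x v \<in> bd_x ` L \<and> (\<forall>\<eta>\<in>bd_x ` L. pairing v \<eta> + S (bd_x v) \<eta> = 0)" using v by blast
  next
    assume a: "bd_x v \<in> bd_x ` L \<and> (\<forall>\<eta>\<in>bd_x ` L. pairing v \<eta> + S (bd_x v) \<eta> = 0)"
    let ?u = "v - G (bd_x v)"
    have u0: "bd_x ?u = 0" using G(3)[of "bd_x v"] a by (simp add: bd_x_linear)
    have "Omega w ?u = 0" if w: "w \<in> L" for w
    proof -
      have "pairing v (bd_x w) + S (bd_x v) (bd_x w) = 0" using a w by blast
      moreover have "bd_x (G (bd_x w)) = bd_x w" using G(3) w by blast
      ultimately have "pairing ?u (bd_x w) = 0" by (simp add: S_def pairing_linear)
      then show ?thesis using u0 by (simp add: Omega_eq pairing_linear)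
    qed
    then have "?u \<in> L" by (rule Lag_maximal[OF L])
    then have "?u + G (bd_x v) \<in> L" by (rule vec.subspace_add[OF s _ GL])
    then show "v \<in> L" by simp
  qed
  moreover have "vec.subspace (bd_x ` L)" by (rule vec.linear_subspace_image[OF lin s])
  ultimately show ?thesis unfolding represents_def by blast
qed

lemma bd_x_eq_0_iff: "bd_x v = 0 \<longleftrightarrow> v \<in> Dirichlet"
proof -
  have "bd_x v = 0 \<longleftrightarrow> join (right_part (left_part v)) (right_part (right_part v)) = join 0 0"
    by (simp only: bd_x_def join_zero)
  then show ?thesis by (simp only: join_eq_iff Dirichlet_def mem_Collect_eq)
qed

lemma Dirichlet_represents: "represents {0} (\<lambda>_ _. 0) Dirichlet"
  unfolding represents_def
  by (auto simp: bd_x_eq_0_iff pairing_linear vec.subspace_single_0 intro!: vcs.hformI)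

lemma Dirichlet_Lag: "(Dirichlet :: 'n::finite bdspace set) \<in> Lag"
proof -
  define f :: "complex ^ ('n + 'n) \<Rightarrow> 'n bdspace" where
    "f \<eta> = join (join (left_part \<eta>) 0) (join (right_part \<eta>) 0)" for \<eta>
  have lin: "Vector_Spaces.linear (*s) (*s) f"
    by (rule vec_linearI) (simp_all add: f_def left_part_linear right_part_linear join_add join_scale)
  have "inj f"
  proof (rule injI)
    fix u v assume "f u = f v"
    then have "left_part u = left_part v" "right_part u = right_part v" by (simp_all add: f_def)
    then have "join (left_part u) (right_part u) = join (left_part v) (right_part v)" by simp
    then show "u = v" by simp
  qed
  moreover have "range f = Dirichlet"
  proof (intro equalityI subsetI)
    fix v :: "'n bdspace" assume "v \<in> Dirichlet"
    then have "right_part (left_part v) = 0" "right_part (right_part v) = 0" by (auto simp: Dirichlet_def)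
    then have "v = f (join (left_part (left_part v)) (left_part (right_part v)))"
      unfolding f_def by (metis join_parts left_part_join right_part_join)
    then show "v \<in> range f" by blast
  qed (auto simp: f_def Dirichlet_def)
  moreover have "Omega u v = 0" if "u \<in> Dirichlet" "v \<in> Dirichlet" for u v :: "'n bdspace"
  proof -
    have "bd_x u = 0" "bd_x v = 0" using that by (simp_all add: bd_x_eq_0_iff)
    then show ?thesis by (simp add: Omega_eq pairing_linear)
  qed
  ultimately show ?thesis using dim_range_inj[OF lin] by (simp add: Lag_def)
qed

text \<open>The kernel of \<open>bd_x\<close> on \<open>L\<close> is the intersection with the
  Dirichlet condition; if it is trivial, the image has full dimension.\<close>

lemma layer_0_bd_x:
  assumes "L \<in> layer 0"
  shows "bd_x ` L = (UNIV :: (complex ^ ('n::finite + 'n)) set)"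
proof -
  have L: "L \<in> Lag" and "vec.dim (L \<inter> Dirichlet) = 0" using assms by (auto simp: layer_def)
  then have z: "L \<inter> Dirichlet \<subseteq> {0}" by simp
  have s: "vec.subspace L" and d: "vec.dim L = 2 * CARD('n)" using L by (auto simp: Lag_def)
  have lin: "Vector_Spaces.linear (*s) (*s) (bd_x :: 'n bdspace \<Rightarrow> _)"
    by (rule vec_linearI) (simp_all add: bd_x_linear)
  have "inj_on bd_x (vec.span L)"
    unfolding vec.linear_inj_on_iff_eq_0[OF lin vec.subspace_span] using z s
    by (auto simp: bd_x_eq_0_iff vec.span_eq_iff[THEN iffD2, OF s])
  then have "vec.dim (bd_x ` L) = 2 * CARD('n)" using vec.dim_image_eq[OF lin] d by metis
  moreover have "vec.dim (UNIV :: (complex ^ ('n + 'n)) set) = 2 * CARD('n)" by (simp add: card_cart_basis)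
  ultimately show ?thesis
    by (intro vec.subspace_dim_equal vec.linear_subspace_image[OF lin s] vec.subspace_UNIV) auto
qed

text \<open>The conditions y(0) = s x(0) and y(T) = -s x(T), written in the weak form that matches
  \<open>represents\<close>.\<close>

definition robin :: "real \<Rightarrow> 'n::finite bdspace set" where
  "robin s = {v. \<forall>\<eta>. pairing v \<eta> + complex_of_real s * hermitian (bd_x v) \<eta> = 0}"

lemma robin_represents: "represents UNIV (\<lambda>\<xi> \<eta>. complex_of_real s * hermitian \<xi> \<eta>) (robin s)"
  unfolding represents_def
  by (auto simp: robin_def intro!: vcs.hform_cmult hform_hermitian)

lemma robin_layer_0: "robin s \<in> (layer 0 :: 'n::finite bdspace set set)"
proof -
  define f :: "complex ^ ('n + 'n) \<Rightarrow> 'n bdspace" where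
    "f \<xi> = join (join (complex_of_real s *s left_part \<xi>) (left_part \<xi>)) (join (complex_of_real (- s) *s right_part \<xi>) (right_part \<xi>))" for \<xi>
  have lin: "Vector_Spaces.linear (*s) (*s) f"
    by (rule vec_linearI)
      (simp_all add: f_def left_part_linear right_part_linear join_add join_scale vector_add_ldistrib
        vector_smult_assoc mult.commute)
  have "inj f"
  proof (rule injI)
    fix u v assume "f u = f v"
    then have "left_part u = left_part v" "right_part u = right_part v" by (simp_all add: f_def)
    then have "join (left_part u) (right_part u) = join (left_part v) (right_part v)" by simp
    then show "u = v" by simp
  qed
  moreover have r: "range f = robin s"
  proof (intro equalityI subsetI)
    fix v :: "'n bdspace" assume v: "v \<in> robin s"
    let ?y0 = "left_part (left_part v)" and ?x0 = "right_part (left_part v)"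
    let ?yT = "left_part (right_part v)" and ?xT = "right_part (right_part v)"
    have e: "pairing v (join \<alpha> \<beta>) + complex_of_real s * hermitian (bd_x v) (join \<alpha> \<beta>) =
        hermitian (?yT + complex_of_real s *s ?xT) \<beta> + hermitian (complex_of_real s *s ?x0 - ?y0) \<alpha>" for \<alpha> \<beta>
      by (simp add: pairing_def bd_x_def hermitian_join hermitian_add_left hermitian_diff_left hermitian_scale_left algebra_simps)
    have "hermitian (?yT + complex_of_real s *s ?xT) (?yT + complex_of_real s *s ?xT) = 0"
      using v e[of 0 "?yT + complex_of_real s *s ?xT"] by (simp add: robin_def)
    then have yT: "?yT = complex_of_real (- s) *s ?xT"
      by (simp add: hermitian_self eq_neg_iff_add_eq_0 vector_smult_lneg)
    have "hermitian (complex_of_real s *s ?x0 - ?y0) (complex_of_real s *s ?x0 - ?y0) = 0"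
      using v e[of "complex_of_real s *s ?x0 - ?y0" 0] by (simp add: robin_def)
    then have y0: "?y0 = complex_of_real s *s ?x0" by (simp add: hermitian_self)
    have "v = join (join ?y0 ?x0) (join ?yT ?xT)" by simp
    also have "\<dots> = f (join ?x0 ?xT)" unfolding f_def left_part_join right_part_join y0[symmetric] yT[symmetric] ..
    finally show "v \<in> range f" by blast
  next
    fix v assume "v \<in> range f"
    then obtain \<xi> where \<xi>: "v = f \<xi>" by blast
    have "pairing v \<eta> + complex_of_real s * hermitian (bd_x v) (join (left_part \<eta>) (right_part \<eta>)) = 0" for \<eta>
      unfolding \<xi> f_def bd_x_def hermitian_join
      by (simp add: pairing_def hermitian_scale_left hermitian_minus_left algebra_simps vector_smult_lneg)
    then show "v \<in> robin s" by (simp add: robin_def)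
  qed
  moreover have "Omega u v = 0" if "u \<in> robin s" "v \<in> robin s" for u v :: "'n bdspace"
  proof -
    have p: "pairing u (bd_x v) = - complex_of_real s * hermitian (bd_x u) (bd_x v)"
      "pairing v (bd_x u) = - complex_of_real s * hermitian (bd_x v) (bd_x u)"
      using that by (simp_all add: robin_def eq_neg_iff_add_eq_0)
    show ?thesis unfolding Omega_eq p by (simp add: hermitian_cnj[of "bd_x v"])
  qed
  moreover have "robin s \<inter> Dirichlet \<subseteq> {0 :: 'n bdspace}"
  proof clarify
    fix v :: "'n bdspace" assume v: "v \<in> robin s" "v \<in> Dirichlet"
    obtain \<xi> where \<xi>: "v = f \<xi>" using v(1) r by blast
    then have "left_part \<xi> = 0" "right_part \<xi> = 0" using v(2) by (simp_all add: f_def Dirichlet_def)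
    then show "v = 0" by (simp add: \<xi> f_def)
  qed
  ultimately show ?thesis using dim_range_inj[OF lin] by (simp add: layer_def Lag_def)
qed

context sturm_liouville begin

section \<open>Eigenspaces as kernels of forms\<close>

definition bd_values :: "(real \<Rightarrow> complex ^ 'n) \<Rightarrow> 'n bdspace" where
  "bd_values x = join (phase_curve P Q T x 0) (phase_curve P Q T x T)"

lemma bd_x_bd_values: "bd_x (bd_values x) = bd x"
  by (simp add: bd_x_def bd_values_def phase_curve_def bd_def)

lemma pairing_bd_values: "pairing (bd_values x) (bd w) = hermitian (qd x T) (w T) - hermitian (qd x 0) (w 0)"
  by (simp add: pairing_def bd_values_def phase_curve_def bd_def)

text \<open>Weak solutions are classical: being orthogonal to the constrained functions makes x a
  solution with multipliers, and further test functions remove the multipliers and yield the natural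
  boundary conditions.\<close>

lemma kernel_iff:
  assumes S: "vcs.hform UNIV S" and E: "vec.subspace E"
  shows "x \<in> cvs.kernel (dom_space E) (lform S \<mu>) \<longleftrightarrow>
    solves \<mu> 0 0 x \<and> bd x \<in> E \<and> (\<forall>\<eta>\<in>E. pairing (bd_values x) \<eta> + S (bd x) \<eta> = 0)"
proof
  assume "x \<in> cvs.kernel (dom_space E) (lform S \<mu>)"
  then have x: "x \<in> func_space" "bd x \<in> E" and k: "\<And>w. w \<in> dom_space E \<Longrightarrow> lform S \<mu> x w = 0"
    by (auto simp: cvs.kernel_def dom_space_def)
  obtain N where N: "coercive \<mu> N" using coercive_exists by blast
  obtain x0 y where d: "x0 \<in> constrained N" "y \<in> sols \<mu> N" "bd y = bd x" "x = x0 + y"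
    using decompose_sols[OF N x(1)] by blast
  obtain c where c: "solves \<mu> N c y" using d(2) by (auto simp: sols_def)
  have m: "x0 \<in> func_space" "y \<in> func_space" using d(1) solves_in[OF c] by (auto simp: constrained_def)
  note h = hform_lform[OF S, of \<mu>]
  have "lform S \<mu> x x0 = lform S \<mu> x0 x0 + lform S \<mu> y x0"
    unfolding d(4) by (rule cvs.hform_add_left[OF h m m(1)])
  note add = this
  have "lform S \<mu> y x0 = cnj (lform S \<mu> x0 y)" by (rule cvs.hform_cnj[OF h m])
  then have "lform S \<mu> y x0 = 0" by (simp only: lform_orth[OF S d(1,2)] complex_cnj_zero)
  moreover note add
  moreover have "lform S \<mu> x x0 = 0" using k constrained_sub[OF E] d(1) by blast
  ultimately have "lform S \<mu> x0 x0 = 0" by (simp only: add_0_right)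
  then have "Re (gform x0 x0) \<le> 0" using lform_constrained[OF N S d(1)] by simp
  then have "x0 = 0" using gform_pos[OF m(1)] by force
  then have xy: "x = y" using d(4) by simp
  \<comment> \<open>Testing against w with zero boundary values and moments equal to the multipliers
    leaves the sum of their squared norms.\<close>
  have c0: "c k = 0" if "k < N" for k
  proof -
    obtain w where w: "w \<in> sols \<mu> N" "bd w = 0" "\<And>k. k < N \<Longrightarrow> moment N k w = c k"
      using lift_boundary[OF N, of 0 c] by blast
    have wf: "w \<in> func_space" using w(1) solves_in by (auto simp: sols_def)
    have "w \<in> dom_space E" using w(2) wf vec.subspace_0[OF E] by (simp add: dom_space_def)
    then have "0 = lform S \<mu> y w" using k xy by simp
    also have "\<dots> = pairing (bd_values y) (bd w) + (\<Sum>k<N. hermitian (c k) (moment N k w)) + S (bd y) (bd w)"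
      unfolding lform_solves[OF c wf] pairing_bd_values ..
    also have "\<dots> = (\<Sum>k<N. hermitian (c k) (c k))"
      using w(2,3) vcs.hform_zero_right[OF S] by (simp add: pairing_linear)
    also have "\<dots> = complex_of_real (\<Sum>k<N. (norm (c k))\<^sup>2)" by (simp add: hermitian_self)
    finally have "(\<Sum>k<N. (norm (c k))\<^sup>2) = 0" by (metis of_real_eq_0_iff)
    then have "(norm (c k))\<^sup>2 = 0" using that by (simp add: sum_nonneg_eq_0_iff)
    then show ?thesis by simp
  qed
  have s: "solves \<mu> 0 0 x" using c c0 by (simp add: solves_def xy)
  \<comment> \<open>With the multipliers gone, a test function with boundary values \<eta> leaves
    exactly the boundary terms.\<close>
  have "pairing (bd_values x) \<eta> + S (bd x) \<eta> = 0" if \<eta>: "\<eta> \<in> E" for \<eta>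
  proof -
    obtain w where w: "w \<in> sols \<mu> N" "bd w = \<eta>" using lift_boundary[OF N, of \<eta> c] by blast
    have wf: "w \<in> func_space" using w(1) solves_in by (auto simp: sols_def)
    have "w \<in> dom_space E" using w(2) wf \<eta> by (simp add: dom_space_def)
    then have "0 = lform S \<mu> x w" using k by simp
    also have "\<dots> = pairing (bd_values x) (bd w) + S (bd x) (bd w)"
      unfolding lform_solves[OF s wf] pairing_bd_values by simp
    finally show ?thesis by (simp add: w(2))
  qed
  then show "solves \<mu> 0 0 x \<and> bd x \<in> E \<and> (\<forall>\<eta>\<in>E. pairing (bd_values x) \<eta> + S (bd x) \<eta> = 0)"
    using s x by blast
next
  assume a: "solves \<mu> 0 0 x \<and> bd x \<in> E \<and> (\<forall>\<eta>\<in>E. pairing (bd_values x) \<eta> + S (bd x) \<eta> = 0)"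
  then have s: "solves \<mu> 0 0 x" by blast
  have "lform S \<mu> x w = 0" if w: "w \<in> dom_space E" for w
  proof -
    have "w \<in> func_space" "bd w \<in> E" using w by (auto simp: dom_space_def)
    then show ?thesis
      unfolding lform_solves[OF s \<open>w \<in> func_space\<close>] pairing_bd_values[symmetric] using a by simp
  qed
  then show "x \<in> cvs.kernel (dom_space E) (lform S \<mu>)"
    using a solves_in[OF s] by (auto simp: cvs.kernel_def dom_space_def)
qed

text \<open>With all boundary values admissible the natural condition determines y(0) from x(0) and
  x(T). If these vanish, so do all Cauchy data at 0.\<close>

lemma kernel_Dirichlet:
  assumes S: "vcs.hform UNIV S"
  shows "cvs.kernel func_space (lform S \<mu>) \<inter> dom_space {0} \<subseteq> {0}"
proof clarify
  fix x assume x: "x \<in> cvs.kernel func_space (lform S \<mu>)" "x \<in> dom_space {0}"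
  have s: "solves \<mu> 0 0 x" and p: "\<And>\<eta>. pairing (bd_values x) \<eta> + S (bd x) \<eta> = 0"
    using x(1) kernel_iff[OF S vec.subspace_UNIV, of x \<mu>] by (auto simp: dom_space_UNIV)
  have b: "bd x = 0" using x(2) by (simp add: dom_space_def)
  then have x0: "x 0 = 0" using join_eq_iff[of "x 0" "x T" 0 0] by (simp add: bd_def)
  \<comment> \<open>This test vector turns the natural condition into the squared norm of
    y(0).\<close>
  have "pairing (bd_values x) (join (- qd x 0) 0) = 0"
    using p[of "join (- qd x 0) 0"] b vcs.hform_zero_left[OF S] by simp
  then have "hermitian (qd x 0) (- qd x 0) = 0" by (simp add: pairing_def bd_values_def phase_curve_def)
  then have "- hermitian (qd x 0) (qd x 0) = 0"
    using hermitian_cnj[of "qd x 0" "- qd x 0"] by (simp add: hermitian_minus_left)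
  then have "qd x 0 = 0" by (simp add: hermitian_self)
  then show "x = 0" by (intro solves_zero[OF s _ _ x0]) auto
qed

lemma H1_C1: "x \<in> func_space \<Longrightarrow> H1 T x"
  using C1_imp_has_weak_deriv[OF func_space_deriv func_space_cont(2)] by (auto simp: H1_def)

text \<open>An almost everywhere equation with continuous right-hand side integrates to a classical
  one. Conversely a classical solution has y of class H1, and dividing P x' = y - Q x by
  \<open>P\<close> shows that x is of class H2.\<close>

lemma eigenspace_iff: "x \<in> eigenspace P Q R T L \<mu> \<longleftrightarrow> solves \<mu> 0 0 x \<and> bd_values x \<in> L"
proof
  assume "x \<in> eigenspace P Q R T L \<mu>"
  then have H2: "H2 T x" and z: "\<And>t. t \<notin> {0..T} \<Longrightarrow> x t = 0" and L: "bd_values x \<in> L"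
    and ae: "AE t in lebesgue_on {0..T}. SL_op P Q R T x t = complex_of_real \<mu> *s x t"
    by (auto simp: eigenspace_def SL_dom_def bd_values_def)
  have x: "x \<in> func_space" using H2 z H1_continuous by (auto simp: func_space_def H2_def)
  have dd1: "H1 T (dd x)" using H2 by (simp add: H2_def)
  have "H1 T (\<lambda>t. cmat (P t) *v dd x t + cmat (Q t) *v x t)"
    by (intro H1_add H1_mult[OF cmat_bilinear] H1_P H1_Q dd1 H1_C1 x)
  then have "H1 T (qd x)" by (simp add: quasi_deriv_def[abs_def])
  then have g: "has_weak_deriv T (qd x) (weak_deriv T (qd x))"
    unfolding H1_def weak_deriv_def by (rule someI_ex)
  let ?g = "weak_deriv T (qd x)" and ?k = "\<lambda>t. low x t - \<mu> *\<^sub>R x t"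
  have ck: "continuous_on {0..T} ?k" by (intro continuous_intros func_space_cont x)
  have "AE t in lebesgue_on {0..T}. ?g t = ?k t"
    using ae
  proof (rule eventually_mono)
    fix t assume "SL_op P Q R T x t = complex_of_real \<mu> *s x t"
    then show "?g t = ?k t" by (simp add: SL_op_def low_def scaleR_eq_scale algebra_simps)
  qed
  then have "AE t in lebesgue. t \<in> {0..T} \<longrightarrow> ?g t = ?k t" by (simp add: AE_restrict_space_iff)
  then obtain A where A: "A \<in> null_sets lebesgue" "{t. \<not> (t \<in> {0..T} \<longrightarrow> ?g t = ?k t)} \<subseteq> A"
    by (auto simp: eventually_ae_filter)
  have nA: "negligible A" using A(1) by (simp add: negligible_iff_null_sets)
  have eq: "qd x 0 + integral {0..t} ?k = qd x t" if t: "t \<in> {0..T}" for t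
  proof -
    have "integral {0..t} ?g = integral {0..t} ?k"
      by (rule integral_spike[OF nA]) (use A(2) t in auto)
    then show ?thesis using has_weak_deriv_at[OF g t] by simp
  qed
  have "(qd x has_vector_derivative ?k t) (at t within {0..T})" if t: "t \<in> {0..T}" for t
  proof -
    have "((\<lambda>t. integral {0..t} ?k) has_vector_derivative ?k t) (at t within {0..T})"
      by (rule integral_has_vector_derivative[OF ck t])
    then have "((\<lambda>t. qd x 0 + integral {0..t} ?k) has_vector_derivative 0 + ?k t) (at t within {0..T})"
      by (intro has_vector_derivative_add has_vector_derivative_const)
    then have "(qd x has_vector_derivative 0 + ?k t) (at t within {0..T})"
      by (rule has_vector_derivative_transform[OF t, rotated]) (rule eq[symmetric])
    then show ?thesis by simp
  qed
  then show "solves \<mu> 0 0 x \<and> bd_values x \<in> L" using x L by (simp add: solves_def)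
next
  assume a: "solves \<mu> 0 0 x \<and> bd_values x \<in> L"
  then have x: "x \<in> func_space" using solves_in by blast
  let ?k = "\<lambda>t. low x t - \<mu> *\<^sub>R x t"
  have ck: "continuous_on {0..T} ?k" by (intro continuous_intros func_space_cont x)
  have qk: "has_weak_deriv T (qd x) ?k"
    using a by (intro C1_imp_has_weak_deriv ck) (simp add: solves_def)
  have "H1 T (qd x)" using qk by (auto simp: H1_def)
  then have "H1 T (\<lambda>t. qd x t - cmat (Q t) *v x t)"
    by (rule H1_diff[OF _ H1_mult[OF cmat_bilinear H1_Q H1_C1[OF x]]])
  then have "H1 T (\<lambda>t. cmat (P t) *v dd x t)" by (simp add: quasi_deriv_def)
  then have "H1 T (dd x)"
    by (rule H1_solve[OF cmat_bilinear H1_P _ func_space_cont(2)[OF x] cont_Pinv Pinv(1)])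
  then have "H2 T x" using x by (simp add: H2_def func_space_def)
  moreover have g: "has_weak_deriv T (qd x) (weak_deriv T (qd x))"
    unfolding weak_deriv_def by (rule someI[of "has_weak_deriv T (qd x)", OF qk])
  have "AE t in lebesgue_on {0..T}. SL_op P Q R T x t = complex_of_real \<mu> *s x t"
    using has_weak_deriv_unique[OF g qk]
  proof (rule eventually_mono)
    fix t assume "weak_deriv T (qd x) t = ?k t"
    then show "SL_op P Q R T x t = complex_of_real \<mu> *s x t"
      by (simp add: SL_op_def low_def scaleR_eq_scale)
  qed
  ultimately show "x \<in> eigenspace P Q R T L \<mu>"
    using a func_space_zero[OF x] by (simp add: eigenspace_def SL_dom_def bd_values_def)
qed

lemma eigenspace_eq_kernel:
  assumes "represents E S L"
  shows "eigenspace P Q R T L \<mu> = cvs.kernel (dom_space E) (lform S \<mu>)"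
proof -
  have S: "vcs.hform UNIV S" and E: "vec.subspace E"
    and r: "\<And>v. v \<in> L \<longleftrightarrow> bd_x v \<in> E \<and> (\<forall>\<eta>\<in>E. pairing v \<eta> + S (bd_x v) \<eta> = 0)"
    using assms by (auto simp: represents_def)
  show ?thesis
    by (rule set_eqI) (simp only: kernel_iff[OF S E] eigenspace_iff r bd_x_bd_values)
qed

text \<open>Semiboundedness of the form: the energy controls the boundary form up to a multiple of
  the L2 form.\<close>

lemma sform_lower:
  assumes S: "vcs.hform UNIV S"
  shows "\<exists>m. \<forall>x\<in>func_space. x \<noteq> 0 \<longrightarrow> m * Re (l2 x x) < Re (sform S x x)"
proof -
  obtain p C where p: "p > 0" "\<And>x. x \<in> func_space \<Longrightarrow> p * dnorm2 x - C * Re (l2 x x) \<le> Re (energy x x)"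
    using energy_lower by blast
  have "Re (hermitian v v) > 0" if "v \<noteq> 0" for v :: "complex ^ ('n + 'n)"
    using that by (simp add: hermitian_self)
  then obtain \<sigma> where \<sigma>: "\<sigma> > 0" "\<And>v. \<bar>Re (S v v)\<bar> \<le> \<sigma> * Re (hermitian v v)"
    using vcs.hform_bounded_by_definite[OF S hform_hermitian finite_cart_basis] span_cart_basis
    by (metis UNIV_I subset_UNIV)
  \<comment> \<open>The trace bound is taken with parameter p/\<sigma>, so that \<sigma> times its
    derivative term exactly matches the ellipticity term of the energy.\<close>
  define K where "K = 2 / T + 1 / (p / \<sigma>)"
  have "(- C - \<sigma> * K - 1) * Re (l2 x x) < Re (sform S x x)" if x: "x \<in> func_space" "x \<noteq> 0" for x
  proof -
    have "(norm (bd x))\<^sup>2 \<le> p / \<sigma> * dnorm2 x + K * Re (l2 x x)"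
      unfolding K_def using p(1) \<sigma>(1) by (intro trace_bound x) auto
    then have "\<sigma> * (norm (bd x))\<^sup>2 \<le> \<sigma> * (p / \<sigma> * dnorm2 x + K * Re (l2 x x))"
      using \<sigma>(1) by (intro mult_left_mono) auto
    also have "\<dots> = p * dnorm2 x + \<sigma> * K * Re (l2 x x)" using \<sigma>(1) by (simp add: distrib_left)
    finally have "- Re (S (bd x) (bd x)) \<le> p * dnorm2 x + \<sigma> * K * Re (l2 x x)"
      using \<sigma>(2)[of "bd x"] by (simp add: hermitian_self)
    moreover have "Re (l2 x x) > 0" by (rule l2_pos[OF x])
    ultimately show ?thesis using p(2)[OF x(1)] by (simp add: algebra_simps)
  qed
  then show ?thesis by blast
qed

text \<open>The bridge to the statement: the enumeration built from the indices is the one selected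
  in \<open>eigval\<close>, up to its value at 0.\<close>

lemma eigval_characterization:
  assumes rep: "represents E S L" and i: "1 \<le> i"
  shows "\<exists>e. eigval P Q R T L (int i) = ereal e \<and>
    (\<forall>t. e \<le> t \<longleftrightarrow> cvs.npos (dom_space E) (lform S t) i) \<and>
    (\<forall>t. e < t \<longleftrightarrow> cvs.neg (dom_space E) (lform S t) i)"
proof -
  have S: "vcs.hform UNIV S" and E: "vec.subspace E" using rep by (auto simp: represents_def)
  have sub: "x \<in> dom_space E \<Longrightarrow> x \<in> func_space" for x by (simp add: dom_space_def)
  obtain m where m: "\<And>x. x \<in> func_space \<Longrightarrow> x \<noteq> 0 \<Longrightarrow> m * Re (l2 x x) < Re (sform S x x)"
    using sform_lower[OF S] by blast
  obtain l where l: "\<And>i t. 1 \<le> i \<Longrightarrow> l i \<le> t \<longleftrightarrow> cvs.npos (dom_space E) (lform S t) i"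
    "\<And>i t. 1 \<le> i \<Longrightarrow> l i < t \<longleftrightarrow> cvs.neg (dom_space E) (lform S t) i"
    "\<And>i k. 1 \<le> i \<Longrightarrow> i \<le> k \<Longrightarrow> l i \<le> l k"
    "\<And>\<mu>. finite {i. 1 \<le> i \<and> l i = \<mu>} \<and>
       card {i. 1 \<le> i \<and> l i = \<mu>} = cfun.dim (cvs.kernel (dom_space E) (lform S \<mu>))"
  proof (rule cvs.spectral_enumeration[of "dom_space E" "sform S" l2 gform m])
    show "cvs.hform (dom_space E) (sform S)" by (rule hform_dom[OF hform_sform[OF S] E])
    show "cvs.hform (dom_space E) l2" by (rule hform_dom[OF hform_l2 E])
    show "cvs.hform (dom_space E) gform" by (rule hform_dom[OF hform_gform E])
    show "cvs.regular (dom_space E) gform (lform S \<theta>)" for \<theta> by (rule lform_regular[OF S E])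
    show "\<exists>C\<subseteq>dom_space E. finite C \<and> cfun.independent C \<and> card C = k" for k
      by (rule infinite_dimensional[OF E])
  qed (use sub l2_pos l2_le_gform m in auto)
  have enum: "is_eigenvalue_enum P Q R T L l"
    unfolding is_eigenvalue_enum_def eigenspace_eq_kernel[OF rep] using l(3,4) by blast
  define l' where "l' = (SOME l. is_eigenvalue_enum P Q R T L l)"
  have enum': "is_eigenvalue_enum P Q R T L l'" unfolding l'_def
    by (rule someI[of "is_eigenvalue_enum P Q R T L", OF enum])
  have mono': "l' i \<le> l' k" if "1 \<le> i" "i \<le> k" for i k
    using enum' that unfolding is_eigenvalue_enum_def by blast
  have fib': "finite {i. 1 \<le> i \<and> l' i = \<mu>}"
    "card {i. 1 \<le> i \<and> l' i = \<mu>} = cfun.dim (cvs.kernel (dom_space E) (lform S \<mu>))" for \<mu>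
    using enum' unfolding is_eigenvalue_enum_def eigenspace_eq_kernel[OF rep] by blast+
  have "l i = l' i"
  proof (rule enumeration_unique[of l l', OF l(3) mono' _ conjunct1[OF l(4)] fib'(1) _ i])
    show "card {i. 1 \<le> i \<and> l i = \<mu>} = card {i. 1 \<le> i \<and> l' i = \<mu>}" for \<mu>
      by (rule trans[OF conjunct2[OF l(4)] fib'(2)[symmetric]])
    show "finite {i. 1 \<le> i \<and> l i \<le> t}" for t
    proof -
      obtain X0 Bp Bz Bn \<epsilon> where d: "cvs.diag (dom_space E) (lform S t) X0 Bp Bz Bn"
        and "\<epsilon> > 0" "\<And>x. x \<in> X0 \<Longrightarrow> \<epsilon> * Re (gform x x) \<le> Re (lform S t x x)"
        and pos: "\<And>x. x \<in> X0 \<Longrightarrow> x \<noteq> 0 \<Longrightarrow> Re (lform S t x x) > 0"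
        by (rule cvs.regularE[OF lform_regular[OF S E, of t] gform_pos[OF sub]]) (assumption, assumption, rule that)
      have idx: "cvs.npos (dom_space E) (lform S t) k \<longleftrightarrow> k \<le> card Bz + card Bn" for k
        by (rule cvs.index_diag(1)[OF hform_dom[OF hform_lform[OF S] E] d]) (erule (1) pos)
      have "{i. 1 \<le> i \<and> l i \<le> t} \<subseteq> {..card Bz + card Bn}"
      proof
        fix i assume "i \<in> {i. 1 \<le> i \<and> l i \<le> t}"
        then have "cvs.npos (dom_space E) (lform S t) i" using l(1)[of i t] by simp
        then show "i \<in> {..card Bz + card Bn}" using idx by (simp only: atMost_iff)
      qed
      then show ?thesis by (rule finite_subset) simp
    qed
  qed
  then have "eigval P Q R T L (int i) = ereal (l i)" using i by (simp add: eigval_def l'_def)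
  then show ?thesis using l(1,2)[OF i] by blast
qed

end

section \<open>The range of an eigenvalue\<close>

context sturm_liouville begin

lemma dom_Dirichlet_sub: "vec.subspace E \<Longrightarrow> dom_space {0} \<subseteq> dom_space E"
  by (auto simp: dom_space_def vec.subspace_0)

lemma lform_Dirichlet:
  assumes S: "vcs.hform UNIV S" and x: "x \<in> dom_space {0}"
  shows "Re (lform S \<mu> x x) = Re (lform (\<lambda>_ _. 0) \<mu> x x)"
  using x vcs.hform_zero_left[OF S] by (simp add: dom_space_def)

lemma hform_zero_form: "vcs.hform UNIV (\<lambda>_ _. 0)"
  by (auto intro!: vcs.hformI)

lemma hform_dom_Dirichlet: "vcs.hform UNIV S \<Longrightarrow> cvs.hform (dom_space {0}) (lform S \<mu>)"
  by (rule hform_dom[OF hform_lform vec.subspace_single_0])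

lemma npos_Dirichlet_cong:
  assumes "vcs.hform UNIV S"
  shows "cvs.npos (dom_space {0}) (lform S \<mu>) j \<longleftrightarrow> cvs.npos (dom_space {0}) (lform (\<lambda>_ _. 0) \<mu>) j"
proof
  show "cvs.npos (dom_space {0}) (lform (\<lambda>_ _. 0) \<mu>) j" if "cvs.npos (dom_space {0}) (lform S \<mu>) j"
    using lform_Dirichlet[OF assms, of _ \<mu>]
    by (intro cvs.npos_antimono[OF hform_dom_Dirichlet[OF assms] _ that]) (simp only: order_refl)
  show "cvs.npos (dom_space {0}) (lform S \<mu>) j" if "cvs.npos (dom_space {0}) (lform (\<lambda>_ _. 0) \<mu>) j"
    using lform_Dirichlet[OF assms, of _ \<mu>]
    by (intro cvs.npos_antimono[OF hform_dom_Dirichlet[OF assms] _ that]) (simp only: order_refl)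
qed

lemma neg_Dirichlet_cong:
  assumes "vcs.hform UNIV S" "cvs.neg (dom_space {0}) (lform S \<mu>) j"
  shows "cvs.neg (dom_space {0}) (lform (\<lambda>_ _. 0) \<mu>) j"
proof -
  obtain C where C: "C \<subseteq> dom_space {0}" "finite C" "cfun.independent C" "card C = j"
    "\<And>x. x \<in> cfun.span C \<Longrightarrow> x \<noteq> 0 \<Longrightarrow> Re (lform S \<mu> x x) < 0"
    using assms(2) unfolding cvs.neg_def by blast
  have "Re (lform (\<lambda>_ _. 0) \<mu> x x) < 0" if "x \<in> cfun.span C" "x \<noteq> 0" for x
  proof -
    have "x \<in> dom_space {0}"
      using that(1) cfun.span_minimal[OF C(1) dom_space_subspace[OF vec.subspace_single_0]] by blast
    then show ?thesis using C(5)[OF that] lform_Dirichlet[OF assms(1), of x \<mu>] by (simp only:)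
  qed
  then show ?thesis unfolding cvs.neg_def using C(1-4) by blast
qed

lemma eigval_Dirichlet:
  assumes "1 \<le> i"
  shows "\<exists>e. eigval P Q R T Dirichlet (int i) = ereal e \<and>
    (\<forall>t. e \<le> t \<longleftrightarrow> cvs.npos (dom_space {0}) (lform (\<lambda>_ _. 0) t) i) \<and>
    (\<forall>t. e < t \<longleftrightarrow> cvs.neg (dom_space {0}) (lform (\<lambda>_ _. 0) t) i)"
  by (rule eigval_characterization[OF Dirichlet_represents assms])

lemma eigval_le_Dirichlet:
  assumes rep: "represents E S L" and j: "1 \<le> j"
  shows "eigval P Q R T L (int j) \<le> eigval P Q R T Dirichlet (int j)"
proof -
  have S: "vcs.hform UNIV S" and E: "vec.subspace E" using rep by (auto simp: represents_def)
  obtain e where e: "eigval P Q R T L (int j) = ereal e" "\<And>t. e \<le> t \<longleftrightarrow> cvs.npos (dom_space E) (lform S t) j"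
    using eigval_characterization[OF rep j] by blast
  obtain d where d: "eigval P Q R T Dirichlet (int j) = ereal d"
    "\<And>t. d \<le> t \<longleftrightarrow> cvs.npos (dom_space {0}) (lform (\<lambda>_ _. 0) t) j"
    using eigval_Dirichlet[OF j] by blast
  have "cvs.npos (dom_space {0}) (lform S d) j" using d(2)[of d] npos_Dirichlet_cong[OF S] by blast
  then have "cvs.npos (dom_space E) (lform S d) j" by (rule cvs.npos_mono[OF _ dom_Dirichlet_sub[OF E]])
  then show ?thesis using e d by simp
qed

text \<open>At the j-th Dirichlet eigenvalue there is a nonpositive j-dimensional space of functions
  vanishing at the ends; it misses the kernel of the larger problem, so a negative one exists
  there.\<close>

lemma eigval_less_Dirichlet:
  assumes rep: "represents UNIV S L" and j: "1 \<le> j"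
  shows "eigval P Q R T L (int j) < eigval P Q R T Dirichlet (int j)"
proof -
  have S: "vcs.hform UNIV S" using rep by (auto simp: represents_def)
  obtain e where e: "eigval P Q R T L (int j) = ereal e" "\<And>t. e < t \<longleftrightarrow> cvs.neg (dom_space UNIV) (lform S t) j"
    using eigval_characterization[OF rep j] by blast
  obtain d where d: "eigval P Q R T Dirichlet (int j) = ereal d"
    "\<And>t. d \<le> t \<longleftrightarrow> cvs.npos (dom_space {0}) (lform (\<lambda>_ _. 0) t) j"
    using eigval_Dirichlet[OF j] by blast
  have n: "cvs.npos (dom_space {0}) (lform S d) j" using d(2)[of d] npos_Dirichlet_cong[OF S] by blast
  have "cvs.neg func_space (lform S d) j"
    by (rule cvs.npos_subspace_imp_neg[OF hform_lform[OF S] lform_regular[OF S vec.subspace_UNIV, unfolded dom_space_UNIV]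
          gform_pos dom_space_subspace[OF vec.subspace_single_0]
          dom_Dirichlet_sub[OF vec.subspace_UNIV, unfolded dom_space_UNIV] kernel_Dirichlet[OF S] n])
  then show ?thesis using e d by (simp add: dom_space_UNIV)
qed

text \<open>The nonpositive j-space is first regarded in the full function space, where the
  Dirichlet functions have codimension 2n; passing to them loses at most 2n dimensions and gains
  strictness.\<close>

lemma Dirichlet_less_eigval:
  assumes rep: "represents E S L" and j: "1 \<le> j"
  shows "eigval P Q R T Dirichlet (int j - 2 * int CARD('n)) < eigval P Q R T L (int j)"
proof -
  have S: "vcs.hform UNIV S" and E: "vec.subspace E" using rep by (auto simp: represents_def)
  obtain e where e: "eigval P Q R T L (int j) = ereal e" "\<And>t. e \<le> t \<longleftrightarrow> cvs.npos (dom_space E) (lform S t) j"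
    using eigval_characterization[OF rep j] by blast
  show ?thesis
  proof (cases "j \<le> 2 * CARD('n)")
    \<comment> \<open>Here the shifted index is at most 0, so the lower bound is -\<infinity> by
      convention.\<close>
    case True
    then show ?thesis using e by (simp add: eigval_def)
  next
    case False
    define k where "k = j - 2 * CARD('n)"
    have k: "1 \<le> k" "int j - 2 * int CARD('n) = int k" using False by (auto simp: k_def)
    obtain d where d: "eigval P Q R T Dirichlet (int k) = ereal d"
      "\<And>t. d < t \<longleftrightarrow> cvs.neg (dom_space {0}) (lform (\<lambda>_ _. 0) t) k"
      using eigval_Dirichlet[OF k(1)] by blast
    obtain N where N: "coercive e N" using coercive_exists by blast
    obtain C where C: "finite C" "card C = 2 * CARD('n)"
      "\<And>x. x \<in> func_space \<Longrightarrow> \<exists>w\<in>cfun.span C. x - w \<in> dom_space {0}"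
      using boundary_complement[OF N] by metis
    have "cvs.npos (dom_space E) (lform S e) j" using e(2) by blast
    then have n: "cvs.npos func_space (lform S e) j"
      by (rule cvs.npos_mono) (auto simp: dom_space_def)
    have "cvs.neg (dom_space {0}) (lform S e) (j - card C)"
      by (rule cvs.npos_imp_neg_subspace[OF hform_lform[OF S] lform_regular[OF S vec.subspace_UNIV, unfolded dom_space_UNIV]
            gform_pos dom_space_subspace[OF vec.subspace_single_0]
            dom_Dirichlet_sub[OF vec.subspace_UNIV, unfolded dom_space_UNIV]
            lform_regular[OF S vec.subspace_single_0] kernel_Dirichlet[OF S] C(1,3) n])
    then have "d < e" using d(2) neg_Dirichlet_cong[OF S] C(2) by (simp only: k_def)
    then show ?thesis using e(1) d(1) k(2) by simp
  qed
qed

text \<open>The two bounds on \<mu> say that the Dirichlet form at \<mu> has nonpositive index below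
  j and negative index at least j - 2n. A Robin term can therefore bring the j-th eigenvalue exactly
  to \<mu>.\<close>

lemma eigval_robin_surj:
  assumes j: "1 \<le> j"
    and lower: "eigval P Q R T Dirichlet (int j - 2 * int CARD('n)) < ereal \<mu>"
    and upper: "ereal \<mu> < eigval P Q R T Dirichlet (int j)"
  shows "\<exists>s. eigval P Q R T (robin s) (int j) = ereal \<mu>"
proof -
  let ?h = "lform (\<lambda>_ _. 0) \<mu>" and ?r = "\<lambda>x w. hermitian (bd x) (bd w)" and ?Y = "dom_space {0}"
  define S where "S s = (\<lambda>\<xi> \<eta>. complex_of_real s * hermitian \<xi> (\<eta> :: complex ^ ('n + 'n)))" for s :: real
  have S: "vcs.hform UNIV (S s)" for s unfolding S_def by (intro vcs.hform_cmult hform_hermitian)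
  have eq: "(\<lambda>x w. ?h x w + complex_of_real s * ?r x w) = lform (S s) \<mu>" for s
    by (simp add: fun_eq_iff S_def)
  obtain d where d: "eigval P Q R T Dirichlet (int j) = ereal d"
    "\<And>t. d \<le> t \<longleftrightarrow> cvs.npos ?Y (lform (\<lambda>_ _. 0) t) j"
    using eigval_Dirichlet[OF j] by blast
  obtain N where N: "coercive \<mu> N" using coercive_exists by blast
  obtain C where C: "finite C" "C \<subseteq> sols \<mu> N" "cfun.independent C" "card C = 2 * CARD('n)"
    "cfun.span C \<inter> ?Y \<subseteq> {0}" "\<And>x. x \<in> func_space \<Longrightarrow> \<exists>w\<in>cfun.span C. x - w \<in> ?Y"
    using boundary_complement[OF N] by metis
  have C2: "C \<subseteq> func_space" using C(2) solves_in by (auto simp: sols_def)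
  obtain Bp Bz Bn where diag: "cvs.diag ?Y ?h (constrained N) Bp Bz Bn"
    using lform_diag[OF N hform_zero_form vec.subspace_single_0] .
  have cs: "constrained N \<subseteq> func_space" by (auto simp: constrained_def)
  have "\<exists>s. cvs.npos func_space (\<lambda>x w. ?h x w + complex_of_real s * ?r x w) j \<and>
      \<not> cvs.neg func_space (\<lambda>x w. ?h x w + complex_of_real s * ?r x w) j"
  proof (rule cvs.exists_intermediate_index[where g = gform and Y = ?Y and C = C])
    show "cvs.diag ?Y ?h (constrained N) Bp Bz Bn" by (rule diag)
    show "cvs.hform func_space ?h" by (rule hform_lform[OF hform_zero_form])
    show "cvs.hform func_space ?r" by (rule hform_bd[OF hform_hermitian])
    show "cvs.hform func_space gform" by (rule hform_gform)
    show "cfun.subspace ?Y" by (rule dom_space_subspace[OF vec.subspace_single_0])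
    show "?Y \<subseteq> func_space" by (auto simp: dom_space_def)
    show "0 < Re (gform x x)" if "x \<in> func_space" "x \<noteq> 0" for x by (rule gform_pos[OF that])
    show "0 \<le> Re (?r x x)" for x by (simp add: hermitian_self)
    show "Re (?r x x) \<le> Re (gform x x)" if "x \<in> func_space" for x
      using l2_pos[OF that] cvs.hform_zero_left[OF hform_l2 that] by (cases "x = 0") (auto simp: gform_def)
    show "?r x y = 0" if "x \<in> ?Y" for x y using that by (simp add: dom_space_def)
    show "x \<in> ?Y" if "x \<in> func_space" "Re (?r x x) = 0" for x
      using that by (simp add: dom_space_def hermitian_self)
    show "cvs.regular func_space gform (\<lambda>x w. ?h x w + complex_of_real s * ?r x w)" for s
      unfolding eq using lform_regular[OF S vec.subspace_UNIV] by (simp only: dom_space_UNIV)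
    show "Re (?h x x) > 0" if "x \<in> constrained N" "x \<noteq> 0" for x
      using lform_constrained[OF N hform_zero_form that(1)] gform_pos[OF _ that(2)] that(1) cs by fastforce
    show "?h c y = 0" if "c \<in> C" "y \<in> constrained N" for c y
    proof -
      have "?h c y = cnj (?h y c)"
        by (rule cvs.hform_cnj[OF hform_lform[OF hform_zero_form]]) (use that cs C2 in auto)
      also have "?h y c = 0" by (rule lform_orth[OF hform_zero_form that(2)]) (use that C(2) in auto)
      finally show ?thesis by simp
    qed
    show "\<not> cvs.npos ?Y ?h j" using d(2)[of \<mu>] d(1) upper by simp
    show "cvs.neg ?Y ?h (j - card C)"
    proof (cases "j \<le> 2 * CARD('n)")
      \<comment> \<open>Truncated subtraction gives dimension 0, for which the empty family is a
        witness.\<close>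
      case True
      then show ?thesis unfolding cvs.neg_def C(4)
        using cfun.independent_empty by (intro exI[of _ "{}"]) simp
    next
      case False
      define k where "k = j - 2 * CARD('n)"
      have k: "1 \<le> k" "int j - 2 * int CARD('n) = int k" using False by (auto simp: k_def)
      obtain c where c: "eigval P Q R T Dirichlet (int k) = ereal c"
        "\<And>t. c < t \<longleftrightarrow> cvs.neg ?Y (lform (\<lambda>_ _. 0) t) k"
        using eigval_Dirichlet[OF k(1)] by blast
      have "c < \<mu>" using lower c(1) k(2) by simp
      then show ?thesis using c(2) C(4) by (simp only: k_def)
    qed
  qed (use C C2 in auto)
  then obtain s where s: "cvs.npos func_space (lform (S s) \<mu>) j" "\<not> cvs.neg func_space (lform (S s) \<mu>) j"
    unfolding eq by blast
  have "represents UNIV (S s) (robin s)" unfolding S_def by (rule robin_represents)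
  then obtain e where e: "eigval P Q R T (robin s) (int j) = ereal e"
    "\<And>t. e \<le> t \<longleftrightarrow> cvs.npos func_space (lform (S s) t) j" "\<And>t. e < t \<longleftrightarrow> cvs.neg func_space (lform (S s) t) j"
    using eigval_characterization[OF _ j] unfolding dom_space_UNIV[symmetric] by blast
  have "e \<le> \<mu>" "\<not> e < \<mu>" using e(2)[of \<mu>] e(3)[of \<mu>] s by blast+
  then show ?thesis using e(1) by (intro exI[of _ s]) simp
qed

lemma eigval_range:
  assumes j: "1 \<le> j"
  shows "(\<lambda>L. eigval P Q R T L (int j)) ` Lag =
           {eigval P Q R T Dirichlet (int j - 2 * int CARD('n)) <..
            eigval P Q R T Dirichlet (int j)}"
    and "(\<lambda>L. eigval P Q R T L (int j)) ` layer 0 =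
           {eigval P Q R T Dirichlet (int j - 2 * int CARD('n)) <..<
            eigval P Q R T Dirichlet (int j)}"
proof -
  let ?l = "\<lambda>L. eigval P Q R T L (int j)"
  let ?a = "eigval P Q R T Dirichlet (int j - 2 * int CARD('n))" and ?b = "?l Dirichlet"
  obtain d where b: "?b = ereal d" using eigval_Dirichlet[OF j] by blast
  have sub: "layer 0 \<subseteq> (Lag :: 'n bdspace set set)" by (auto simp: layer_def)
  have low: "?a < ?l L" if "L \<in> Lag" for L
    using Lag_represents[OF that] Dirichlet_less_eigval[OF _ j] by blast
  have up: "?l L \<le> ?b" if "L \<in> Lag" for L
    using Lag_represents[OF that] eigval_le_Dirichlet[OF _ j] by blast
  have up0: "?l L < ?b" if L: "L \<in> layer 0" for L
  proof -
    have "L \<in> Lag" using L sub by blast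
    then obtain S where "represents (bd_x ` L) S L" using Lag_represents by blast
    then show ?thesis unfolding layer_0_bd_x[OF L] by (rule eigval_less_Dirichlet[OF _ j])
  qed
  have mid: "x \<in> ?l ` layer 0" if x: "?a < x" "x < ?b" for x
  proof -
    obtain \<mu> where \<mu>: "x = ereal \<mu>" using x b by (cases x) auto
    obtain s where "?l (robin s) = ereal \<mu>" using eigval_robin_surj[OF j, of \<mu>] x \<mu> by blast
    then show ?thesis using robin_layer_0[of s] \<mu> by (intro image_eqI[of _ _ "robin s"]) simp_all
  qed
  show "?l ` layer 0 = {?a<..<?b}" using low up0 mid sub by fastforce
  show "?l ` Lag = {?a<..?b}"
  proof (intro equalityI subsetI)
    fix x assume x: "x \<in> {?a<..?b}"
    show "x \<in> ?l ` Lag"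
    \<comment> \<open>The closed upper end is attained by the Dirichlet condition itself; everything
      below comes from the zeroth layer.\<close>
    proof (cases "x = ?b")
      case True
      then show ?thesis using Dirichlet_Lag by blast
    next
      case False
      then have "x \<in> ?l ` layer 0" using x by (intro mid) auto
      then show ?thesis using sub by blast
    qed
  qed (use low up in auto)
qed

end

theorem corollary1p3:
  fixes P Q R :: "real \<Rightarrow> real ^ 'n ^ 'n::finite" and T :: real and j :: nat
  assumes "T > 0"
    and "H1 T P" and "H1 T Q" and "continuous_on {0..T} R"
    and "\<forall>t\<in>{0..T}. transpose (P t) = P t"
    and "\<forall>t\<in>{0..T}. transpose (R t) = R t"
    and "\<forall>t\<in>{0..T}. \<forall>v. v \<noteq> 0 \<longrightarrow> v \<bullet> (P t *v v) > 0"
    and "j \<ge> 1"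
  shows "(\<lambda>L. eigval P Q R T L (int j)) ` Lag =
           {eigval P Q R T Dirichlet (int j - 2 * int CARD('n)) <..
            eigval P Q R T Dirichlet (int j)} \<and>
         (\<lambda>L. eigval P Q R T L (int j)) ` layer 0 =
           {eigval P Q R T Dirichlet (int j - 2 * int CARD('n)) <..<
            eigval P Q R T Dirichlet (int j)}"
proof -
  interpret sturm_liouville P Q R T
    using assms by unfold_locales auto
  show ?thesis using eigval_range[OF \<open>j \<ge> 1\<close>] by blast
qed

end
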